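(* Let $p,q:\mathbb N\to\mathbb Z$ be sequences of integers such that $p(n+1)-p(n)\to+\infty$ and $q(n+1)-q(n)\to+\infty$ as $n\to\infty$. Then there exist automorphisms $S,T$ of a standard (Lebesgue) probability space $(X,\mu)$, each having simple singular spectrum, such that the sequence $$\frac1N\sum_{n=1}^{N}\mu\bigl(S^{p(n)}C\cap T^{q(n)}C\bigr),\qquad N=1,2,\dots,$$ diverges (does not converge as $N\to\infty$) for some measurable set $C\subset X$.
   Context: An automorphism of $(X,\mu)$ is an invertible measure-preserving transformation. It is identified with the unitary operator it induces on $L_2(X,\mu)$. The spectrum is simple if this operator has a cyclic vector (the closed linear span of the orbit of some vector under all integer powers of the operator is the whole space). The spectrum is singular if the maximal spectral type of the operator on the unit circle is singular with respect to Lebesgue measure. *)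

theory Defs
  imports "HOL-Probability.Probability"
begin

section \<open>Lebesgue probability spaces and automorphisms\<close>

definition measure_iso :: "'a measure \<Rightarrow> 'b measure \<Rightarrow> ('a \<Rightarrow> 'b) \<Rightarrow> bool" where
  "measure_iso M N f \<longleftrightarrow>
     bij_betw f (space M) (space N) \<and>
     f \<in> measurable M N \<and>
     inv_into (space M) f \<in> measurable N M \<and>
     distr M N f = N"

definition isomorphic_mod0 :: "'a measure \<Rightarrow> 'b measure \<Rightarrow> bool" where
  "isomorphic_mod0 M N \<longleftrightarrow>
     (\<exists>A\<in>sets M. \<exists>B\<in>sets N.
        emeasure M (space M - A) = 0 \<and> emeasure N (space N - B) = 0 \<and>
        (\<exists>f. measure_iso (restrict_space M A) (restrict_space N B) f))"

text \<open>Rokhlin's notion of a (non-atomic) standard probability space: a complete probability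
  space isomorphic, up to null sets, to the unit interval with Lebesgue measure.\<close>

definition lebesgue_probability_space :: "'a measure \<Rightarrow> bool" where
  "lebesgue_probability_space M \<longleftrightarrow>
     prob_space M \<and> complete_measure M \<and> isomorphic_mod0 M (lebesgue_on {0..1::real})"

definition automorphism :: "'a measure \<Rightarrow> ('a \<Rightarrow> 'a) \<Rightarrow> bool" where
  "automorphism M T \<longleftrightarrow> measure_iso M M T"

text \<open>The integer iterate \<open>T\<^sup>k\<close>; the inverse is taken on \<open>space M\<close>, so for an
  automorphism the values are meaningful at points of \<open>space M\<close>.\<close>

definition iterate :: "'a measure \<Rightarrow> ('a \<Rightarrow> 'a) \<Rightarrow> int \<Rightarrow> 'a \<Rightarrow> 'a" where
  "iterate M T k =
     (if 0 \<le> k then T ^^ nat k else inv_into (space M) T ^^ nat (- k))"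


section \<open>The induced unitary operator\<close>

text \<open>Elements of the complex Hilbert space \<open>L\<^sub>2(M)\<close> are represented by square-integrable
  functions; functions that agree almost everywhere are at distance 0.\<close>

definition L2 :: "'a measure \<Rightarrow> ('a \<Rightarrow> complex) set" where
  "L2 M = {f \<in> borel_measurable M. integrable M (\<lambda>x. (cmod (f x))\<^sup>2)}"

definition L2_inner :: "'a measure \<Rightarrow> ('a \<Rightarrow> complex) \<Rightarrow> ('a \<Rightarrow> complex) \<Rightarrow> complex" where
  "L2_inner M f g = (LINT x|M. f x * cnj (g x))"

definition L2_norm :: "'a measure \<Rightarrow> ('a \<Rightarrow> complex) \<Rightarrow> real" where
  "L2_norm M f = sqrt (LINT x|M. (cmod (f x))\<^sup>2)"

definition L2_closed_span :: "'a measure \<Rightarrow> ('a \<Rightarrow> complex) set \<Rightarrow> ('a \<Rightarrow> complex) set" where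
  "L2_closed_span M F =
     {g \<in> L2 M. \<forall>\<epsilon>>0. \<exists>B c. finite B \<and> B \<subseteq> F \<and>
        L2_norm M (\<lambda>x. g x - (\<Sum>h\<in>B. c h * h x)) < \<epsilon>}"

definition koopman_power ::
    "'a measure \<Rightarrow> ('a \<Rightarrow> 'a) \<Rightarrow> int \<Rightarrow> ('a \<Rightarrow> complex) \<Rightarrow> 'a \<Rightarrow> complex" where
  "koopman_power M T k f = (\<lambda>x. f (iterate M T k x))"

definition cyclic_vector :: "'a measure \<Rightarrow> ('a \<Rightarrow> 'a) \<Rightarrow> ('a \<Rightarrow> complex) \<Rightarrow> bool" where
  "cyclic_vector M T f \<longleftrightarrow>
     f \<in> L2 M \<and> L2_closed_span M (range (\<lambda>k. koopman_power M T k f)) = L2 M"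

definition simple_spectrum :: "'a measure \<Rightarrow> ('a \<Rightarrow> 'a) \<Rightarrow> bool" where
  "simple_spectrum M T \<longleftrightarrow> (\<exists>f. cyclic_vector M T f)"


section \<open>Spectral measures on the unit circle\<close>

definition circle_borel :: "complex measure" where
  "circle_borel = restrict_space borel (sphere 0 1)"

text \<open>Arc length, i.e. Lebesgue measure of total mass \<open>2\<pi>\<close>.\<close>

definition circle_lebesgue :: "complex measure" where
  "circle_lebesgue = distr (restrict_space lborel {0..<2 * pi}) circle_borel cis"

definition spectral_measure ::
    "'a measure \<Rightarrow> ('a \<Rightarrow> 'a) \<Rightarrow> ('a \<Rightarrow> complex) \<Rightarrow> complex measure \<Rightarrow> bool" where
  "spectral_measure M T f \<sigma> \<longleftrightarrow>
     finite_measure \<sigma> \<and> sets \<sigma> = sets circle_borel \<and>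
     (\<forall>k::int. (LINT z|\<sigma>. z powi k) = L2_inner M (koopman_power M T k f) f)"

text \<open>The maximal spectral type is a measure class; \<open>\<sigma>\<close> below is a representative of it that
  is itself the spectral measure of a vector. Recall that \<open>absolutely_continuous \<sigma> \<rho>\<close> means
  that \<open>\<rho>\<close> is absolutely continuous with respect to \<open>\<sigma>\<close>.\<close>

definition maximal_spectral_measure ::
    "'a measure \<Rightarrow> ('a \<Rightarrow> 'a) \<Rightarrow> complex measure \<Rightarrow> bool" where
  "maximal_spectral_measure M T \<sigma> \<longleftrightarrow>
     (\<exists>h\<in>L2 M. spectral_measure M T h \<sigma>) \<and>
     (\<forall>f\<in>L2 M. \<forall>\<rho>. spectral_measure M T f \<rho> \<longrightarrow> absolutely_continuous \<sigma> \<rho>)"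

definition mutually_singular :: "'a measure \<Rightarrow> 'a measure \<Rightarrow> bool" where
  "mutually_singular \<mu> \<nu> \<longleftrightarrow>
     sets \<mu> = sets \<nu> \<and>
     (\<exists>A\<in>sets \<mu>. emeasure \<mu> A = 0 \<and> emeasure \<nu> (space \<nu> - A) = 0)"

definition singular_spectrum :: "'a measure \<Rightarrow> ('a \<Rightarrow> 'a) \<Rightarrow> bool" where
  "singular_spectrum M T \<longleftrightarrow>
     (\<exists>\<sigma>. maximal_spectral_measure M T \<sigma> \<and> mutually_singular \<sigma> circle_lebesgue)"

end

theory Submission
  imports Defs
begin

text \<open>
  The automorphisms are limits of cyclic permutations of the cells \<open>[k/m, (k+1)/m)\<close> of the unit
  interval, with \<open>m\<close> multiplied at each stage. Passing to the next stage, the two cyclic orders are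
  followed for a long time \<open>L\<close> and then shifted by an independent uniformly distributed amount, over all
  words of shifts. Since the gaps of \<open>p\<close> and \<open>q\<close> eventually exceed \<open>L\<close>, the cells seen at
  the times \<open>0\<close> and \<open>p n\<close> (\<open>n\<close> in a long window) lie in different blocks and so are independent and
  uniform, and likewise for \<open>q n\<close>. Hence the points of the two finite systems can be identified in such a
  way that the present cells agree while the cells at the times \<open>p n\<close> and \<open>q n\<close> are almost always equal,
  or almost always in opposite halves of the interval. With \<open>C\<close> the left half, the averages are
  driven close to \<open>1/2\<close> and to \<open>0\<close> alternately.

  All later changes can be made small compared with any quantity of the present stage. This makes the
  limits rigid along the orders \<open>m\<close> of the permutations, and makes a suitable sum of small multiples of
  indicators of cells cyclic for both of them: at every stage a multiple can be chosen for which no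
  Fourier coefficient along either cycle vanishes. The spectral measure of a cyclic vector (which exists by
  Herglotz' theorem) has maximal type, and it is singular because \<open>z\<^sup>m \<longrightarrow> 1\<close> almost everywhere along
  a rigidity sequence.
\<close>

section \<open>Square-integrable functions and the Koopman representation\<close>

text \<open>A point lies in \<open>S^u C\<close> exactly when its \<open>u\<close>-th iterate under
  the inverse of \<open>S\<close> lies in \<open>C\<close>. The cyclic permutations therefore
  approximate the inverses of \<open>S\<close> and \<open>T\<close>, and both memberships are read
  along forward orbits of one common point. The identification of the two finite systems is a count:
  with all recorded times in different blocks, every admissible combination of time, present cell
  and future cells occurs equally often in either system. A bijection respecting these data exists,
  even after a permutation of the cells is applied to the future ones: the identity gives
  \<open>1/2\<close>, the exchange of the halves gives \<open>0\<close>. The present cell has to be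
  left alone, because both new permutations must refine the same partition. Near the end of a word
  the future is incomplete; such times are made rare by taking words much longer than the horizon.
  The order of choices matters: block length, window, horizon, word length, and only then the
  tolerance for later stages, small against the horizon and against the coefficients expressing
  indicators of cells through the orbit of the vector.\<close>

lemma cmod_add_sq_le: "(cmod (a + b))\<^sup>2 \<le> 2 * (cmod a)\<^sup>2 + 2 * (cmod b)\<^sup>2"
proof -
  have "(cmod (a + b))\<^sup>2 \<le> (cmod a + cmod b)\<^sup>2"
    by (intro power_mono norm_triangle_ineq) auto
  also have "\<dots> \<le> 2 * (cmod a)\<^sup>2 + 2 * (cmod b)\<^sup>2"
    using sum_squares_bound[of "cmod a" "cmod b"] by (simp add: power2_sum)
  finally show ?thesis .
qed

lemma cnj_measurable [measurable]: "cnj \<in> borel_measurable borel"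
  by (intro borel_measurable_continuous_onI continuous_intros)

lemma L2_measurable [measurable_dest]: "f \<in> L2 M \<Longrightarrow> f \<in> borel_measurable M"
  by (simp add: L2_def)

lemma L2_integrable_sq: "f \<in> L2 M \<Longrightarrow> integrable M (\<lambda>x. (cmod (f x))\<^sup>2)"
  by (simp add: L2_def)

lemma L2_add:
  assumes "f \<in> L2 M" "g \<in> L2 M"
  shows "(\<lambda>x. f x + g x) \<in> L2 M"
proof -
  have [measurable]: "f \<in> borel_measurable M" "g \<in> borel_measurable M"
    using assms by (auto simp: L2_def)
  have "integrable M (\<lambda>x. (cmod (f x + g x))\<^sup>2)"
  proof (rule Bochner_Integration.integrable_bound)
    show "integrable M (\<lambda>x. 2 * (cmod (f x))\<^sup>2 + 2 * (cmod (g x))\<^sup>2)"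
      using assms by (auto simp: L2_def)
    show "AE x in M. norm ((cmod (f x + g x))\<^sup>2) \<le> norm (2 * (cmod (f x))\<^sup>2 + 2 * (cmod (g x))\<^sup>2)"
      using cmod_add_sq_le by auto
  qed auto
  then show ?thesis by (simp add: L2_def)
qed

lemma L2_cmult: "f \<in> L2 M \<Longrightarrow> (\<lambda>x. c * f x) \<in> L2 M"
  by (auto simp: L2_def norm_mult power_mult_distrib)

lemma L2_zero: "(\<lambda>x. 0) \<in> L2 M"
  by (auto simp: L2_def)

lemma L2_diff: "f \<in> L2 M \<Longrightarrow> g \<in> L2 M \<Longrightarrow> (\<lambda>x. f x - g x) \<in> L2 M"
  using L2_add[of f M "\<lambda>x. -1 * g x"] L2_cmult[of g M "-1"] by simp

lemma L2_sum: "(\<And>i. i \<in> I \<Longrightarrow> u i \<in> L2 M) \<Longrightarrow> (\<lambda>x. \<Sum>i\<in>I. u i x) \<in> L2 M"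
  by (induction I rule: infinite_finite_induct) (auto intro: L2_zero L2_add)

lemma integral_cmod_add_sq_le:
  assumes "f \<in> L2 M" "g \<in> L2 M"
  shows "(LINT x|M. (cmod (f x + g x))\<^sup>2) \<le> 2 * (LINT x|M. (cmod (f x))\<^sup>2) + 2 * (LINT x|M. (cmod (g x))\<^sup>2)"
proof -
  have "(LINT x|M. (cmod (f x + g x))\<^sup>2) \<le> (LINT x|M. 2 * (cmod (f x))\<^sup>2 + 2 * (cmod (g x))\<^sup>2)"
    using L2_add[OF assms] assms
    by (intro integral_mono cmod_add_sq_le) (auto simp: L2_def)
  also have "\<dots> = 2 * (LINT x|M. (cmod (f x))\<^sup>2) + 2 * (LINT x|M. (cmod (g x))\<^sup>2)"
    using assms by (subst Bochner_Integration.integral_add) (auto simp: L2_def)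
  finally show ?thesis .
qed

lemma L2_mult_cnj_integrable:
  assumes "f \<in> L2 M" "g \<in> L2 M"
  shows "integrable M (\<lambda>x. f x * cnj (g x))"
proof (rule Bochner_Integration.integrable_bound)
  have [measurable]: "f \<in> borel_measurable M" "g \<in> borel_measurable M"
    using assms by (auto simp: L2_def)
  show "integrable M (\<lambda>x. (cmod (f x))\<^sup>2 + (cmod (g x))\<^sup>2)"
    using assms by (auto simp: L2_def)
  show "(\<lambda>x. f x * cnj (g x)) \<in> borel_measurable M" by measurable
  have "cmod a * cmod b \<le> (cmod a)\<^sup>2 + (cmod b)\<^sup>2" for a b
  proof -
    have "0 \<le> cmod a * cmod b" "2 * cmod a * cmod b \<le> (cmod a)\<^sup>2 + (cmod b)\<^sup>2"
      using sum_squares_bound by auto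
    then show ?thesis by linarith
  qed
  then show "AE x in M. norm (f x * cnj (g x)) \<le> norm ((cmod (f x))\<^sup>2 + (cmod (g x))\<^sup>2)"
    by (simp add: norm_mult)
qed

text \<open>The squared norm of a combination is the quadratic form of its Gram matrix. It is
  applied to orbit vectors in \<open>M\<close> and to characters on the circle; equality of the two
  matrices is what makes spectral measures work.\<close>

lemma integral_cmod_sum_sq:
  assumes "\<And>i. i \<in> I \<Longrightarrow> u i \<in> L2 M"
  shows "complex_of_real (LINT x|M. (cmod (\<Sum>i\<in>I. c i * u i x))\<^sup>2) =
    (\<Sum>i\<in>I. \<Sum>j\<in>I. c i * cnj (c j) * (LINT x|M. u i x * cnj (u j x)))"
proof -
  have "complex_of_real (LINT x|M. (cmod (\<Sum>i\<in>I. c i * u i x))\<^sup>2) =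
      (LINT x|M. complex_of_real ((cmod (\<Sum>i\<in>I. c i * u i x))\<^sup>2))"
    by (rule integral_complex_of_real[symmetric])
  also have "\<dots> = (LINT x|M. (\<Sum>i\<in>I. \<Sum>j\<in>I. c i * cnj (c j) * (u i x * cnj (u j x))))"
    by (intro Bochner_Integration.integral_cong refl)
       (simp only: complex_norm_square cnj_sum complex_cnj_mult sum_product, simp add: mult_ac)
  also have "\<dots> = (\<Sum>i\<in>I. \<Sum>j\<in>I. c i * cnj (c j) * (LINT x|M. u i x * cnj (u j x)))"
  proof -
    have i: "integrable M (\<lambda>x. c i * cnj (c j) * (u i x * cnj (u j x)))" if "i \<in> I" "j \<in> I" for i j
      using L2_mult_cnj_integrable[OF assms[OF that(1)] assms[OF that(2)]]
      by (rule integrable_mult_right)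
    show ?thesis
      by (subst Bochner_Integration.integral_sum, intro Bochner_Integration.integrable_sum i)
         (auto intro!: sum.cong simp: Bochner_Integration.integral_sum i)
  qed
  finally show ?thesis .
qed

lemma funpow_preserves:
  assumes [measurable]: "f \<in> measurable M M" and "distr M M f = M"
  shows "f ^^ n \<in> measurable M M \<and> distr M M (f ^^ n) = M"
proof (induction n)
  case 0
  then show ?case by (simp add: id_def)
next
  case (Suc n)
  then have [measurable]: "f ^^ n \<in> measurable M M" by simp
  have "distr M M (f \<circ> f ^^ n) = distr (distr M M (f ^^ n)) M f"
    by (subst distr_distr) auto
  with Suc assms show ?case by (auto simp: comp_def)
qed

locale koopman = prob_space M for M :: "'a measure" +
  fixes T :: "'a \<Rightarrow> 'a"
  assumes automorphism: "automorphism M T"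
begin

abbreviation "It \<equiv> iterate M T"
abbreviation "U \<equiv> koopman_power M T"
abbreviation "corr g k \<equiv> L2_inner M (U k g) g"

lemma bij: "bij_betw T (space M) (space M)"
  and meas_T [measurable]: "T \<in> measurable M M"
  and meas_inv [measurable]: "inv_into (space M) T \<in> measurable M M"
  and distr_T: "distr M M T = M"
  using automorphism by (auto simp: automorphism_def measure_iso_def)

lemma inv_T: "x \<in> space M \<Longrightarrow> T (inv_into (space M) T x) = x"
  and T_inv: "x \<in> space M \<Longrightarrow> inv_into (space M) T (T x) = x"
  using bij by (auto simp: bij_betw_def f_inv_into_f)

lemma distr_inv: "distr M M (inv_into (space M) T) = M"
proof -
  have "distr M M (inv_into (space M) T) = distr (distr M M T) M (inv_into (space M) T)"
    by (simp add: distr_T)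
  also have "\<dots> = distr M M (inv_into (space M) T \<circ> T)"
    by (rule distr_distr) measurable
  also have "\<dots> = distr M M (\<lambda>x. x)"
    by (rule distr_cong) (auto simp: T_inv)
  finally show ?thesis by simp
qed

lemma meas_It [measurable]: "It k \<in> measurable M M"
  and distr_It: "distr M M (It k) = M"
  using funpow_preserves[OF meas_T distr_T] funpow_preserves[OF meas_inv distr_inv]
  by (auto simp: iterate_def)

lemma It_space: "x \<in> space M \<Longrightarrow> It k x \<in> space M"
  by (rule measurable_space[OF meas_It])

lemma It_0 [simp]: "It 0 = id"
  by (simp add: iterate_def)

text \<open>For negative \<open>k\<close> one factor of the inverse cancels against
  \<open>T\<close>, which is legitimate only at points of \<open>space M\<close>.\<close>

lemma It_Suc: assumes "x \<in> space M" shows "It (k + 1) x = It k (T x)"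
proof (cases "k \<ge> 0")
  case True
  then show ?thesis by (simp add: iterate_def nat_add_distrib funpow_swap1)
next
  case False
  define n where "n = nat (- k - 1)"
  have k: "k = - int (Suc n)" using False by (simp add: n_def)
  have "It (k + 1) x = (inv_into (space M) T ^^ n) x"
    by (cases "n = 0") (auto simp: k iterate_def)
  also have "\<dots> = (inv_into (space M) T ^^ Suc n) (T x)"
    using T_inv[OF assms] by (simp add: funpow_swap1)
  finally have *: "It (k + 1) x = (inv_into (space M) T ^^ Suc n) (T x)" .
  have "nat (- k) = Suc n" by (simp add: k)
  then show ?thesis using False unfolding * by (simp only: iterate_def if_False)
qed

lemma It_pred: assumes "x \<in> space M" shows "It (k - 1) x = It k (inv_into (space M) T x)"
  using It_Suc[of "inv_into (space M) T x" "k - 1"] assms measurable_space[OF meas_inv]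
  by (simp add: inv_T)

lemma It_add: "x \<in> space M \<Longrightarrow> It (k + l) x = It k (It l x)"
proof (induction l arbitrary: x rule: int_induct[where k = 0])
  case base
  then show ?case by simp
next
  case (step1 l)
  then have "It (k + l) (T x) = It k (It l (T x))"
    using measurable_space[OF meas_T] by blast
  then show ?case using It_Suc[OF step1.prems, of "k + l"] It_Suc[OF step1.prems, of l]
    by (simp add: add.assoc)
next
  case (step2 l)
  then have "It (k + l) (inv_into (space M) T x) = It k (It l (inv_into (space M) T x))"
    using measurable_space[OF meas_inv] by blast
  then show ?case using It_pred[OF step2.prems, of "k + l"] It_pred[OF step2.prems, of l]
    by (simp add: diff_add_eq add_diff_eq)
qed

lemma integral_It:
  fixes f :: "'a \<Rightarrow> 'b::{banach, second_countable_topology}"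
  assumes "f \<in> borel_measurable M"
  shows "(LINT x|M. f (It k x)) = (LINT x|M. f x)"
  using integral_distr[OF meas_It assms, of k] by (simp add: distr_It)

lemma L2_U: assumes "g \<in> L2 M" shows "U k g \<in> L2 M"
proof -
  have [measurable]: "g \<in> borel_measurable M" using assms by (simp add: L2_def)
  have "integrable M (\<lambda>x. (cmod (g (It k x)))\<^sup>2)"
    using integrable_distr[OF meas_It[of k], of "\<lambda>x. (cmod (g x))\<^sup>2"] L2_integrable_sq[OF assms]
    by (simp add: distr_It)
  then show ?thesis by (simp add: L2_def koopman_power_def)
qed

text \<open>Measure preservation allows the substitution of \<open>It l x\<close> for
  \<open>x\<close>, so the Gram matrix of an orbit depends only on differences of exponents.\<close>

lemma U_inner:
  assumes "g \<in> L2 M"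
  shows "(LINT x|M. U k g x * cnj (U l g x)) = corr g (k - l)"
proof -
  have [measurable]: "g \<in> borel_measurable M" using assms by (simp add: L2_def)
  have "(LINT x|M. U k g x * cnj (U l g x)) =
      (LINT x|M. (\<lambda>y. U (k - l) g y * cnj (g y)) (It l x))"
    using It_add[of _ "k - l" l]
    by (intro Bochner_Integration.integral_cong) (auto simp: koopman_power_def)
  also have "\<dots> = corr g (k - l)"
    unfolding L2_inner_def
    unfolding koopman_power_def by (rule integral_It) measurable
  finally show ?thesis .
qed

lemma corr_0: "corr g 0 = complex_of_real (LINT x|M. (cmod (g x))\<^sup>2)"
  by (simp add: L2_inner_def koopman_power_def complex_norm_square[symmetric] flip: integral_complex_of_real)

text \<open>Hermitian symmetry reduces the construction of a spectral measure to its coefficients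
  with nonnegative index.\<close>

lemma corr_minus: assumes "g \<in> L2 M" shows "corr g (- k) = cnj (corr g k)"
proof -
  have "corr g (- k) = (LINT x|M. U 0 g x * cnj (U k g x))"
    using U_inner[OF assms, of 0 k] by simp
  also have "\<dots> = (LINT x|M. cnj (U k g x * cnj (g x)))"
    by (simp add: koopman_power_def mult.commute)
  also have "\<dots> = cnj (corr g k)"
    unfolding L2_inner_def by (rule Bochner_Integration.integral_cnj)
  finally show ?thesis .
qed

lemma norm_trig_sum:
  assumes "g \<in> L2 M"
  shows "complex_of_real (LINT x|M. (cmod (\<Sum>i\<in>I. c i * U (\<kappa> i) g x))\<^sup>2) =
    (\<Sum>i\<in>I. \<Sum>j\<in>I. c i * cnj (c j) * corr g (\<kappa> i - \<kappa> j))"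
  by (subst integral_cmod_sum_sq) (auto simp: L2_U[OF assms] U_inner[OF assms])

lemma L2_trig: "g \<in> L2 M \<Longrightarrow> (\<lambda>x. \<Sum>i\<in>I. c i * U (\<kappa> i) g x) \<in> L2 M"
  by (intro L2_sum L2_cmult L2_U)

end

section \<open>Continuous functions and integer powers on the unit circle\<close>

lemma circle_space: "sets \<sigma> = sets circle_borel \<Longrightarrow> space \<sigma> = sphere 0 1"
  by (drule sets_eq_imp_space_eq) (simp add: circle_borel_def)

lemma circle_continuous_measurable:
  assumes "sets \<sigma> = sets circle_borel" "continuous_on (sphere 0 1) f"
  shows "f \<in> borel_measurable \<sigma>"
  unfolding measurable_cong_sets[OF assms(1) refl] circle_borel_def
  by (rule borel_measurable_continuous_on_restrict[OF assms(2)])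

lemma continuous_on_powi_sphere: "continuous_on (sphere 0 1) (\<lambda>z::complex. z powi k)"
  by (rule continuous_on_power_int) (auto intro: continuous_on_id)

lemma circle_bounded_integrable:
  assumes "finite_measure \<sigma>" "sets \<sigma> = sets circle_borel"
    and "continuous_on (sphere 0 1) f" "\<And>z. z \<in> sphere 0 1 \<Longrightarrow> norm (f z) \<le> B"
  shows "integrable \<sigma> (f :: complex \<Rightarrow> 'b::{banach, second_countable_topology})"
proof -
  interpret finite_measure \<sigma> by fact
  show ?thesis
    by (rule integrable_const_bound[where B = B])
       (use assms circle_space[OF assms(2)] circle_continuous_measurable in auto)
qed

lemma circle_continuous_integrable:
  assumes "finite_measure \<sigma>" "sets \<sigma> = sets circle_borel" "continuous_on (sphere 0 1) f"
  shows "integrable \<sigma> (f :: complex \<Rightarrow> 'b::{banach, second_countable_topology})"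
proof -
  have "compact (f ` sphere 0 1)" using assms(3) by (intro compact_continuous_image) auto
  then obtain B where "\<And>y. y \<in> f ` sphere 0 1 \<Longrightarrow> norm y \<le> B"
    using compact_imp_bounded bounded_iff by metis
  then show ?thesis using circle_bounded_integrable[OF assms, of B] by blast
qed

lemma powi_mult_cnj: "cmod z = 1 \<Longrightarrow> z powi k * cnj (z powi l) = z powi (k - l)"
proof -
  assume z: "cmod z = 1"
  then have "z \<noteq> 0" by auto
  have "cnj (z powi l) = inverse (z powi l)"
    using z by (intro inverse_unique[symmetric])
      (simp add: complex_norm_square[symmetric] norm_power_int del: complex_cnj_power_int)
  then show ?thesis using \<open>z \<noteq> 0\<close>
    by (simp add: power_int_diff divide_inverse del: complex_cnj_power_int)
qed

text \<open>The orbit of \<open>g\<close> and the characters on the circle have the same Gram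
  matrix, by the defining property of \<open>\<sigma>\<close>. This is the isometry of the spectral
  theorem, restricted to trigonometric polynomials.\<close>

lemma (in koopman) spectral_trig:
  assumes g: "g \<in> L2 M" and \<sigma>: "spectral_measure M T g \<sigma>"
  shows "(LINT x|M. (cmod (\<Sum>i\<in>I. c i * U (\<kappa> i) g x))\<^sup>2) =
    (LINT z|\<sigma>. (cmod (\<Sum>i\<in>I. c i * z powi \<kappa> i))\<^sup>2)"
proof -
  have fin: "finite_measure \<sigma>" and s: "sets \<sigma> = sets circle_borel"
    and k: "\<And>k. (LINT z|\<sigma>. z powi k) = corr g k"
    using \<sigma> by (auto simp: spectral_measure_def)
  have L: "(\<lambda>z. z powi k) \<in> L2 \<sigma>" for k
    using circle_continuous_measurable[OF s continuous_on_powi_sphere]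
    by (auto simp: L2_def intro!: circle_continuous_integrable[OF fin s] continuous_intros continuous_on_powi_sphere)
  have kk: "(LINT z|\<sigma>. z powi k * cnj (z powi l)) = corr g (k - l)" for k l
  proof -
    have "(LINT z|\<sigma>. z powi k * cnj (z powi l)) = (LINT z|\<sigma>. z powi (k - l))"
      by (rule Bochner_Integration.integral_cong) (auto simp: circle_space[OF s] powi_mult_cnj simp del: complex_cnj_power_int)
    then show ?thesis by (simp add: k)
  qed
  have "complex_of_real (LINT z|\<sigma>. (cmod (\<Sum>i\<in>I. c i * z powi \<kappa> i))\<^sup>2) =
      (\<Sum>i\<in>I. \<Sum>j\<in>I. c i * cnj (c j) * corr g (\<kappa> i - \<kappa> j))"
    using integral_cmod_sum_sq[where u = "\<lambda>i z. z powi \<kappa> i" and M = \<sigma> and I = I and c = c, OF L]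
    unfolding kk .
  from norm_trig_sum[OF g, of c \<kappa> I] this[symmetric]
  show ?thesis by (rule trans[THEN of_real_eq_iff[THEN iffD1]])
qed

section \<open>Existence of spectral measures\<close>

lemma has_bochner_integral_cis:
  "has_bochner_integral lborel (\<lambda>t. indicator {0..2*pi} t *\<^sub>R cis (of_int n * t))
     (if n = 0 then of_real (2 * pi) else 0)"
proof (cases "n = 0")
  case True
  have "has_bochner_integral lborel (\<lambda>t. indicator {0..2*pi} t *\<^sub>R (1::complex)) (measure lborel {0..2*pi} *\<^sub>R 1)"
    by (rule has_bochner_integral_indicator) auto
  with True show ?thesis by (simp add: scaleR_conv_of_real)
next
  case False
  have "has_bochner_integral lborel (\<lambda>t. indicator {0..2*pi} t *\<^sub>R cis (of_int n * t))
     ((\<lambda>t. cis (of_int n * t) / (\<i> * of_int n)) (2*pi) - (\<lambda>t. cis (of_int n * t) / (\<i> * of_int n)) 0)"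
  proof (rule has_bochner_integral_FTC_Icc)
    fix t :: real
    have "((\<lambda>t. exp (\<i> * of_real (of_int n * t)) / (\<i> * of_int n)) has_vector_derivative
       exp (\<i> * of_real (of_int n * t))) (at t within {0..2*pi})"
    proof -
      have "((\<lambda>z. exp (\<i> * (of_int n * z)) / (\<i> * of_int n)) has_field_derivative exp (\<i> * (of_int n * of_real t)))
         (at (complex_of_real t))"
        using False by (auto intro!: derivative_eq_intros simp: field_simps)
      from has_vector_derivative_real_field[OF this, of "{0..2*pi}"] show ?thesis by simp
    qed
    then show "((\<lambda>t. cis (of_int n * t) / (\<i> * of_int n)) has_vector_derivative cis (of_int n * t)) (at t within {0..2*pi})"
      by (simp add: cis_conv_exp)
  next
    show "continuous_on {0..2*pi} (\<lambda>t. cis (of_int n * t))"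
      by (intro continuous_intros continuous_on_cis)
  qed simp
  moreover have "cis (of_int n * (2 * pi)) = 1"
    using cis_multiple_2pi[of "of_int n"] by (simp add: mult_ac)
  ultimately show ?thesis using False by simp
qed

section \<open>Fejer means of a correlation sequence and Herglotz' theorem\<close>

context koopman
begin

text \<open>The Fejer mean of the correlation sequence, normalised so that for nonzero
  \<open>g\<close> and \<open>N\<close> it is a probability density on \<open>[0, 2 * pi]\<close>.
  Written as a squared norm it is visibly nonnegative.\<close>

definition fejer :: "('a \<Rightarrow> complex) \<Rightarrow> nat \<Rightarrow> real \<Rightarrow> real" where
  "fejer g N t = (LINT x|M. (cmod (\<Sum>k<N. cis (- (of_nat k * t)) * U (int k) g x))\<^sup>2)
     / (2 * pi * real N * (LINT x|M. (cmod (g x))\<^sup>2))"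

lemma fejer_nonneg: "0 \<le> fejer g N t"
  unfolding fejer_def by (intro divide_nonneg_nonneg integral_nonneg mult_nonneg_nonneg) auto

lemma fejer_eq:
  assumes "g \<in> L2 M"
  shows "complex_of_real (fejer g N t) = (\<Sum>k<N. \<Sum>l<N. cis (of_int (int l - int k) * t) *
     (corr g (int k - int l) / (2 * pi * N * corr g 0)))"
proof -
  have "complex_of_real (fejer g N t) = (\<Sum>k<N. \<Sum>l<N. cis (- (of_nat k * t)) * cnj (cis (- (of_nat l * t))) *
     corr g (int k - int l)) / (2 * pi * N * corr g 0)"
    unfolding fejer_def of_real_divide norm_trig_sum[OF assms, of _ int "{..<N}"] corr_0 by simp
  also have "\<dots> = (\<Sum>k<N. \<Sum>l<N. cis (of_int (int l - int k) * t) *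
     (corr g (int k - int l) / (2 * pi * N * corr g 0)))"
    unfolding sum_divide_distrib
    by (intro sum.cong refl) (simp add: cis_cnj cis_mult algebra_simps)
  finally show ?thesis .
qed

text \<open>Orthogonality of the exponentials leaves only the pairs with
  \<open>int k - int l = n\<close>.\<close>

lemma fejer_fourier:
  assumes "g \<in> L2 M"
  shows "has_bochner_integral lborel (\<lambda>t. (indicator {0..2*pi} t * fejer g N t) *\<^sub>R cis (of_int n * t))
    (\<Sum>k<N. \<Sum>l<N. if int k = n + int l then corr g n / (N * corr g 0) else 0)"
proof -
  have "has_bochner_integral lborel
     (\<lambda>t. \<Sum>k<N. \<Sum>l<N. (corr g (int k - int l) / (2 * pi * N * corr g 0)) *
        (indicator {0..2*pi} t *\<^sub>R cis (of_int (n + int l - int k) * t)))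
     (\<Sum>k<N. \<Sum>l<N. (corr g (int k - int l) / (2 * pi * N * corr g 0)) *
        (if n + int l - int k = 0 then of_real (2 * pi) else 0))"
    by (intro has_bochner_integral_sum has_bochner_integral_mult_right has_bochner_integral_cis)
  also have "(\<lambda>t. \<Sum>k<N. \<Sum>l<N. (corr g (int k - int l) / (2 * pi * N * corr g 0)) *
        (indicator {0..2*pi} t *\<^sub>R cis (of_int (n + int l - int k) * t))) =
     (\<lambda>t. (indicator {0..2*pi} t * fejer g N t) *\<^sub>R cis (of_int n * t))"
  proof
    fix t
    have "(indicator {0..2*pi} t * fejer g N t) *\<^sub>R cis (of_int n * t) =
       indicator {0..2*pi} t *\<^sub>R (complex_of_real (fejer g N t) * cis (of_int n * t))"
      by (simp add: scaleR_conv_of_real)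
    also have "complex_of_real (fejer g N t) * cis (of_int n * t) =
       (\<Sum>k<N. \<Sum>l<N. (corr g (int k - int l) / (2 * pi * N * corr g 0)) * cis (of_int (n + int l - int k) * t))"
      unfolding fejer_eq[OF assms] sum_distrib_right
    proof (intro sum.cong refl)
      have *: "a * c * b = c * d" if "a * b = d" for a b c d :: complex
        using that by (auto simp: mult_ac)
      fix k l
      have "cis (of_int (int l - int k) * t) * cis (of_int n * t) = cis (of_int (n + int l - int k) * t)"
        by (simp add: cis_mult algebra_simps)
      then show "cis (of_int (int l - int k) * t) * (corr g (int k - int l) / (2 * pi * N * corr g 0)) * cis (of_int n * t)
        = corr g (int k - int l) / (2 * pi * N * corr g 0) * cis (of_int (n + int l - int k) * t)"
        by (rule *)
    qed
    finally show "(\<Sum>k<N. \<Sum>l<N. (corr g (int k - int l) / (2 * pi * N * corr g 0)) *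
        (indicator {0..2*pi} t *\<^sub>R cis (of_int (n + int l - int k) * t))) =
      (indicator {0..2*pi} t * fejer g N t) *\<^sub>R cis (of_int n * t)"
      by (simp add: scaleR_sum_right)
  qed
  also have "(\<Sum>k<N. \<Sum>l<N. (corr g (int k - int l) / (2 * pi * N * corr g 0)) *
        (if n + int l - int k = 0 then of_real (2 * pi) else 0)) =
     (\<Sum>k<N. \<Sum>l<N. if int k = n + int l then corr g n / (N * corr g 0) else 0)"
  proof (intro sum.cong refl)
    fix k l
    have A: "c / (complex_of_real (2 * pi * real N) * d) * of_real (2 * pi) = c / (of_nat N * d)" for c d :: complex
      by simp
    show "corr g (int k - int l) / (2 * pi * N * corr g 0) *
        (if n + int l - int k = 0 then of_real (2 * pi) else 0) =
      (if int k = n + int l then corr g n / (N * corr g 0) else 0)"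
    proof (cases "int k = n + int l")
      case True
      then have "int k - int l = n" "n + int l - int k = 0" by simp_all
      then show ?thesis using True A[of "corr g n" "corr g 0"] by (simp only: if_True refl)
    next
      case False
      then have "n + int l - int k \<noteq> 0" by simp
      then show ?thesis using False by (simp only: if_False mult_zero_right)
    qed
  qed
  finally show ?thesis .
qed

text \<open>There are \<open>N - n\<close> such pairs; truncated subtraction covers
  \<open>n \<ge> N\<close>, where there are none.\<close>

lemma fejer_fourier_nat:
  assumes "g \<in> L2 M"
  shows "has_bochner_integral lborel (\<lambda>t. (indicator {0..2*pi} t * fejer g N t) *\<^sub>R cis (of_nat n * t))
    (of_nat (N - n) * (corr g (int n) / (N * corr g 0)))"
proof -
  have "(\<Sum>k<N. \<Sum>l<N. if int k = int n + int l then c else 0) = of_nat (N - n) * c" for c :: complex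
  proof -
    have "(\<Sum>k<N. \<Sum>l<N. if int k = int n + int l then c else 0) =
        (\<Sum>l<N. \<Sum>k<N. if k = n + l then c else 0)"
      by (subst sum.swap) (intro sum.cong refl, auto)
    also have "\<dots> = (\<Sum>l<N. if n + l < N then c else 0)"
      by (intro sum.cong refl) auto
    also have "\<dots> = (\<Sum>l\<in>{..<N - n}. c)"
      by (intro sum.mono_neutral_cong_right) auto
    finally show ?thesis by simp
  qed
  then show ?thesis using fejer_fourier[OF assms, of N "int n"] by simp
qed

text \<open>Placed on the line, where tightness and weak convergence of real distributions are
  available. \<open>Suc N\<close> avoids the empty mean.\<close>

definition fejer_measure :: "('a \<Rightarrow> complex) \<Rightarrow> nat \<Rightarrow> real measure" where
  "fejer_measure g N = density lborel (\<lambda>t. ennreal (indicator {0..2*pi} t * fejer g (Suc N) t))"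

lemma fejer_measurable: assumes "g \<in> L2 M" shows "fejer g N \<in> borel_measurable borel"
proof -
  have "fejer g N = (\<lambda>t. Re (\<Sum>k<N. \<Sum>l<N. cis (of_int (int l - int k) * t) *
     (corr g (int k - int l) / (2 * pi * N * corr g 0))))"
    using fejer_eq[OF assms, of N] by (metis Re_complex_of_real)
  also have "\<dots> \<in> borel_measurable borel"
    by (intro borel_measurable_continuous_onI continuous_intros continuous_on_cis)
  finally show ?thesis .
qed

lemma fejer_measure_fourier:
  assumes "g \<in> L2 M"
  shows "(LINT t|fejer_measure g N. cis (of_nat n * t)) =
    of_nat (Suc N - n) * (corr g (int n) / (Suc N * corr g 0))"
proof -
  have [measurable]: "fejer g (Suc N) \<in> borel_measurable borel" by (rule fejer_measurable[OF assms])
  have [measurable]: "cis \<in> borel_measurable borel"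
    by (intro borel_measurable_continuous_onI continuous_on_cis continuous_intros)
  have "(LINT t|fejer_measure g N. cis (of_nat n * t)) =
     (LINT t|lborel. (indicator {0..2*pi} t * fejer g (Suc N) t) *\<^sub>R cis (of_nat n * t))"
    unfolding fejer_measure_def by (rule integral_density) (auto simp: fejer_nonneg)
  then show ?thesis
    using has_bochner_integral_integral_eq[OF fejer_fourier_nat[OF assms, of "Suc N" n]] by simp
qed

text \<open>The total mass is the Fourier coefficient with index 0, which the normalisation makes
  1.\<close>

lemma fejer_measure_real_distribution:
  assumes "g \<in> L2 M" and nz: "(LINT x|M. (cmod (g x))\<^sup>2) \<noteq> 0"
  shows "real_distribution (fejer_measure g N)"
proof -
  have [measurable]: "fejer g (Suc N) \<in> borel_measurable borel" by (rule fejer_measurable[OF assms(1)])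
  have c0: "corr g 0 \<noteq> 0" using nz by (simp add: corr_0)
  have "has_bochner_integral lborel (\<lambda>t. complex_of_real (indicator {0..2*pi} t * fejer g (Suc N) t)) 1"
  proof -
    have "of_nat (Suc N - 0) * (corr g (int 0) / (of_nat (Suc N) * corr g 0)) = 1"
      using c0 of_nat_neq_0[of N, where 'a = complex] by (simp del: of_nat_Suc)
    then show ?thesis
      using fejer_fourier_nat[OF assms(1), of "Suc N" 0] by (simp add: scaleR_conv_of_real)
  qed
  then have "has_bochner_integral lborel (\<lambda>t. indicator {0..2*pi} t * fejer g (Suc N) t) 1"
    using has_bochner_integral_Re by fastforce
  then have "(\<integral>\<^sup>+ t. ennreal (indicator {0..2*pi} t * fejer g (Suc N) t) \<partial>lborel) = 1"
    by (subst nn_integral_eq_integral)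
       (auto simp: fejer_nonneg has_bochner_integral_iff)
  then have "prob_space (fejer_measure g N)"
    by (intro prob_spaceI) (simp add: fejer_measure_def emeasure_density)
  then show ?thesis
    by (intro real_distribution.intro real_distribution_axioms.intro) (auto simp: fejer_measure_def)
qed

lemma fejer_measure_tight:
  assumes "g \<in> L2 M" and nz: "(LINT x|M. (cmod (g x))\<^sup>2) \<noteq> 0"
  shows "tight (fejer_measure g)"
  unfolding tight_def
proof (intro conjI allI impI)
  show rd: "real_distribution (fejer_measure g N)" for N
    by (rule fejer_measure_real_distribution[OF assms])
  fix e :: real assume e: "e > 0"
  \<comment> \<open>All the measures live on \<open>[0, 2 * pi]\<close>, which lies inside this
    interval.\<close>
  have "measure (fejer_measure g N) {-1<..7} = 1" for N
  proof -
    interpret D: real_distribution "fejer_measure g N" by (rule rd)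
    have "AE t in lborel. indicator {0..2*pi} t * fejer g (Suc N) t > 0 \<longrightarrow> t \<in> {-1<..7}"
      using pi_less_4 pi_approx by (intro AE_I2) (auto split: split_indicator)
    then have "AE t in fejer_measure g N. t \<in> {-1<..7}"
      unfolding fejer_measure_def using fejer_measurable[OF assms(1), of "Suc N"]
      by (subst AE_density) (auto simp: ennreal_eq_0_iff)
    then show ?thesis by (subst D.prob_eq_1) auto
  qed
  then show "\<exists>a b. a < b \<and> (\<forall>n. measure (fejer_measure g n) {a<..b} > 1 - e)"
    using e by (intro exI[of _ "-1"] exI[of _ 7]) auto
qed

text \<open>Herglotz' theorem for the correlation sequence of \<open>g\<close>: the spectral measure is a weak limit of
  the measures whose densities are the Fejer means.\<close>

lemma spectral_measure_exists:
  assumes g: "g \<in> L2 M"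
  shows "\<exists>\<sigma>. spectral_measure M T g \<sigma>"
proof (cases "(LINT x|M. (cmod (g x))\<^sup>2) = 0")
  \<comment> \<open>A vector of norm 0 cannot be normalised; its correlations vanish and the null
    measure serves.\<close>
  case True
  have "AE x in M. (cmod (g x))\<^sup>2 = 0"
    using True integral_nonneg_eq_0_iff_AE[OF L2_integrable_sq[OF g]] by simp
  then have "AE x in M. U k g x * cnj (g x) = 0" for k
    by eventually_elim simp
  then have "corr g k = 0" for k
    unfolding L2_inner_def by (rule integral_eq_zero_AE)
  then have "spectral_measure M T g (null_measure circle_borel)"
    unfolding spectral_measure_def
    by (auto intro!: finite_measureI)
  then show ?thesis by blast
next
  case False
  define m where "m = (LINT x|M. (cmod (g x))\<^sup>2)"
  have m: "m > 0" using False unfolding m_def by (simp add: order.not_eq_order_implies_strict)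
  obtain r L where r: "strict_mono (r :: nat \<Rightarrow> nat)" and L: "real_distribution L"
    and conv: "weak_conv_m (fejer_measure g \<circ> id \<circ> r) L"
    using tight_imp_convergent_subsubsequence[OF fejer_measure_tight[OF g False] strict_mono_id] by blast
  interpret L: real_distribution L by fact
  have cis_meas [measurable]: "cis \<in> borel_measurable borel"
    by (intro borel_measurable_continuous_onI continuous_on_cis continuous_intros)
  have cis_circle: "cis \<in> measurable L circle_borel"
    unfolding circle_borel_def by (intro measurable_restrict_space2) auto
  \<comment> \<open>Weak convergence gives one limit of the coefficients along the subsequence; the
    explicit formula, with a factor tending to 1, gives the other.\<close>
  have fou: "(LINT t|L. cis (of_nat n * t)) = corr g (int n) / corr g 0" for n
  proof (rule LIMSEQ_unique)
    show "(\<lambda>j. LINT t|(fejer_measure g \<circ> id \<circ> r) j. cis (of_nat n * t)) \<longlonglongrightarrow> (LINT t|L. cis (of_nat n * t))"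
    proof (rule weak_conv_imp_integral_bdd_continuous_conv[where B = 1])
      show "real_distribution ((fejer_measure g \<circ> id \<circ> r) n)" for n
        using fejer_measure_real_distribution[OF g False] by simp
      have "continuous_on UNIV (\<lambda>t. cis (real n * t))"
        by (intro continuous_on_cis continuous_intros)
      then show "isCont (\<lambda>t. cis (real n * t)) t" for t
        by (simp add: continuous_on_eq_continuous_at)
    qed (rule L, rule conv, simp)
    have "(\<lambda>N. of_nat (Suc N - n) * (corr g (int n) / (Suc N * corr g 0))) \<longlonglongrightarrow> corr g (int n) / corr g 0"
    proof -
      have "(\<lambda>N. complex_of_real (1 - real n / real (Suc N)) * (corr g (int n) / corr g 0)) \<longlonglongrightarrow>
          complex_of_real (1 - 0) * (corr g (int n) / corr g 0)"
        by (intro tendsto_mult tendsto_of_real tendsto_diff tendsto_const LIMSEQ_Suc[OF lim_const_over_n])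
      moreover have "\<forall>\<^sub>F N in sequentially. complex_of_real (1 - real n / real (Suc N)) * (corr g (int n) / corr g 0) =
          of_nat (Suc N - n) * (corr g (int n) / (Suc N * corr g 0))"
        using eventually_ge_at_top[of n]
      proof eventually_elim
        case (elim N)
        have "complex_of_real (1 - real n / real (Suc N)) = of_nat (Suc N - n) / of_nat (Suc N)"
          using elim by (simp add: of_nat_diff field_simps)
        then show ?case by simp
      qed
      ultimately have "(\<lambda>N. of_nat (Suc N - n) * (corr g (int n) / (Suc N * corr g 0))) \<longlonglongrightarrow>
          complex_of_real (1 - 0) * (corr g (int n) / corr g 0)"
        by (rule Lim_transform_eventually)
      then show ?thesis by simp
    qed
    from LIMSEQ_subseq_LIMSEQ[OF this r]
    show "(\<lambda>j. LINT t|(fejer_measure g \<circ> id \<circ> r) j. cis (of_nat n * t)) \<longlonglongrightarrow> corr g (int n) / corr g 0"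
      by (simp add: fejer_measure_fourier[OF g] comp_def)
  qed
  \<comment> \<open>The limit is wrapped around the circle, and the factor \<open>m\<close> undoes
    the normalisation of the densities.\<close>
  define L' where "L' = distr L circle_borel cis"
  define \<sigma> where "\<sigma> = density L' (\<lambda>_. ennreal m)"
  have sL: "sets L' = sets circle_borel" by (simp add: L'_def)
  have s: "sets \<sigma> = sets circle_borel" by (simp add: \<sigma>_def sL)
  interpret L': prob_space L' unfolding L'_def by (rule L.prob_space_distr[OF cis_circle])
  have fin: "finite_measure \<sigma>"
    by (rule finite_measureI) (simp add: \<sigma>_def emeasure_density L'.emeasure_space_1)
  have pw: "(LINT z|\<sigma>. z powi int n) = corr g (int n)" for n
  proof -
    have "(LINT z|\<sigma>. z powi int n) = (LINT z|L'. m *\<^sub>R (z powi int n))"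
      unfolding \<sigma>_def using m
      by (intro integral_density circle_continuous_measurable[OF sL] continuous_on_powi_sphere) auto
    also have "\<dots> = m *\<^sub>R (LINT z|L'. z powi int n)" by simp
    also have "(LINT z|L'. z powi int n) = (LINT t|L. cis t powi int n)"
      unfolding L'_def
      by (intro integral_distr[OF cis_circle] circle_continuous_measurable continuous_on_powi_sphere refl)
    also have "(\<lambda>t. cis t powi int n) = (\<lambda>t. cis (real n * t))"
      by (simp only: power_int_of_nat Complex.DeMoivre)
    also have "(LINT t|L. cis (real n * t)) = corr g (int n) / corr g 0" by (rule fou)
    finally have "(LINT z|\<sigma>. z powi int n) = of_real m * (corr g (int n) / corr g 0)"
      by (simp only: scaleR_conv_of_real)
    moreover have "corr g 0 = of_real m" by (simp only: corr_0 m_def)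
    ultimately show ?thesis using m by simp
  qed
  have "(LINT z|\<sigma>. z powi k) = corr g k" for k
  proof (cases "k \<ge> 0")
    case True
    then show ?thesis using pw[of "nat k"] by (simp only: int_nat_eq if_True)
  next
    case False
    define n where "n = nat (- k)"
    have k: "k = - int n" using False by (simp add: n_def)
    have "(LINT z|\<sigma>. z powi k) = (LINT z|\<sigma>. cnj (z powi int n))"
    proof (rule Bochner_Integration.integral_cong[OF refl])
      fix z assume "z \<in> space \<sigma>"
      then have "cmod z = 1" by (simp add: circle_space[OF s])
      from powi_mult_cnj[OF this, of 0 "int n"] show "z powi k = cnj (z powi int n)"
        unfolding k by (simp only: power_int_0_right mult_1_left diff_0)
    qed
    also have "\<dots> = cnj (corr g (int n))"
      unfolding pw[symmetric] by (rule Bochner_Integration.integral_cnj)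
    also have "\<dots> = cnj (corr g (- k))" by (simp add: k)
    finally show ?thesis using corr_minus[OF g, of k] by simp
  qed
  then show ?thesis using fin s by (auto simp: spectral_measure_def)
qed

end

section \<open>Trigonometric polynomials on the circle\<close>

text \<open>A list of pairs of coefficient and exponent may repeat exponents, so sums and products
  are plain list operations. Only values on the circle matter.\<close>

definition trig_polynomial :: "(complex \<Rightarrow> complex) \<Rightarrow> bool" where
  "trig_polynomial P \<longleftrightarrow>
     (\<exists>xs. \<forall>z\<in>sphere 0 1. P z = (\<Sum>(c, k :: int)\<leftarrow>xs. c * z powi k))"

lemma trig_polynomialI:
  "(\<And>z. z \<in> sphere 0 1 \<Longrightarrow> P z = (\<Sum>(c, k :: int)\<leftarrow>xs. c * z powi k)) \<Longrightarrow> trig_polynomial P"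
  unfolding trig_polynomial_def by blast

lemma trig_polynomial_add:
  assumes "trig_polynomial P" "trig_polynomial Q"
  shows "trig_polynomial (\<lambda>z. P z + Q z)"
proof -
  obtain xs ys where "\<And>z. z \<in> sphere 0 1 \<Longrightarrow> P z = (\<Sum>(c, k :: int)\<leftarrow>xs. c * z powi k)"
    "\<And>z. z \<in> sphere 0 1 \<Longrightarrow> Q z = (\<Sum>(c, k :: int)\<leftarrow>ys. c * z powi k)"
    using assms unfolding trig_polynomial_def by blast
  then show ?thesis by (intro trig_polynomialI[where xs = "xs @ ys"]) simp
qed

lemma trig_polynomial_mult:
  assumes "trig_polynomial P" "trig_polynomial Q"
  shows "trig_polynomial (\<lambda>z. P z * Q z)"
proof -
  obtain xs ys where P: "\<And>z. z \<in> sphere 0 1 \<Longrightarrow> P z = (\<Sum>(c, k :: int)\<leftarrow>xs. c * z powi k)"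
    and Q: "\<And>z. z \<in> sphere 0 1 \<Longrightarrow> Q z = (\<Sum>(c, k :: int)\<leftarrow>ys. c * z powi k)"
    using assms unfolding trig_polynomial_def by blast
  have 1: "(\<Sum>(c, k)\<leftarrow>map (\<lambda>(c, k). (a * c, l + k)) ys. c * z powi k) =
      a * z powi l * (\<Sum>(c, k :: int)\<leftarrow>ys. c * z powi k)" if "z \<in> sphere 0 1" for z a l
  proof -
    have "z \<noteq> 0" using that by auto
    then have "c * z powi (l + k) = z powi l * (c * z powi k)" for c k
      by (simp add: power_int_add)
    then show ?thesis by (induction ys) (auto simp: algebra_simps)
  qed
  have 2: "(\<Sum>(c, k)\<leftarrow>concat (map (\<lambda>(a, l). map (\<lambda>(c, k). (a * c, l + k)) ys) xs). c * z powi k) =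
      (\<Sum>(c, k :: int)\<leftarrow>xs. c * z powi k) * (\<Sum>(c, k :: int)\<leftarrow>ys. c * z powi k)"
    if "z \<in> sphere 0 1" for z
    by (induction xs) (auto simp: 1[OF that] algebra_simps simp del: map_map)
  show ?thesis
    by (rule trig_polynomialI, subst P, assumption, subst Q, assumption, rule 2[symmetric])
qed

lemma trig_polynomial_monom: "trig_polynomial (\<lambda>z. c * z powi k)"
  by (rule trig_polynomialI[where xs = "[(c, k)]"]) simp

lemma trig_polynomial_const: "trig_polynomial (\<lambda>z. c)"
  using trig_polynomial_monom[of c 0] by simp

lemma trig_polynomial_cong:
  "trig_polynomial P \<Longrightarrow> (\<And>z. z \<in> sphere 0 1 \<Longrightarrow> P z = Q z) \<Longrightarrow> trig_polynomial Q"
  unfolding trig_polynomial_def by metis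

text \<open>On the circle \<open>cnj z\<close> equals \<open>z powi (-1)\<close>, so both
  coordinates are combinations of \<open>z\<close> and its inverse. They generate the real
  polynomials needed for density.\<close>

lemma trig_polynomial_Re: "trig_polynomial (\<lambda>z. of_real (Re z))"
  and trig_polynomial_Im: "trig_polynomial (\<lambda>z. of_real (Im z))"
proof -
  have c: "cnj z = z powi (-1)" if "z \<in> sphere 0 1" for z
    using powi_mult_cnj[of z 0 1] that by simp
  have "trig_polynomial (\<lambda>z. 1/2 * z powi 1 + 1/2 * z powi (-1))"
    by (intro trig_polynomial_add trig_polynomial_monom)
  then show "trig_polynomial (\<lambda>z. of_real (Re z))"
    by (rule trig_polynomial_cong) (simp only: c[symmetric], simp add: complex_eq_iff)
  have "trig_polynomial (\<lambda>z. (- \<i>/2) * z powi 1 + (\<i>/2) * z powi (-1))"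
    by (intro trig_polynomial_add trig_polynomial_monom)
  then show "trig_polynomial (\<lambda>z. of_real (Im z))"
    by (rule trig_polynomial_cong) (simp only: c[symmetric], simp add: complex_eq_iff)
qed

text \<open>Stone-Weierstrass supplies a real polynomial in the coordinates of the plane, and on the
  circle each such polynomial is a trigonometric one.\<close>

lemma trig_polynomial_dense:
  assumes "continuous_on (sphere 0 1) f" "e > 0"
  obtains P where "trig_polynomial P" "\<And>z. z \<in> sphere 0 1 \<Longrightarrow> cmod (of_real (f z) - P z) < e"
proof -
  obtain g where g: "real_polynomial_function g" "\<And>z. z \<in> sphere 0 1 \<Longrightarrow> \<bar>f z - g z\<bar> < e"
    using Stone_Weierstrass_real_polynomial_function[OF compact_sphere assms] by blast
  from g(1) have "trig_polynomial (\<lambda>z. of_real (g z))"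
  proof (induction g rule: real_polynomial_function.induct)
    case (linear f)
    have "trig_polynomial (\<lambda>z. of_real (f 1) * of_real (Re z) + of_real (f \<i>) * of_real (Im z))"
      by (intro trig_polynomial_add trig_polynomial_mult trig_polynomial_const trig_polynomial_Re trig_polynomial_Im)
    moreover have "f 1 * Re z + f \<i> * Im z = f z" for z
    proof -
      interpret f: bounded_linear f by fact
      have "f z = f (Re z *\<^sub>R 1 + Im z *\<^sub>R \<i>)"
        by (intro arg_cong[where f = f]) (simp add: complex_eq_iff)
      also have "\<dots> = f 1 * Re z + f \<i> * Im z"
        by (simp only: f.add f.scaleR real_scaleR_def mult.commute)
      finally show ?thesis ..
    qed
    ultimately show ?case by (simp only: of_real_mult[symmetric] of_real_add[symmetric])
  qed (auto intro: trig_polynomial_const trig_polynomial_add trig_polynomial_mult)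
  then show ?thesis
    using g(2) by (intro that) (auto simp flip: of_real_diff)
qed

lemma trig_polynomial_continuous:
  assumes "trig_polynomial P" shows "continuous_on (sphere 0 1) P"
proof -
  obtain xs where P: "\<And>z. z \<in> sphere 0 1 \<Longrightarrow> P z = (\<Sum>(c, k :: int)\<leftarrow>xs. c * z powi k)"
    using assms unfolding trig_polynomial_def by blast
  have "continuous_on (sphere 0 1) (\<lambda>z. \<Sum>(c, k :: int)\<leftarrow>xs. c * z powi k)"
    by (induction xs) (auto intro!: continuous_intros continuous_on_powi_sphere simp: split_beta)
  then show ?thesis by (rule continuous_on_eq) (simp add: P)
qed

lemma trig_polynomial_sum:
  assumes "trig_polynomial P"
  shows "\<exists>n c \<kappa>. \<forall>z\<in>sphere 0 1. P z = (\<Sum>i<(n::nat). c i * z powi \<kappa> i)"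
proof -
  obtain xs where P: "\<And>z. z \<in> sphere 0 1 \<Longrightarrow> P z = (\<Sum>(c, k :: int)\<leftarrow>xs. c * z powi k)"
    using assms unfolding trig_polynomial_def by blast
  show ?thesis
    by (rule exI[of _ "length xs"], rule exI[of _ "\<lambda>i. fst (xs ! i)"], rule exI[of _ "\<lambda>i. snd (xs ! i)"])
       (auto simp: P sum_list_sum_nth split_beta lessThan_atLeast0)
qed

section \<open>Spectral measures of a transformation with a cyclic vector\<close>

text \<open>Inner regularity of \<open>\<rho>\<close> gives a compact set inside \<open>E\<close>,
  outer regularity of \<open>\<sigma>\<close> an open set of small \<open>\<sigma>\<close>-measure
  around it, and a Urysohn function separates the two. The measures are first transported to the
  plane, where these regularity theorems apply. Squares appear because spectral measures are
  compared through norms in \<open>L\<^sub>2\<close>.\<close>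

lemma indicator_approx_continuous:
  fixes \<sigma> \<rho> :: "complex measure"
  assumes fin: "finite_measure \<sigma>" "finite_measure \<rho>"
    and sets: "sets \<sigma> = sets circle_borel" "sets \<rho> = sets circle_borel"
    and E: "E \<in> sets circle_borel" "measure \<sigma> E = 0" and e: "e > 0"
  obtains f :: "complex \<Rightarrow> real" where "continuous_on (sphere 0 1) f" "\<And>z. 0 \<le> f z" "\<And>z. f z \<le> 1"
    "(LINT z|\<sigma>. (f z)\<^sup>2) \<le> e" "measure \<rho> E - e \<le> (LINT z|\<rho>. (f z)\<^sup>2)"
proof -
  interpret \<sigma>: finite_measure \<sigma> by fact
  interpret \<rho>: finite_measure \<rho> by fact
  have sp: "space \<sigma> = sphere 0 1" "space \<rho> = sphere 0 1" using sets by (auto dest: circle_space)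
  have m: "(\<lambda>z. z) \<in> borel_measurable \<tau>" if "sets \<tau> = sets circle_borel" for \<tau>
    using that by (intro circle_continuous_measurable continuous_intros) auto
  define \<sigma>' where "\<sigma>' = distr \<sigma> borel (\<lambda>z. z)"
  define \<rho>' where "\<rho>' = distr \<rho> borel (\<lambda>z. z)"
  interpret \<sigma>': finite_measure \<sigma>' unfolding \<sigma>'_def by (rule \<sigma>.finite_measure_distr[OF m[OF sets(1)]])
  interpret \<rho>': finite_measure \<rho>' unfolding \<rho>'_def by (rule \<rho>.finite_measure_distr[OF m[OF sets(2)]])
  have meas: "measure \<sigma>' A = measure \<sigma> (A \<inter> sphere 0 1)" "measure \<rho>' A = measure \<rho> (A \<inter> sphere 0 1)"
    if "A \<in> sets borel" for A
    unfolding \<sigma>'_def \<rho>'_def using that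
    by (simp_all add: measure_distr[OF m[OF sets(1)]] measure_distr[OF m[OF sets(2)]] sp)
  have Eb: "E \<in> sets borel" "E \<subseteq> sphere 0 1"
    using E(1) by (auto simp: circle_borel_def sets_restrict_space)
  then have EE: "E \<inter> sphere 0 1 = E" by auto
  have "emeasure \<rho>' E = (SUP K \<in> {K. K \<subseteq> E \<and> compact K}. emeasure \<rho>' K)"
    using Eb(1) \<rho>'.finite_emeasure_space by (intro inner_regular) (simp_all add: \<rho>'_def)
  then obtain K where K: "K \<subseteq> E" "compact K" "measure \<rho>' E - e < measure \<rho>' K"
  proof (cases "measure \<rho>' E - e < 0")
    \<comment> \<open>A negative bound is met by the empty set; \<open>ennreal\<close> would
      truncate it to 0.\<close>
    case True
    then show ?thesis using that[of "{}"] by auto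
  next
    case False
    have "ennreal (measure \<rho>' E - e) < (SUP K \<in> {K. K \<subseteq> E \<and> compact K}. emeasure \<rho>' K)"
      using False e unfolding \<open>emeasure \<rho>' E = _\<close>[symmetric]
      by (simp add: \<rho>'.emeasure_eq_measure ennreal_less_iff)
    then obtain K where "K \<subseteq> E" "compact K" "ennreal (measure \<rho>' E - e) < emeasure \<rho>' K"
      unfolding less_SUP_iff by auto
    then show ?thesis using that False by (simp add: \<rho>'.emeasure_eq_measure ennreal_less_iff)
  qed
  have Kb: "K \<in> sets borel" using K(2) by (simp add: borel_compact)
  have "measure \<sigma>' K \<le> measure \<sigma>' E" using K(1) Eb by (intro \<sigma>'.finite_measure_mono) (auto simp: \<sigma>'_def)
  then have K0: "measure \<sigma>' K = 0" using Eb E(2) by (simp add: meas EE measure_le_0_iff)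
  have "emeasure \<sigma>' K = (INF U \<in> {U. K \<subseteq> U \<and> open U}. emeasure \<sigma>' U)"
    using Kb \<sigma>'.finite_emeasure_space by (intro outer_regular) (simp_all add: \<sigma>'_def)
  then have "(INF U \<in> {U. K \<subseteq> U \<and> open U}. emeasure \<sigma>' U) < ennreal e"
    using K0 e by (simp add: \<sigma>'.emeasure_eq_measure)
  then obtain V where V: "K \<subseteq> V" "open V" "measure \<sigma>' V < e"
    unfolding INF_less_iff using e by (auto simp: \<sigma>'.emeasure_eq_measure ennreal_less_iff)
  have Vb: "V \<in> sets borel" using V(2) by simp
  obtain f :: "complex \<Rightarrow> real" where f: "continuous_on UNIV f" "\<And>x. f x \<in> closed_segment 1 0"
    "\<And>x. x \<in> K \<Longrightarrow> f x = 1" "\<And>x. x \<in> - V \<Longrightarrow> f x = 0"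
    using Urysohn_local[of UNIV K "- V" 1 0] K(2) V(1,2) by (auto simp: compact_imp_closed)
  have f01: "0 \<le> f z" "f z \<le> 1" for z using f(2)[of z] by (auto simp: closed_segment_eq_real_ivl)
  have cf: "continuous_on (sphere 0 1) f" using f(1) continuous_on_subset by blast
  have int: "integrable \<sigma> (\<lambda>z. (f z)\<^sup>2)" "integrable \<rho> (\<lambda>z. (f z)\<^sup>2)"
    using fin sets by (auto intro!: circle_continuous_integrable continuous_intros cf)
  have KV: "K \<inter> sphere 0 1 \<in> sets \<rho>" "V \<inter> sphere 0 1 \<in> sets \<sigma>"
    using Kb Vb unfolding sets by (auto simp: circle_borel_def sets_restrict_space)
  have "(LINT z|\<sigma>. (f z)\<^sup>2) \<le> (LINT z|\<sigma>. indicator (V \<inter> sphere 0 1) z)"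
  proof (rule integral_mono[OF int(1)])
    show "integrable \<sigma> (indicator (V \<inter> sphere 0 1) :: _ \<Rightarrow> real)"
      using KV(2) by (simp add: \<sigma>.emeasure_eq_measure)
    show "(f z)\<^sup>2 \<le> indicator (V \<inter> sphere 0 1) z" if "z \<in> space \<sigma>" for z
      using that f(4)[of z] f01[of z] by (auto simp: sp split: split_indicator intro: power_le_one)
  qed
  also have "\<dots> = measure \<sigma>' V" using KV(2) Vb by (simp add: meas)
  finally have 1: "(LINT z|\<sigma>. (f z)\<^sup>2) \<le> e" using V(3) by simp
  have "measure \<rho> E - e \<le> measure \<rho>' K" using K(3) Eb by (simp add: meas EE)
  also have "\<dots> = (LINT z|\<rho>. indicator (K \<inter> sphere 0 1) z)" using KV(1) Kb by (simp add: meas)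
  also have "\<dots> \<le> (LINT z|\<rho>. (f z)\<^sup>2)"
  proof (rule integral_mono[OF _ int(2)])
    show "integrable \<rho> (indicator (K \<inter> sphere 0 1) :: _ \<Rightarrow> real)"
      using KV(1) by (simp add: \<rho>.emeasure_eq_measure)
    show "indicator (K \<inter> sphere 0 1) z \<le> (f z)\<^sup>2" for z
      using f(3)[of z] by (auto split: split_indicator)
  qed
  finally have 2: "measure \<rho> E - e \<le> (LINT z|\<rho>. (f z)\<^sup>2)" .
  from that[OF cf f01 1 2] show ?thesis .
qed

context koopman
begin

text \<open>Sequences of orbit points may repeat, unlike the finite subsets of the orbit in the definition
  of the closed span.\<close>

definition approx_cyclic :: "('a \<Rightarrow> complex) \<Rightarrow> bool" where
  "approx_cyclic h \<longleftrightarrow> h \<in> L2 M \<and> (\<forall>g\<in>L2 M. \<forall>e>0. \<exists>n c \<kappa>.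
     (LINT x|M. (cmod (g x - (\<Sum>i<(n::nat). c i * U (\<kappa> i) h x)))\<^sup>2) < e)"

lemma simple_spectrum_if_approx_cyclic:
  assumes "approx_cyclic h" shows "simple_spectrum M T"
proof -
  have "L2_closed_span M (range (\<lambda>k. U k h)) = L2 M"
  proof
    show "L2 M \<subseteq> L2_closed_span M (range (\<lambda>k. U k h))"
      unfolding L2_closed_span_def
    proof (intro subsetI CollectI conjI allI impI)
      fix g e assume g: "g \<in> L2 M" and e: "(e::real) > 0"
      then have "e\<^sup>2 > 0" by simp
      then obtain n c \<kappa> where 1: "(LINT x|M. (cmod (g x - (\<Sum>i<(n::nat). c i * U (\<kappa> i) h x)))\<^sup>2) < e\<^sup>2"
        using assms g unfolding approx_cyclic_def by blast
      define u where "u i = U (\<kappa> i) h" for i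
      \<comment> \<open>Coinciding translates are merged and their coefficients added, since the
        closed span is defined through finite sets of functions.\<close>
      define c' where "c' f = (\<Sum>i\<in>{i\<in>{..<n}. u i = f}. c i)" for f
      have "(\<Sum>f\<in>u ` {..<n}. c' f * f x) = (\<Sum>i<n. c i * U (\<kappa> i) h x)" for x
      proof -
        have "(\<Sum>i<n. c i * u i x) = (\<Sum>f\<in>u ` {..<n}. \<Sum>i\<in>{i\<in>{..<n}. u i = f}. c i * u i x)"
          by (rule sum.image_gen) simp
        also have "\<dots> = (\<Sum>f\<in>u ` {..<n}. c' f * f x)"
          unfolding c'_def sum_distrib_right by (intro sum.cong refl) auto
        finally show ?thesis by (simp add: u_def)
      qed
      then have "L2_norm M (\<lambda>x. g x - (\<Sum>f\<in>u ` {..<n}. c' f * f x)) < e"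
        using 1 e by (auto simp: L2_norm_def intro!: real_less_lsqrt)
      then show "\<exists>B c. finite B \<and> B \<subseteq> range (\<lambda>k. U k h) \<and> L2_norm M (\<lambda>x. g x - (\<Sum>f\<in>B. c f * f x)) < e"
        by (intro exI[of _ "u ` {..<n}"] exI[of _ c']) (auto simp: u_def)
    qed
  qed (auto simp: L2_closed_span_def)
  then show ?thesis
    using assms unfolding simple_spectrum_def cyclic_vector_def approx_cyclic_def by blast
qed

lemma spectral_measure_total:
  assumes "g \<in> L2 M" "spectral_measure M T g \<sigma>"
  shows "measure \<sigma> (space \<sigma>) = (LINT x|M. (cmod (g x))\<^sup>2)"
proof -
  have "complex_of_real (measure \<sigma> (space \<sigma>)) = (LINT z|\<sigma>. z powi 0)"
    by (simp add: scaleR_conv_of_real)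
  also have "\<dots> = corr g 0" using assms(2) unfolding spectral_measure_def by blast
  finally show ?thesis by (simp only: corr_0 of_real_eq_iff)
qed

text \<open>Split \<open>g\<close> into a combination \<open>g'\<close> of orbit vectors of
  \<open>h\<close> and an error \<open>d\<close>, and let the operator polynomial of
  \<open>P\<close> act on both. On \<open>g'\<close> it is computed in the circle model of
  \<open>h\<close>, where the combination is bounded by the sum of the moduli of its coefficients;
  on \<open>d\<close> its norm is at most \<open>B\<close>.\<close>

lemma spectral_comparison:
  assumes h: "h \<in> L2 M" and g: "g \<in> L2 M"
    and \<sigma>: "spectral_measure M T h \<sigma>" and \<rho>: "spectral_measure M T g \<rho>"
    and P: "trig_polynomial P" and PB: "\<And>z. z \<in> sphere 0 1 \<Longrightarrow> cmod (P z) \<le> B"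
  shows "(LINT z|\<rho>. (cmod (P z))\<^sup>2) \<le> 2 * (\<Sum>j<m. cmod (b j))\<^sup>2 * (LINT z|\<sigma>. (cmod (P z))\<^sup>2)
    + 2 * B\<^sup>2 * (LINT x|M. (cmod (g x - (\<Sum>j<(m::nat). b j * U (\<eta> j) h x)))\<^sup>2)"
proof -
  have fin: "finite_measure \<sigma>" and s: "sets \<sigma> = sets circle_borel"
    using \<sigma> by (auto simp: spectral_measure_def)
  have s\<rho>: "sets \<rho> = sets circle_borel" using \<rho> by (auto simp: spectral_measure_def)
  obtain n c \<kappa> where "\<forall>z\<in>sphere 0 1. P z = (\<Sum>i<(n::nat). c i * z powi \<kappa> i)"
    using trig_polynomial_sum[OF P] by blast
  then have Ps: "P z = (\<Sum>i<n. c i * z powi \<kappa> i)" if "z \<in> sphere 0 1" for z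
    using that by blast
  have PsI: "(LINT z|\<tau>. (cmod (\<Sum>i<n. c i * z powi \<kappa> i))\<^sup>2) = (LINT z|\<tau>. (cmod (P z))\<^sup>2)"
    if "sets \<tau> = sets circle_borel" for \<tau>
    by (rule Bochner_Integration.integral_cong) (simp_all add: circle_space[OF that] Ps)
  define g' where "g' x = (\<Sum>j<m. b j * U (\<eta> j) h x)" for x
  define d where "d x = g x - g' x" for x
  have g': "g' \<in> L2 M" unfolding g'_def by (rule L2_trig[OF h])
  have d: "d \<in> L2 M" unfolding d_def by (rule L2_diff[OF g g'])
  \<comment> \<open>A spectral measure of the error itself turns the bound on \<open>P\<close> into
    an operator bound.\<close>
  obtain \<tau> where \<tau>: "spectral_measure M T d \<tau>" using spectral_measure_exists[OF d] by blast
  then have s\<tau>: "sets \<tau> = sets circle_borel" and fin\<tau>: "finite_measure \<tau>"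
    by (auto simp: spectral_measure_def)
  let ?S = "\<lambda>g x. \<Sum>i<n. c i * U (\<kappa> i) g x"
  have "(LINT z|\<rho>. (cmod (P z))\<^sup>2) = (LINT x|M. (cmod (?S g x))\<^sup>2)"
    using spectral_trig[OF g \<rho>, of c \<kappa> "{..<n}"] PsI[OF s\<rho>] by simp
  also have "\<dots> = (LINT x|M. (cmod (?S g' x + ?S d x))\<^sup>2)"
    by (intro Bochner_Integration.integral_cong refl)
       (simp add: d_def koopman_power_def algebra_simps flip: sum.distrib)
  also have "\<dots> \<le> 2 * (LINT x|M. (cmod (?S g' x))\<^sup>2) + 2 * (LINT x|M. (cmod (?S d x))\<^sup>2)"
    by (intro integral_cmod_add_sq_le L2_trig g' d)
  also have "(LINT x|M. (cmod (?S d x))\<^sup>2) \<le> B\<^sup>2 * (LINT x|M. (cmod (d x))\<^sup>2)"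
  proof -
    have "(LINT x|M. (cmod (?S d x))\<^sup>2) = (LINT z|\<tau>. (cmod (P z))\<^sup>2)"
      using spectral_trig[OF d \<tau>, of c \<kappa> "{..<n}"] PsI[OF s\<tau>] by simp
    also have "\<dots> \<le> (LINT z|\<tau>. B\<^sup>2)"
      using PB by (intro integral_mono circle_continuous_integrable[OF fin\<tau> s\<tau>] continuous_intros
          trig_polynomial_continuous[OF P] power_mono) (auto simp: circle_space[OF s\<tau>])
    finally show ?thesis by (simp add: spectral_measure_total[OF d \<tau>] mult.commute)
  qed
  also have "(LINT x|M. (cmod (?S g' x))\<^sup>2) \<le> (\<Sum>j<m. cmod (b j))\<^sup>2 * (LINT z|\<sigma>. (cmod (P z))\<^sup>2)"
  proof -
    have "(LINT x|M. (cmod (?S g' x))\<^sup>2) =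
       (LINT x|M. (cmod (\<Sum>p\<in>{..<n}\<times>{..<m}. (c (fst p) * b (snd p)) * U (\<eta> (snd p) + \<kappa> (fst p)) h x))\<^sup>2)"
    proof (intro Bochner_Integration.integral_cong refl)
      fix x assume x: "x \<in> space M"
      have "?S g' x = (\<Sum>i<n. \<Sum>j<m. (c i * b j) * U (\<eta> j + \<kappa> i) h x)"
        using It_add[OF x] by (simp add: g'_def koopman_power_def sum_distrib_left mult.assoc)
      also have "\<dots> = (\<Sum>p\<in>{..<n}\<times>{..<m}. (c (fst p) * b (snd p)) * U (\<eta> (snd p) + \<kappa> (fst p)) h x)"
        by (simp add: sum.cartesian_product split_beta)
      finally show "(cmod (?S g' x))\<^sup>2 = (cmod (\<Sum>p\<in>{..<n}\<times>{..<m}. (c (fst p) * b (snd p)) * U (\<eta> (snd p) + \<kappa> (fst p)) h x))\<^sup>2"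
        by simp
    qed
    also have "\<dots> = (LINT z|\<sigma>. (cmod (\<Sum>p\<in>{..<n}\<times>{..<m}. (c (fst p) * b (snd p)) * z powi (\<eta> (snd p) + \<kappa> (fst p))))\<^sup>2)"
      by (rule spectral_trig[OF h \<sigma>])
    also have "\<dots> = (LINT z|\<sigma>. (cmod (P z) * cmod (\<Sum>j<m. b j * z powi \<eta> j))\<^sup>2)"
    proof (intro Bochner_Integration.integral_cong refl)
      fix z assume "z \<in> space \<sigma>"
      then have z: "z \<in> sphere 0 1" by (simp add: circle_space[OF s])
      then have z0: "z \<noteq> 0" by auto
      have "(\<Sum>p\<in>{..<n}\<times>{..<m}. (c (fst p) * b (snd p)) * z powi (\<eta> (snd p) + \<kappa> (fst p))) =
          (\<Sum>i<n. \<Sum>j<m. (c i * b j) * z powi (\<eta> j + \<kappa> i))"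
        by (simp add: sum.cartesian_product split_beta)
      also have "\<dots> = P z * (\<Sum>j<m. b j * z powi \<eta> j)"
        unfolding Ps[OF z] sum_product by (intro sum.cong refl) (simp add: power_int_add z0)
      finally show "(cmod (\<Sum>p\<in>{..<n}\<times>{..<m}. (c (fst p) * b (snd p)) * z powi (\<eta> (snd p) + \<kappa> (fst p))))\<^sup>2
        = (cmod (P z) * cmod (\<Sum>j<m. b j * z powi \<eta> j))\<^sup>2" by (simp add: norm_mult)
    qed
    also have "\<dots> \<le> (LINT z|\<sigma>. (cmod (P z) * (\<Sum>j<m. cmod (b j)))\<^sup>2)"
    proof (intro integral_mono circle_continuous_integrable[OF fin s])
      show "continuous_on (sphere 0 1) (\<lambda>z. (cmod (P z) * cmod (\<Sum>j<m. b j * z powi \<eta> j))\<^sup>2)"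
        by (intro continuous_intros trig_polynomial_continuous[OF P] continuous_on_powi_sphere)
      show "continuous_on (sphere 0 1) (\<lambda>z. (cmod (P z) * (\<Sum>j<m. cmod (b j)))\<^sup>2)"
        by (intro continuous_intros trig_polynomial_continuous[OF P])
      fix z assume "z \<in> space \<sigma>"
      then have z: "cmod z = 1" by (simp add: circle_space[OF s])
      have "cmod (\<Sum>j<m. b j * z powi \<eta> j) \<le> (\<Sum>j<m. cmod (b j))"
        by (rule order.trans[OF norm_sum]) (simp add: norm_mult norm_power_int z)
      then show "(cmod (P z) * cmod (\<Sum>j<m. b j * z powi \<eta> j))\<^sup>2 \<le> (cmod (P z) * (\<Sum>j<m. cmod (b j)))\<^sup>2"
        by (intro power_mono mult_left_mono) auto
    qed
    also have "\<dots> = (\<Sum>j<m. cmod (b j))\<^sup>2 * (LINT z|\<sigma>. (cmod (P z))\<^sup>2)"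
      by (simp add: power_mult_distrib)
    finally show ?thesis .
  qed
  finally show ?thesis by (simp add: d_def g'_def)
qed

text \<open>For a \<open>\<sigma>\<close>-null set \<open>E\<close> the comparison is applied to a
  polynomial close to a continuous substitute for the indicator of \<open>E\<close>, good for both
  measures. The term with \<open>\<sigma>\<close> becomes small, which leaves only the approximation
  error of \<open>g\<close>.\<close>

lemma absolutely_continuous_spectral:
  assumes h: "approx_cyclic h" and \<sigma>: "spectral_measure M T h \<sigma>"
    and g: "g \<in> L2 M" and \<rho>: "spectral_measure M T g \<rho>"
  shows "absolutely_continuous \<sigma> \<rho>"
proof -
  have hL: "h \<in> L2 M" using h by (simp add: approx_cyclic_def)
  have fin: "finite_measure \<sigma>" "finite_measure \<rho>"
    and s: "sets \<sigma> = sets circle_borel" "sets \<rho> = sets circle_borel"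
    using \<sigma> \<rho> by (auto simp: spectral_measure_def)
  interpret \<sigma>: finite_measure \<sigma> by fact
  interpret \<rho>: finite_measure \<rho> by fact
  define s1 where "s1 = measure \<sigma> (space \<sigma>)"
  define r1 where "r1 = measure \<rho> (space \<rho>)"
  have sr: "s1 \<ge> 0" "r1 \<ge> 0" by (auto simp: s1_def r1_def)
  have main: "measure \<rho> E \<le> 0" if E: "E \<in> sets circle_borel" "measure \<sigma> E = 0" for E
  proof (rule field_le_epsilon)
    fix e' :: real assume "e' > 0"
    define e where "e = e' / 20"
    have e: "e > 0" using \<open>e' > 0\<close> by (simp add: e_def)
    obtain m b \<eta> where a: "(LINT x|M. (cmod (g x - (\<Sum>j<(m::nat). b j * U (\<eta> j) h x)))\<^sup>2) < e"
      using h g e unfolding approx_cyclic_def by blast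
    \<comment> \<open>The coefficients of the approximant may be large, so \<open>e1\<close> and
      \<open>\<delta>\<close> are chosen only after them.\<close>
    define B where "B = (\<Sum>j<m. cmod (b j))"
    define e1 where "e1 = e / (8 * B\<^sup>2 + 1)"
    have B: "8 * B\<^sup>2 + 1 > 0" using zero_le_power2[of B] by linarith
    have e1: "e1 > 0" "e1 \<le> e" "8 * B\<^sup>2 * e1 \<le> e"
      using e B by (auto simp: e1_def divide_simps mult_le_cancel_left1 algebra_simps)
    obtain f :: "complex \<Rightarrow> real" where f: "continuous_on (sphere 0 1) f" "\<And>z. 0 \<le> f z" "\<And>z. f z \<le> 1"
        "(LINT z|\<sigma>. (f z)\<^sup>2) \<le> e1" "measure \<rho> E - e1 \<le> (LINT z|\<rho>. (f z)\<^sup>2)"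
      using indicator_approx_continuous[OF fin s E e1(1)] by blast
    \<comment> \<open>\<open>D\<close> collects the factors of \<open>\<delta>\<^sup>2\<close> in
      the final estimate; the summand 1 keeps it positive.\<close>
    define D where "D = 8 * B\<^sup>2 * s1 + 2 * r1 + 1"
    have D: "D \<ge> 1" using sr by (simp add: D_def)
    define \<delta> where "\<delta> = min 1 (e / D)"
    have \<delta>: "0 < \<delta>" "\<delta> \<le> 1" "D * \<delta>\<^sup>2 \<le> e"
    proof -
      show 1: "0 < \<delta>" "\<delta> \<le> 1" using e D by (auto simp: \<delta>_def)
      have "\<delta>\<^sup>2 \<le> \<delta>" using 1 by (simp add: power2_eq_square mult_left_le)
      also have "\<dots> \<le> e / D" by (simp add: \<delta>_def)
      finally show "D * \<delta>\<^sup>2 \<le> e" using D by (simp add: field_simps)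
    qed
    obtain P where P: "trig_polynomial P" "\<And>z. z \<in> sphere 0 1 \<Longrightarrow> cmod (of_real (f z) - P z) < \<delta>"
      using trig_polynomial_dense[OF f(1) \<delta>(1)] by blast
    have P2: "cmod (P z) \<le> 2" if "z \<in> sphere 0 1" for z
      using norm_triangle_sub[of "P z" "of_real (f z)"] P(2)[OF that] f(2,3)[of z] \<delta>
      by (simp add: norm_minus_commute)
    have iP: "integrable \<tau> (\<lambda>z. (cmod (P z))\<^sup>2)" and i_f: "integrable \<tau> (\<lambda>z. (f z)\<^sup>2)"
      if "finite_measure \<tau>" "sets \<tau> = sets circle_borel" for \<tau>
      by (intro circle_continuous_integrable[OF that] continuous_intros trig_polynomial_continuous[OF P(1)] f(1))+
    have pt: "(cmod (P z))\<^sup>2 \<le> 2 * (f z)\<^sup>2 + 2 * \<delta>\<^sup>2" "(f z)\<^sup>2 \<le> 2 * (cmod (P z))\<^sup>2 + 2 * \<delta>\<^sup>2"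
      if "z \<in> sphere 0 1" for z
    proof -
      have "(cmod (of_real (f z) - P z))\<^sup>2 \<le> \<delta>\<^sup>2" using P(2)[OF that] by (intro power_mono) auto
      then show "(cmod (P z))\<^sup>2 \<le> 2 * (f z)\<^sup>2 + 2 * \<delta>\<^sup>2" "(f z)\<^sup>2 \<le> 2 * (cmod (P z))\<^sup>2 + 2 * \<delta>\<^sup>2"
        using cmod_add_sq_le[of "of_real (f z)" "P z - of_real (f z)"] cmod_add_sq_le[of "P z" "of_real (f z) - P z"]
        by (auto simp: norm_minus_commute)
    qed
    have "(LINT z|\<sigma>. (cmod (P z))\<^sup>2) \<le> (LINT z|\<sigma>. 2 * (f z)\<^sup>2 + 2 * \<delta>\<^sup>2)"
      using iP[OF fin(1) s(1)] i_f[OF fin(1) s(1)] pt(1)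
      by (intro integral_mono) (auto simp: circle_space[OF s(1)])
    also have "\<dots> = 2 * (LINT z|\<sigma>. (f z)\<^sup>2) + 2 * \<delta>\<^sup>2 * s1"
      using i_f[OF fin(1) s(1)] by (simp add: s1_def)
    also have "\<dots> \<le> 2 * e1 + 2 * \<delta>\<^sup>2 * s1" using f(4) by simp
    finally have A: "(LINT z|\<sigma>. (cmod (P z))\<^sup>2) \<le> 2 * e1 + 2 * \<delta>\<^sup>2 * s1" .
    have "(LINT z|\<rho>. (f z)\<^sup>2) \<le> (LINT z|\<rho>. 2 * (cmod (P z))\<^sup>2 + 2 * \<delta>\<^sup>2)"
      using iP[OF fin(2) s(2)] i_f[OF fin(2) s(2)] pt(2)
      by (intro integral_mono) (auto simp: circle_space[OF s(2)])
    also have "\<dots> = 2 * (LINT z|\<rho>. (cmod (P z))\<^sup>2) + 2 * \<delta>\<^sup>2 * r1"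
      using iP[OF fin(2) s(2)] by (simp add: r1_def)
    finally have C: "(LINT z|\<rho>. (f z)\<^sup>2) \<le> 2 * (LINT z|\<rho>. (cmod (P z))\<^sup>2) + 2 * \<delta>\<^sup>2 * r1" .
    have "(LINT z|\<rho>. (cmod (P z))\<^sup>2) \<le> 2 * B\<^sup>2 * (LINT z|\<sigma>. (cmod (P z))\<^sup>2) + 2 * 2\<^sup>2 * e"
      using spectral_comparison[OF hL g \<sigma> \<rho> P(1) P2, of b m \<eta>] a by (simp add: B_def)
    also have "2 * B\<^sup>2 * (LINT z|\<sigma>. (cmod (P z))\<^sup>2) \<le> 2 * B\<^sup>2 * (2 * e1 + 2 * \<delta>\<^sup>2 * s1)"
      using A by (intro mult_left_mono) auto
    also have "2 * B\<^sup>2 * (2 * e1 + 2 * \<delta>\<^sup>2 * s1) = 4 * (B\<^sup>2 * e1) + 4 * (B\<^sup>2 * s1 * \<delta>\<^sup>2)"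
      by (simp add: algebra_simps)
    finally have F: "(LINT z|\<rho>. (cmod (P z))\<^sup>2) \<le> 4 * (B\<^sup>2 * e1) + 4 * (B\<^sup>2 * s1 * \<delta>\<^sup>2) + 8 * e"
      by simp
    have "D * \<delta>\<^sup>2 = 8 * (B\<^sup>2 * s1 * \<delta>\<^sup>2) + 2 * \<delta>\<^sup>2 * r1 + \<delta>\<^sup>2"
      by (simp add: D_def algebra_simps)
    then have "measure \<rho> E \<le> e1 + (8 * (B\<^sup>2 * e1) + D * \<delta>\<^sup>2 + 16 * e)"
      using C F f(5) zero_le_power2[of \<delta>] by linarith
    \<comment> \<open>Three terms of size at most \<open>e\<close> and \<open>16 * e\<close> are
      summed, whence the division by 20 at the start.\<close>
    also have "\<dots> \<le> 20 * e" using e1 \<delta> e by (simp add: mult.assoc)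
    finally show "measure \<rho> E \<le> 0 + e'" by (simp add: e_def)
  qed
  show ?thesis
    unfolding absolutely_continuous_def
  proof
    fix E assume "E \<in> null_sets \<sigma>"
    then have "E \<in> sets circle_borel" "measure \<sigma> E = 0"
      using s by (auto simp: \<sigma>.emeasure_eq_measure)
    from main[OF this] this(1) show "E \<in> null_sets \<rho>"
      using s by (auto simp: \<rho>.emeasure_eq_measure measure_le_0_iff)
  qed
qed

end

section \<open>Rigidity implies singular spectrum\<close>

lemma cis_circle_measurable: "cis \<in> measurable (restrict_space lborel A) circle_borel"
  unfolding circle_borel_def
  by (intro measurable_restrict_space1 measurable_restrict_space2)
     (auto intro!: borel_measurable_continuous_onI continuous_on_cis continuous_intros)

lemma sets_circle_lebesgue: "sets circle_lebesgue = sets circle_borel"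
  by (simp add: circle_lebesgue_def)

lemma finite_circle_lebesgue: "finite_measure circle_lebesgue"
  unfolding circle_lebesgue_def
  by (rule finite_measure.finite_measure_distr[OF _ cis_circle_measurable], rule finite_measureI)
     (simp add: emeasure_restrict_space)

lemma circle_lebesgue_powi:
  "(LINT z|circle_lebesgue. z powi k) = (if k = 0 then of_real (2 * pi) else 0)"
proof -
  have "(LINT z|circle_lebesgue. z powi k) = (LINT t|restrict_space lborel {0..<2*pi}. cis t powi k)"
    unfolding circle_lebesgue_def
    by (intro integral_distr[OF cis_circle_measurable] circle_continuous_measurable continuous_on_powi_sphere refl)
  also have "\<dots> = (LINT t|lborel. indicator {0..<2*pi} t *\<^sub>R cis t powi k)"
    by (subst integral_restrict_space) auto
  also have "\<dots> = (LINT t|lborel. indicator {0..2*pi} t *\<^sub>R cis (of_int k * t))"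
  proof (rule integral_cong_AE)
    have [measurable]: "(\<lambda>t. cis (of_int k * t)) \<in> borel_measurable borel"
      by (intro borel_measurable_continuous_onI continuous_on_cis continuous_intros)
    have c: "cis t powi k = cis (of_int k * t)" for t by (simp add: cis_power_int)
    show "(\<lambda>t. indicator {0..<2*pi} t *\<^sub>R cis t powi k) \<in> borel_measurable lborel"
      unfolding c by measurable
    show "(\<lambda>t. indicator {0..2*pi} t *\<^sub>R cis (of_int k * t)) \<in> borel_measurable lborel"
      by measurable
    show "AE t in lborel. indicator {0..<2*pi} t *\<^sub>R cis t powi k = indicator {0..2*pi} t *\<^sub>R cis (of_int k * t)"
      unfolding c using AE_lborel_singleton[of "2*pi"]
      by eventually_elim (auto split: split_indicator)
  qed
  also have "\<dots> = (if k = 0 then of_real (2 * pi) else 0)"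
    by (rule has_bochner_integral_integral_eq[OF has_bochner_integral_cis])
  finally show ?thesis .
qed

text \<open>The average of the characters \<open>1, z\<^sup>r, \<dots>, z\<^sup>r\<^sup>(\<^sup>K\<^sup>-\<^sup>1\<^sup>)\<close> is small in \<open>L\<^sub>2\<close> of arc length by
  orthogonality, but close to 1 in \<open>L\<^sub>2\<close> of a spectral measure along a rigidity sequence \<open>r\<close>.\<close>

definition power_average :: "nat \<Rightarrow> int \<Rightarrow> complex \<Rightarrow> complex" where
  "power_average K r z = (\<Sum>k<K. (1 / of_nat K) * z powi (r * int k))"

lemma power_average_continuous: "continuous_on (sphere 0 1) (power_average K r)"
  unfolding power_average_def by (intro continuous_intros continuous_on_powi_sphere)

lemma power_average_lebesgue:
  assumes "r \<noteq> 0" "K > 0"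
  shows "(LINT z|circle_lebesgue. (cmod (power_average K r z))\<^sup>2) = 2 * pi / K"
proof -
  have L: "(\<lambda>z. z powi (r * int k)) \<in> L2 circle_lebesgue" for k
    unfolding L2_def using circle_continuous_measurable[OF sets_circle_lebesgue continuous_on_powi_sphere]
    by (auto intro!: circle_continuous_integrable[OF finite_circle_lebesgue sets_circle_lebesgue]
        continuous_intros continuous_on_powi_sphere)
  have "complex_of_real (LINT z|circle_lebesgue. (cmod (power_average K r z))\<^sup>2) =
     (\<Sum>i<K. \<Sum>j<K. (1 / of_nat K) * cnj (1 / of_nat K) *
        (LINT z|circle_lebesgue. z powi (r * int i) * cnj (z powi (r * int j))))"
    unfolding power_average_def
    by (rule integral_cmod_sum_sq[where u = "\<lambda>k z. z powi (r * int k)"]) (rule L)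
  also have "\<dots> = (\<Sum>i<K. \<Sum>j<K. if j = i then of_real (2 * pi / (real K)\<^sup>2) else 0)"
  proof (intro sum.cong refl)
    fix i j
    have "(LINT z|circle_lebesgue. z powi (r * int i) * cnj (z powi (r * int j))) =
        (LINT z|circle_lebesgue. z powi (r * int i - r * int j))"
      by (rule Bochner_Integration.integral_cong[OF refl], rule powi_mult_cnj)
         (simp add: circle_space[OF sets_circle_lebesgue])
    also have "\<dots> = (if j = i then of_real (2 * pi) else 0)"
      unfolding circle_lebesgue_powi using assms(1) by (auto simp flip: right_diff_distrib)
    finally show "(1 / of_nat K) * cnj (1 / of_nat K) *
        (LINT z|circle_lebesgue. z powi (r * int i) * cnj (z powi (r * int j))) =
        (if j = i then of_real (2 * pi / (real K)\<^sup>2) else 0)"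
      by (simp add: power2_eq_square)
  qed
  also have "\<dots> = of_real (2 * pi / K)"
    using assms(2) by (simp add: power2_eq_square)
  finally show ?thesis by (simp only: of_real_eq_iff)
qed

text \<open>Telescoping: each further factor \<open>z powi r\<close> moves a number of modulus 1 by
  \<open>cmod (z powi r - 1)\<close>.\<close>

lemma norm_one_minus_powi:
  assumes "cmod z = 1" shows "cmod (1 - z powi (r * int k)) \<le> real k * cmod (z powi r - 1)"
proof (induction k)
  case (Suc k)
  have "z \<noteq> 0" using assms by auto
  then have "z powi (r * int (Suc k)) = z powi r * z powi (r * int k)"
    by (simp add: distrib_left power_int_add)
  then have "1 - z powi (r * int (Suc k)) = (1 - z powi (r * int k)) - z powi (r * int k) * (z powi r - 1)"
    by (simp add: algebra_simps)
  then have "cmod (1 - z powi (r * int (Suc k))) \<le> cmod (1 - z powi (r * int k)) + cmod (z powi (r * int k) * (z powi r - 1))"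
    by (simp only: norm_triangle_ineq4)
  also have "cmod (z powi (r * int k) * (z powi r - 1)) = cmod (z powi r - 1)"
    using assms by (simp add: norm_mult norm_power_int)
  finally show ?case using Suc.IH by (simp add: algebra_simps)
qed simp

lemma norm_one_minus_power_average:
  assumes "cmod z = 1" "K > 0"
  shows "cmod (1 - power_average K r z) \<le> real K * cmod (z powi r - 1)"
proof -
  have "1 - power_average K r z = (\<Sum>k<K. (1 / of_nat K) * (1 - z powi (r * int k)))"
    using assms(2) by (simp add: power_average_def right_diff_distrib sum_subtractf)
  then have "cmod (1 - power_average K r z) \<le> (\<Sum>k<K. cmod ((1 / of_nat K) * (1 - z powi (r * int k))))"
    by (simp only: norm_sum)
  also have "\<dots> \<le> (\<Sum>k<K. (1 / real K) * (real K * cmod (z powi r - 1)))"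
  proof (intro sum_mono)
    fix k assume "k \<in> {..<K}"
    then have "real k * cmod (z powi r - 1) \<le> real K * cmod (z powi r - 1)"
      by (intro mult_right_mono) auto
    then have "cmod (1 - z powi (r * int k)) \<le> real K * cmod (z powi r - 1)" (is "?a \<le> ?b")
      using norm_one_minus_powi[OF assms(1), of r k] by linarith
    then show "cmod ((1 / of_nat K) * (1 - z powi (r * int k))) \<le> (1 / real K) * (real K * cmod (z powi r - 1))"
      unfolding norm_mult by (intro mult_mono) (auto simp: norm_divide)
  qed
  also have "\<dots> = real K * cmod (z powi r - 1)" using assms(2) by simp
  finally show ?thesis .
qed

text \<open>Summable integrals make the sum of the functions finite almost everywhere, so its terms
  tend to 0 there.\<close>

lemma AE_tendsto_0_if_integral_le:
  fixes f :: "nat \<Rightarrow> 'a \<Rightarrow> real"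
  assumes int: "\<And>j. integrable M (f j)" and nonneg: "\<And>j x. 0 \<le> f j x"
    and le: "\<And>j. integral\<^sup>L M (f j) \<le> c * (1/2) ^ j"
  shows "AE x in M. (\<lambda>j. f j x) \<longlonglongrightarrow> 0"
proof -
  have "0 \<le> integral\<^sup>L M (f 0)" using nonneg by (intro integral_nonneg_AE) auto
  then have c: "0 \<le> c" using le[of 0] by simp
  have [measurable]: "\<And>j. f j \<in> borel_measurable M" using int by auto
  have "(\<integral>\<^sup>+x. (\<Sum>j. ennreal (f j x)) \<partial>M) = (\<Sum>j. \<integral>\<^sup>+x. ennreal (f j x) \<partial>M)"
    by (intro nn_integral_suminf) simp
  also have "\<dots> \<le> (\<Sum>j. ennreal (c * (1/2) ^ j))"
    using le by (intro suminf_le) (auto simp: nn_integral_eq_integral[OF int] nonneg ennreal_leI)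
  also have "\<dots> < \<infinity>"
  proof -
    have "summable (\<lambda>j. c * (1/2::real) ^ j)" by (intro summable_mult summable_geometric) simp
    then show ?thesis using c by (subst suminf_ennreal2) auto
  qed
  finally have "(\<integral>\<^sup>+x. (\<Sum>j. ennreal (f j x)) \<partial>M) \<noteq> \<infinity>" by simp
  then have "AE x in M. (\<Sum>j. ennreal (f j x)) \<noteq> \<infinity>"
    by (intro nn_integral_noteq_infinite) auto
  then show ?thesis
  proof eventually_elim
    case (elim x)
    then have "summable (\<lambda>j. f j x)" using nonneg by (intro summable_suminf_not_top) auto
    then show ?case by (rule summable_LIMSEQ_zero)
  qed
qed

context koopman
begin

text \<open>Rigidity of one vector is enough once that vector is cyclic, because its spectral
  measure then has maximal type. The exponents are only asked to be nonzero, as this already makes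
  the powers of \<open>z powi r\<close> orthogonal for arc length.\<close>

definition rigid_vector :: "('a \<Rightarrow> complex) \<Rightarrow> bool" where
  "rigid_vector h \<longleftrightarrow> (\<forall>e>0. \<exists>r. r \<noteq> 0 \<and> (LINT x|M. (cmod (U r h x - h x))\<^sup>2) < e)"

text \<open>The averages \<open>A j\<close> tend to 1 almost everywhere for \<open>\<sigma>\<close>
  and to 0 almost everywhere for arc length, so the two measures live on disjoint sets.\<close>

lemma mutually_singular_if_rigid:
  assumes h: "h \<in> L2 M" "rigid_vector h" and \<sigma>: "spectral_measure M T h \<sigma>"
  shows "mutually_singular \<sigma> circle_lebesgue"
proof -
  have fin: "finite_measure \<sigma>" and s: "sets \<sigma> = sets circle_borel"
    using \<sigma> by (auto simp: spectral_measure_def)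
  note ci = circle_continuous_integrable[OF fin s]
    and cl = circle_continuous_integrable[OF finite_circle_lebesgue sets_circle_lebesgue]
  have eq: "(LINT x|M. (cmod (U r h x - h x))\<^sup>2) = (LINT z|\<sigma>. (cmod (z powi r - 1))\<^sup>2)" for r
    using spectral_trig[OF h(1) \<sigma>, of "\<lambda>i. if i = 0 then 1 else -1" "\<lambda>i. if i = 0 then r else 0" "{..<2::nat}"]
    by (simp add: numeral_2_eq_2 koopman_power_def)
  \<comment> \<open>An average of \<open>2 ^ j\<close> powers multiplies the squared displacement by
    at most \<open>4 ^ j\<close>; the rate \<open>(1/8) ^ j\<close> still leaves the summable
    \<open>(1/2) ^ j\<close>.\<close>
  have "\<exists>r. r \<noteq> 0 \<and> (LINT z|\<sigma>. (cmod (z powi r - 1))\<^sup>2) < (1/8) ^ j" for j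
    using h(2) unfolding rigid_vector_def eq by simp
  then obtain r where r: "\<And>j. r j \<noteq> 0" "\<And>j. (LINT z|\<sigma>. (cmod (z powi r j - 1))\<^sup>2) < (1/8) ^ j"
    by metis
  define A where "A j = power_average (2 ^ j) (r j)" for j
  have cA: "continuous_on (sphere 0 1) (A j)" for j
    unfolding A_def by (rule power_average_continuous)
  have "AE z in \<sigma>. (\<lambda>j. (cmod (1 - A j z))\<^sup>2) \<longlonglongrightarrow> 0"
  proof (rule AE_tendsto_0_if_integral_le[where c = 1])
    fix j
    show "integrable \<sigma> (\<lambda>z. (cmod (1 - A j z))\<^sup>2)"
      by (intro ci continuous_intros cA)
    have "(LINT z|\<sigma>. (cmod (1 - A j z))\<^sup>2) \<le> (LINT z|\<sigma>. (2 ^ j)\<^sup>2 * (cmod (z powi r j - 1))\<^sup>2)"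
    proof (intro integral_mono ci continuous_intros cA continuous_on_powi_sphere)
      fix z assume "z \<in> space \<sigma>"
      then have "cmod z = 1" by (simp add: circle_space[OF s])
      from norm_one_minus_power_average[OF this, of "2 ^ j" "r j"]
      show "(cmod (1 - A j z))\<^sup>2 \<le> (2 ^ j)\<^sup>2 * (cmod (z powi r j - 1))\<^sup>2"
        by (simp add: A_def power_mono flip: power_mult_distrib)
    qed auto
    also have "\<dots> = (2 ^ j)\<^sup>2 * (LINT z|\<sigma>. (cmod (z powi r j - 1))\<^sup>2)" by simp
    also have "\<dots> \<le> (2 ^ j)\<^sup>2 * (1/8) ^ j" using r(2)[of j] by (intro mult_left_mono) auto
    also have "\<dots> = 1 * (1/2) ^ j"
      by (simp add: power_mult[symmetric] mult.commute[of j] power_mult flip: power_mult_distrib)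
    finally show "(LINT z|\<sigma>. (cmod (1 - A j z))\<^sup>2) \<le> 1 * (1/2) ^ j" .
  qed simp
  then have s1: "AE z in \<sigma>. (\<lambda>j. cmod (1 - A j z)) \<longlonglongrightarrow> 0"
    by eventually_elim (simp add: power_tendsto_0_iff)
  have "AE z in circle_lebesgue. (\<lambda>j. (cmod (A j z))\<^sup>2) \<longlonglongrightarrow> 0"
  proof (rule AE_tendsto_0_if_integral_le[where c = "2 * pi"])
    fix j
    show "integrable circle_lebesgue (\<lambda>z. (cmod (A j z))\<^sup>2)"
      by (intro cl continuous_intros cA)
    show "(LINT z|circle_lebesgue. (cmod (A j z))\<^sup>2) \<le> 2 * pi * (1/2) ^ j"
      unfolding A_def using power_average_lebesgue[OF r(1)[of j], of "2 ^ j"] by (simp add: power_divide)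
  qed simp
  then have s2: "AE z in circle_lebesgue. (\<lambda>j. cmod (A j z)) \<longlonglongrightarrow> 0"
    by eventually_elim (simp add: power_tendsto_0_iff)
  define Z where "Z = {z \<in> space \<sigma>. \<not> (\<lambda>j. cmod (1 - A j z)) \<longlonglongrightarrow> 0}"
  have [measurable]: "A j \<in> borel_measurable \<sigma>" for j
    by (rule circle_continuous_measurable[OF s cA])
  have Zs: "Z \<in> sets \<sigma>" unfolding Z_def by measurable
  have 1: "emeasure \<sigma> Z = 0"
    using s1 Zs unfolding Z_def by (subst (asm) AE_iff_measurable[OF _ refl]) auto
  have "AE z in circle_lebesgue. z \<notin> space circle_lebesgue - Z"
    using s2
  proof eventually_elim
    case (elim z)
    show ?case
    proof
      assume "z \<in> space circle_lebesgue - Z"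
      then have "(\<lambda>j. cmod (1 - A j z)) \<longlonglongrightarrow> 0"
        by (auto simp: Z_def circle_space[OF s] circle_space[OF sets_circle_lebesgue])
      then have "(\<lambda>j. cmod (1 - A j z) + cmod (A j z)) \<longlonglongrightarrow> 0 + 0" by (intro tendsto_add elim)
      \<comment> \<open>This is why no point can have both limits.\<close>
      moreover have "1 \<le> cmod (1 - A j z) + cmod (A j z)" for j
        using norm_triangle_ineq[of "1 - A j z" "A j z"] by simp
      ultimately have "1 \<le> (0::real)" by (intro LIMSEQ_le_const[of _ 0 1]) auto
      then show False by simp
    qed
  qed
  then have 2: "emeasure circle_lebesgue (space circle_lebesgue - Z) = 0"
    using Zs s sets_circle_lebesgue by (subst (asm) AE_iff_measurable[of "space circle_lebesgue - Z"]) auto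
  show ?thesis
    unfolding mutually_singular_def using s sets_circle_lebesgue Zs 1 2 by auto
qed

lemma singular_spectrum_if_cyclic_rigid:
  assumes "approx_cyclic h" "rigid_vector h"
  shows "singular_spectrum M T"
proof -
  have h: "h \<in> L2 M" using assms(1) by (simp add: approx_cyclic_def)
  obtain \<sigma> where \<sigma>: "spectral_measure M T h \<sigma>" using spectral_measure_exists[OF h] by blast
  then have "maximal_spectral_measure M T \<sigma>"
    using h absolutely_continuous_spectral[OF assms(1) \<sigma>] unfolding maximal_spectral_measure_def by blast
  then show ?thesis
    using mutually_singular_if_rigid[OF h assms(2) \<sigma>] unfolding singular_spectrum_def by blast
qed

end

section \<open>Measure-preserving maps of the unit interval\<close>

text \<open>Half-open, so that half-open cells of equal length partition it exactly.\<close>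

abbreviation unit_interval :: "real measure" where
  "unit_interval \<equiv> lebesgue_on {0..<1}"

lemma prob_space_unit_interval: "prob_space unit_interval"
  by (rule prob_spaceI) (simp add: emeasure_restrict_space)

interpretation UI: prob_space unit_interval
  by (rule prob_space_unit_interval)

lemma complete_unit_interval:
  assumes "N \<in> null_sets unit_interval" "A \<subseteq> N" shows "A \<in> null_sets unit_interval"
  using assms null_sets_completion_subset[of A N lborel] by (auto simp: null_sets_restrict_space)

text \<open>The two intervals differ by the null set \<open>{1}\<close>, and the identity is the
  isomorphism.\<close>

lemma lebesgue_probability_space_unit_interval: "lebesgue_probability_space unit_interval"
  unfolding lebesgue_probability_space_def
proof (intro conjI)
  show "prob_space unit_interval" by (rule prob_space_unit_interval)
  show "complete_measure unit_interval"
  proof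
    fix A B assume "B \<subseteq> A" "A \<in> null_sets unit_interval"
    then show "B \<in> sets unit_interval" using complete_unit_interval by blast
  qed
  have S: "restrict_space unit_interval {0..<1} = unit_interval"
    by (subst restrict_restrict_space) auto
  have T: "restrict_space (lebesgue_on {0..1}) {0..<1::real} = unit_interval"
    by (subst restrict_restrict_space) (auto intro!: arg_cong[where f = "\<lambda>A. lebesgue_on A"])
  have 0: "emeasure (lebesgue_on {0..1::real}) (space (lebesgue_on {0..1}) - {0..<1}) = 0"
  proof -
    have "space (lebesgue_on {0..1}) - {0..<1::real} = {1}" by auto
    then show ?thesis by (simp add: emeasure_restrict_space)
  qed
  have iso: "measure_iso unit_interval unit_interval id"
    unfolding measure_iso_def
  proof (intro conjI)
    show "inv_into (space unit_interval) id \<in> measurable unit_interval unit_interval"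
      by (subst measurable_cong[where g = "\<lambda>x. x"]) (auto simp: inv_into_f_f[of id _ _, simplified])
    show "distr unit_interval unit_interval id = unit_interval" by (simp add: id_def)
  qed auto
  show "isomorphic_mod0 unit_interval (lebesgue_on {0..1::real})"
    unfolding isomorphic_mod0_def
  proof (intro bexI[of _ "{0..<1::real}"] conjI exI[of _ "id :: real \<Rightarrow> real"])
    show "measure_iso (restrict_space unit_interval {0..<1}) (restrict_space (lebesgue_on {0..1}) {0..<1}) id"
      unfolding S T by (rule iso)
    show "{0..<1::real} \<in> sets (lebesgue_on {0..1})" by (subst sets_restrict_space_iff) auto
    show "{0..<1} \<in> sets unit_interval" by (subst sets_restrict_space_iff) auto
    show "emeasure (lebesgue_on {0..1::real}) (space (lebesgue_on {0..1}) - {0..<1}) = 0" by (rule 0)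
  qed simp
qed

text \<open>A Lebesgue set is a Borel set up to a subset of a Borel null set; the preimage of that
  null set is null, and completeness handles the subset. Hence equality of the distributions on
  Borel sets suffices.\<close>

lemma measure_preserving_unit_interval:
  assumes f: "f \<in> borel_measurable unit_interval" "\<And>x. x \<in> {0..<1} \<Longrightarrow> f x \<in> {0..<1}"
    and d: "distr unit_interval borel f = distr unit_interval borel (\<lambda>x. x)"
  shows "f \<in> measurable unit_interval unit_interval" "distr unit_interval unit_interval f = unit_interval"
proof -
  have id: "(\<lambda>x. x) \<in> borel_measurable unit_interval"
    by (intro measurable_restrict_space1 measurable_completion) simp
  have pre: "emeasure unit_interval (f -` S \<inter> {0..<1}) = emeasure unit_interval (S \<inter> {0..<1})"
    if "S \<in> sets borel" for S
    using emeasure_distr[OF f(1) that] emeasure_distr[OF id that] d by simp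
  have main: "f -` A \<inter> {0..<1} \<in> sets unit_interval \<and>
      emeasure unit_interval (f -` A \<inter> {0..<1}) = emeasure unit_interval A"
    if A: "A \<in> sets unit_interval" for A
  proof -
    have A': "A \<in> sets (completion lborel)" "A \<subseteq> {0..<1}"
      using A by (auto simp: sets_restrict_space_iff)
    obtain S N N' where S: "A = S \<union> N" "N \<subseteq> N'" "N' \<in> null_sets lborel" "S \<in> sets lborel"
      using sets_completionE[OF A'(1)] by blast
    then have SN: "S \<in> sets borel" "N' \<in> sets borel" "emeasure lborel N' = 0" by auto
    have N'0: "N' \<inter> {0..<1} \<in> null_sets unit_interval"
    proof -
      have "N' \<in> null_sets lebesgue" using S(3) by (rule null_sets_completionI)
      then show ?thesis by (auto simp: null_sets_restrict_space intro: null_set_Int2)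
    qed
    have fN': "f -` N' \<inter> {0..<1} \<in> null_sets unit_interval"
      using pre[OF SN(2)] null_setsD1[OF N'0] measurable_sets[OF f(1) SN(2)] by (intro null_setsI) simp_all
    have fN: "f -` N \<inter> {0..<1} \<in> null_sets unit_interval"
      by (rule complete_unit_interval[OF fN']) (use S(2) in auto)
    have N0: "N \<inter> {0..<1} \<in> null_sets unit_interval"
      by (rule complete_unit_interval[OF N'0]) (use S(2) in auto)
    have fS: "f -` S \<inter> {0..<1} \<in> sets unit_interval"
      using measurable_sets[OF f(1) SN(1)] by simp
    have SX: "S \<inter> {0..<1} \<in> sets unit_interval"
      using measurable_sets[OF id SN(1)] by (simp add: vimage_def Int_def conj_commute)
    have fA: "f -` A \<inter> {0..<1} = (f -` S \<inter> {0..<1}) \<union> (f -` N \<inter> {0..<1})" using S(1) by auto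
    have AX: "A = (S \<inter> {0..<1}) \<union> (N \<inter> {0..<1})" using S(1) A'(2) by auto
    have "emeasure unit_interval (f -` A \<inter> {0..<1}) = emeasure unit_interval (f -` S \<inter> {0..<1})"
      unfolding fA by (rule emeasure_Un_null_set[OF fS fN])
    also have "\<dots> = emeasure unit_interval (S \<inter> {0..<1})" by (rule pre[OF SN(1)])
    also have "\<dots> = emeasure unit_interval A"
      using emeasure_Un_null_set[OF SX N0] unfolding AX[symmetric] by (rule sym)
    finally show ?thesis using fS fN unfolding fA by auto
  qed
  show m: "f \<in> measurable unit_interval unit_interval"
    using main f(2) by (intro measurableI) auto
  show "distr unit_interval unit_interval f = unit_interval"
    by (rule measure_eqI) (auto simp: emeasure_distr[OF m] main)
qed

text \<open>Discarding a null set once is not enough: the remaining points must be mapped among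
  themselves. Those whose whole \<open>f\<close>-orbit stays in \<open>G\<close> and whole
  \<open>g\<close>-orbit in \<open>G'\<close> form such a set, invariant under both maps; elsewhere
  the identity is used.\<close>

lemma automorphism_from_almost_inverse:
  fixes M :: "'a measure"
  assumes f: "f \<in> measurable M M" "distr M M f = M" and g: "g \<in> measurable M M" "distr M M g = M"
    and G: "G \<in> sets M" "AE x in M. x \<in> G" and G': "G' \<in> sets M" "AE x in M. x \<in> G'"
    and fg: "\<And>x. x \<in> G \<Longrightarrow> f x \<in> G' \<and> g (f x) = x" and gf: "\<And>x. x \<in> G' \<Longrightarrow> g x \<in> G \<and> f (g x) = x"
  shows "\<exists>S. automorphism M S \<and> (AE x in M. inv_into (space M) S x = f x)"
proof -
  note [measurable] = f(1) g(1) G(1) G'(1)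
  define D where "D = {x\<in>space M. \<forall>n. (f ^^ n) x \<in> G \<and> (g ^^ n) x \<in> G'}"
  note [measurable] = funpow_preserves[OF f, THEN conjunct1] funpow_preserves[OF g, THEN conjunct1]
  have D [measurable]: "D \<in> sets M" unfolding D_def by measurable
  have pull: "AE x in M. (h ^^ n) x \<in> H" if "AE x in M. x \<in> H" "h \<in> measurable M M" "distr M M h = M" for h H n
  proof -
    have "AE x in distr M M (h ^^ n). x \<in> H" using that(1) unfolding funpow_preserves[OF that(2,3), of n, THEN conjunct2] .
    then show ?thesis by (rule AE_distrD[rotated]) (use funpow_preserves[OF that(2,3), of n] in auto)
  qed
  have AED: "AE x in M. x \<in> D"
  proof -
    have "AE x in M. \<forall>n. (f ^^ n) x \<in> G \<and> (g ^^ n) x \<in> G'"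
      unfolding AE_all_countable using pull[OF G(2) f] pull[OF G'(2) g] by auto
    then show ?thesis using AE_space by eventually_elim (auto simp: D_def)
  qed
  have DG: "x \<in> G" "x \<in> G'" if "x \<in> D" for x
    using that unfolding D_def by (auto dest!: spec[of _ 0])
  have fD: "f x \<in> D" if x: "x \<in> D" for x
  proof -
    have "(f ^^ n) (f x) \<in> G" for n
    proof -
      have "(f ^^ Suc n) x \<in> G" using x unfolding D_def by blast
      then show ?thesis by (simp add: funpow_swap1)
    qed
    moreover have "(g ^^ n) (f x) \<in> G'" for n
    proof (cases n)
      case 0
      then show ?thesis using fg[OF DG(1)[OF x]] by simp
    next
      case (Suc k)
      then have "(g ^^ n) (f x) = (g ^^ k) x"
        using fg[OF DG(1)[OF x]] by (simp add: funpow_swap1)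
      then show ?thesis using x by (simp add: D_def)
    qed
    moreover have "f x \<in> space M" using x measurable_space[OF f(1)] by (simp add: D_def)
    ultimately show ?thesis by (simp add: D_def)
  qed
  have gD: "g x \<in> D" if x: "x \<in> D" for x
  proof -
    have "(g ^^ n) (g x) \<in> G'" for n
    proof -
      have "(g ^^ Suc n) x \<in> G'" using x unfolding D_def by blast
      then show ?thesis by (simp add: funpow_swap1)
    qed
    moreover have "(f ^^ n) (g x) \<in> G" for n
    proof (cases n)
      case 0
      then show ?thesis using gf[OF DG(2)[OF x]] by simp
    next
      case (Suc k)
      then have "(f ^^ n) (g x) = (f ^^ k) x"
        using gf[OF DG(2)[OF x]] by (simp add: funpow_swap1)
      then show ?thesis using x by (simp add: D_def)
    qed
    moreover have "g x \<in> space M" using x measurable_space[OF g(1)] by (simp add: D_def)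
    ultimately show ?thesis by (simp add: D_def)
  qed
  define F where "F x = (if x \<in> D then f x else x)" for x
  \<comment> \<open>The automorphism extends \<open>g\<close>, so that its inverse is given by
    \<open>f\<close>.\<close>
  define S where "S x = (if x \<in> D then g x else x)" for x
  have DM: "D \<subseteq> space M" by (auto simp: D_def)
  have Fm [measurable]: "F \<in> measurable M M" unfolding F_def by measurable
  have Sm [measurable]: "S \<in> measurable M M" unfolding S_def by measurable
  have FS: "F (S x) = x" for x
    using gf[OF DG(2), of x] gD[of x] by (auto simp: F_def S_def)
  have SF: "S (F x) = x" for x
    using fg[OF DG(1), of x] fD[of x] by (auto simp: F_def S_def)
  have bij: "bij_betw S (space M) (space M)"
    using FS SF measurable_space[OF Fm] measurable_space[OF Sm]
    by (intro bij_betw_byWitness[where f' = F]) auto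
  have inv: "inv_into (space M) S x = F x" if "x \<in> space M" for x
    using inv_into_f_f[OF bij_betw_imp_inj_on[OF bij], of "F x"] measurable_space[OF Fm that] by (simp add: SF)
  have "distr M M S = distr M M g"
    using AED by (intro distr_cong_AE) (auto simp: S_def elim!: eventually_mono)
  then have "automorphism M S"
    unfolding automorphism_def measure_iso_def using bij g(2) inv
    by (auto simp: measurable_cong[OF inv])
  moreover have "AE x in M. inv_into (space M) S x = f x"
    using AED AE_space by eventually_elim (simp add: inv F_def)
  ultimately show ?thesis by blast
qed

section \<open>Limits of permutations of equal cells\<close>

definition cell :: "nat \<Rightarrow> real \<Rightarrow> nat" where
  "cell n x = nat \<lfloor>real n * x\<rfloor>"

lemma cell_bounds:
  assumes "0 < n" "0 \<le> x" shows "real (cell n x) / real n \<le> x" "x < (real (cell n x) + 1) / real n"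
proof -
  have 0: "0 \<le> real n * x" using assms by simp
  have 1: "real (cell n x) \<le> real n * x" using 0 unfolding cell_def by linarith
  have 2: "real n * x < real (cell n x) + 1" unfolding cell_def by linarith
  show "real (cell n x) / real n \<le> x" "x < (real (cell n x) + 1) / real n"
    using 1 2 assms(1) by (simp_all add: field_simps)
qed

lemma cell_eqI:
  assumes "0 < n" "real k / real n \<le> x" "x < (real k + 1) / real n" shows "cell n x = k"
proof -
  have "real k \<le> real n * x" "real n * x < real k + 1" using assms by (simp_all add: field_simps)
  then have "\<lfloor>real n * x\<rfloor> = int k" by (intro floor_unique) auto
  then show ?thesis by (simp add: cell_def)
qed

lemma cell_less: assumes "x \<in> {0..<1}" "0 < n" shows "cell n x < n"
proof -
  have "real n * x < real n" using assms by simp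
  moreover have "0 \<le> real n * x" using assms by simp
  ultimately show ?thesis unfolding cell_def by linarith
qed

lemma cell_div: assumes "0 \<le> x" "0 < r" shows "cell (n * r) x div r = cell n x"
proof -
  have "\<lfloor>real n * x\<rfloor> = \<lfloor>real (n * r) * x / real r\<rfloor>" using assms by simp
  also have "\<dots> = \<lfloor>real (n * r) * x\<rfloor> div int r" using floor_divide_real_eq_div[of "int r" "real (n * r) * x"] by simp
  finally have "cell n x = nat (\<lfloor>real (n * r) * x\<rfloor> div int r)" by (simp add: cell_def)
  also have "\<dots> = cell (n * r) x div r" using assms by (simp add: cell_def nat_div_distrib)
  finally show ?thesis by simp
qed

lemma id_measurable_unit_interval [measurable]: "(\<lambda>x. x) \<in> borel_measurable unit_interval"
  by (intro measurable_restrict_space1 measurable_completion) simp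

lemma cell_measurable [measurable]: "cell n \<in> measurable unit_interval (count_space UNIV)"
proof -
  have "(\<lambda>x. real n * x) \<in> borel_measurable unit_interval" by measurable
  then have "(\<lambda>x. \<lfloor>real n * x\<rfloor>) \<in> measurable unit_interval (count_space UNIV)"
    by (rule measurable_compose[OF _ measurable_real_floor])
  then have "(\<lambda>x. nat \<lfloor>real n * x\<rfloor>) \<in> measurable unit_interval (count_space UNIV)"
    by (rule measurable_compose) simp
  then show ?thesis by (simp add: cell_def[abs_def])
qed

lemma cell_set: assumes "k < n" shows "{x\<in>{0..<1}. cell n x = k} = {real k / n ..< (real k + 1) / n}"
proof -
  have n: "0 < n" using assms by simp
  have "(real k + 1) / n \<le> 1" "0 \<le> real k / n" using assms by (simp_all add: field_simps)
  then have u: "(real k + 1) / n \<le> 1" "0 \<le> real k / n" by simp_all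
  show ?thesis
  proof (intro set_eqI iffI)
    fix x assume "x \<in> {x\<in>{0..<1}. cell n x = k}"
    then show "x \<in> {real k / n ..< (real k + 1) / n}" using cell_bounds[OF n, of x] by auto
  next
    fix x assume x: "x \<in> {real k / n ..< (real k + 1) / n}"
    then have "0 \<le> x" "x < 1" using u by (simp_all add: order.trans[OF u(2)] order.strict_trans2[OF _ u(1)])
    then show "x \<in> {x\<in>{0..<1}. cell n x = k}" using x cell_eqI[OF n, of k x] by auto
  qed
qed

lemma measure_cell_eq: assumes "k < n" shows "measure unit_interval {x\<in>{0..<1}. cell n x = k} = 1 / n"
proof -
  have n: "0 < n" using assms by simp
  have "(real k + 1) / n \<le> 1" "0 \<le> real k / n" using assms by (simp_all add: field_simps)
  then have s: "{real k / n ..< (real k + 1) / n} \<subseteq> {0..<1}" by auto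
  have "measure unit_interval {real k / n ..< (real k + 1) / n} = measure lebesgue {real k / n ..< (real k + 1) / n}"
    using s by (intro measure_restrict_space) auto
  also have "\<dots> = 1 / n" using n by (simp add: divide_right_mono diff_divide_distrib[symmetric])
  finally show ?thesis unfolding cell_set[OF assms] .
qed

lemma integral_cell:
  fixes g :: "nat \<Rightarrow> 'b::{banach, second_countable_topology}"
  assumes "0 < n"
  shows "(LINT x|unit_interval. g (cell n x)) = (\<Sum>k<n. (1 / real n) *\<^sub>R g k)"
proof -
  have "(LINT x|unit_interval. g (cell n x)) =
      (LINT x|unit_interval. (\<Sum>k<n. indicator {x\<in>{0..<1}. cell n x = k} x *\<^sub>R g k))"
  proof (intro Bochner_Integration.integral_cong refl)
    fix x :: real assume "x \<in> space unit_interval"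
    then have x: "x \<in> {0..<1}" by simp
    have "(\<Sum>k<n. indicator {x\<in>{0..<1}. cell n x = k} x *\<^sub>R g k) = (\<Sum>k<n. if k = cell n x then g k else 0)"
      using x by (intro sum.cong) (auto simp: indicator_def)
    then show "g (cell n x) = (\<Sum>k<n. indicator {x\<in>{0..<1}. cell n x = k} x *\<^sub>R g k)"
      using cell_less[OF x assms] by simp
  qed
  also have "\<dots> = (\<Sum>k<n. measure unit_interval {x\<in>{0..<1}. cell n x = k} *\<^sub>R g k)"
  proof (rule has_bochner_integral_integral_eq[OF has_bochner_integral_sum[OF has_bochner_integral_indicator]])
    fix k
    have "{x\<in>space unit_interval. cell n x = k} \<in> sets unit_interval" by measurable
    then show "{x\<in>{0..<1}. cell n x = k} \<in> sets unit_interval" by simp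
    show "emeasure unit_interval {x\<in>{0..<1}. cell n x = k} < \<infinity>"
      by (simp add: UI.emeasure_eq_measure)
  qed
  also have "\<dots> = (\<Sum>k<n. (1 / real n) *\<^sub>R g k)"
    by (intro sum.cong refl) (simp only: measure_cell_eq lessThan_iff)
  finally show ?thesis .
qed

lemma measure_cell_in:
  assumes "0 < n" "A \<subseteq> {..<n}"
  shows "measure unit_interval {x\<in>{0..<1}. cell n x \<in> A} = card A / n"
proof -
  have m: "{x\<in>space unit_interval. cell n x \<in> A} \<in> sets unit_interval" by measurable
  have "measure unit_interval {x\<in>{0..<1}. cell n x \<in> A} = (LINT x|unit_interval. indicator {x\<in>{0..<1}. cell n x \<in> A} x)"
    by (subst Bochner_Integration.integral_indicator) (auto intro!: arg_cong[where f = "measure unit_interval"])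
  also have "\<dots> = (LINT x|unit_interval. indicator A (cell n x))"
    by (intro Bochner_Integration.integral_cong) (auto simp: indicator_def)
  also have "\<dots> = (\<Sum>k<n. (1 / real n) * indicator A k)" using integral_cell[OF assms(1), of "indicator A :: nat \<Rightarrow> real"] by simp
  also have "\<dots> = (\<Sum>k\<in>A. 1 / real n)"
    using assms(2) by (intro sum.mono_neutral_cong_right) (auto simp: indicator_def)
  finally show ?thesis by simp
qed

text \<open>\<open>s j\<close> permutes the \<open>m j\<close> cells of stage \<open>j\<close>, each
  of which splits into \<open>r j\<close> consecutive cells of the next stage, so
  \<open>k div r j\<close> is the cell containing cell \<open>k\<close>. Consecutive permutations
  are compatible except on a fraction \<open>\<delta> j\<close>, and summability makes
  Borel-Cantelli applicable.\<close>

locale refining =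
  fixes m r :: "nat \<Rightarrow> nat" and s :: "nat \<Rightarrow> nat \<Rightarrow> nat" and \<delta> :: "nat \<Rightarrow> real"
  assumes m0: "0 < m 0" and mS: "\<And>j. m (Suc j) = m j * r j" and r2: "\<And>j. 2 \<le> r j"
    and bij: "\<And>j. bij_betw (s j) {..<m j} {..<m j}" and \<delta>: "summable \<delta>"
    and mismatch: "\<And>j. real (card {k\<in>{..<m (Suc j)}. s (Suc j) k div r j \<noteq> s j (k div r j)}) \<le> \<delta> j * real (m (Suc j))"
begin

lemma r_pos: "0 < r j" using r2[of j] by simp

lemma m_pos: "0 < m j"
  by (induction j) (auto simp: m0 mS r_pos)

lemma m_ge: "2 ^ j \<le> m j"
proof (induction j)
  case (Suc j)
  have "2 ^ j * 2 \<le> m j * r j" using Suc r2[of j] by (rule mult_le_mono)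
  then show ?case by (simp add: mS)
qed (use m0 in simp)

lemma one_over_m: "(\<lambda>j. 1 / real (m j)) \<longlonglongrightarrow> 0"
proof (rule tendsto_sandwich[of "\<lambda>_. 0" _ _ "\<lambda>j. (1/2) ^ j"])
  show "\<forall>\<^sub>F j in sequentially. 1 / real (m j) \<le> (1 / 2) ^ j"
  proof (intro always_eventually allI)
    fix j
    have "(2::real) ^ j \<le> real (m j)" using m_ge[of j] by (metis of_nat_le_iff of_nat_numeral of_nat_power)
    then show "1 / real (m j) \<le> (1 / 2) ^ j" by (simp add: power_divide frac_le)
  qed
  show "(\<lambda>j. (1 / 2 :: real) ^ j) \<longlonglongrightarrow> 0" by (rule LIMSEQ_power_zero) simp
qed auto

definition target :: "nat \<Rightarrow> real \<Rightarrow> nat" where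
  "target j x = s j (cell (m j) x)"

text \<open>The limit map as a relation: passing to the inverse permutations merely exchanges
  \<open>x\<close> and \<open>y\<close>, which later identifies the inverse map. Finitely many
  stages may disagree.\<close>

definition related :: "real \<Rightarrow> real \<Rightarrow> bool" where
  "related x y \<longleftrightarrow> x \<in> {0..<1} \<and> y \<in> {0..<1} \<and> (\<exists>J. \<forall>j\<ge>J. cell (m j) y = target j x)"

definition limit_map :: "real \<Rightarrow> real" where
  "limit_map x = lim (\<lambda>j. real (target j x) / real (m j))"

definition jump :: "nat \<Rightarrow> real set" where
  "jump j = {x\<in>{0..<1}. target (Suc j) x div r j \<noteq> target j x}"

lemma cell_Suc: "0 \<le> x \<Longrightarrow> cell (m (Suc j)) x div r j = cell (m j) x"
  by (simp add: mS cell_div r_pos)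

lemma target_less: "x \<in> {0..<1} \<Longrightarrow> target j x < m j"
  using bij_betw_apply[OF bij[of j]] cell_less[of x "m j"] m_pos by (auto simp: target_def)

lemma target_measurable [measurable]: "target j \<in> measurable unit_interval (count_space UNIV)"
  unfolding target_def[abs_def] by (rule measurable_compose[OF cell_measurable]) simp

lemma target_fun_measurable [measurable]:
  "(\<lambda>x. real (h (target j x))) \<in> borel_measurable unit_interval"
  by (rule measurable_compose[OF target_measurable]) simp

lemma target_ratio_measurable [measurable]:
  "(\<lambda>x. real (target j x) / real (m j)) \<in> borel_measurable unit_interval"
  by (rule measurable_compose[OF target_measurable]) simp

lemma cell_ratio_measurable [measurable]:
  "(\<lambda>x. real (cell (m j) x) / real (m j)) \<in> borel_measurable unit_interval"
  by (rule measurable_compose[OF cell_measurable]) simp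

lemma jump_sets: "jump j \<in> sets unit_interval"
proof -
  have "{x\<in>space unit_interval. real (target (Suc j) x div r j) \<noteq> real (target j x)} \<in> sets unit_interval" by measurable
  then show ?thesis by (simp add: jump_def)
qed

lemma measure_jump: "measure unit_interval (jump j) \<le> \<delta> j"
proof -
  have "jump j = {x\<in>{0..<1}. cell (m (Suc j)) x \<in> {k\<in>{..<m (Suc j)}. s (Suc j) k div r j \<noteq> s j (k div r j)}}"
    using cell_less[OF _ m_pos] by (auto simp: jump_def target_def cell_Suc)
  then have "measure unit_interval (jump j) =
      card {k\<in>{..<m (Suc j)}. s (Suc j) k div r j \<noteq> s j (k div r j)} / m (Suc j)"
    using measure_cell_in[OF m_pos[of "Suc j"], of "{k\<in>{..<m (Suc j)}. s (Suc j) k div r j \<noteq> s j (k div r j)}"] by auto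
  also have "\<dots> \<le> \<delta> j" using mismatch[of j] m_pos[of "Suc j"] by (simp add: divide_le_eq)
  finally show ?thesis .
qed

lemma cell_LIMSEQ: assumes "x \<in> {0..<1}" shows "(\<lambda>j. real (cell (m j) x) / real (m j)) \<longlonglongrightarrow> x"
proof (rule tendsto_sandwich[of "\<lambda>j. x - 1 / real (m j)" _ _ "\<lambda>_. x"])
  show "\<forall>\<^sub>F j in sequentially. x - 1 / real (m j) \<le> real (cell (m j) x) / real (m j)"
  proof (intro always_eventually allI)
    fix j
    show "x - 1 / real (m j) \<le> real (cell (m j) x) / real (m j)"
      using cell_bounds(2)[OF m_pos[of j], of x] assms by (simp add: add_divide_distrib)
  qed
  show "\<forall>\<^sub>F j in sequentially. real (cell (m j) x) / real (m j) \<le> x"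
    using cell_bounds(1)[OF m_pos] assms by (intro always_eventually allI) auto
  show "(\<lambda>j. x - 1 / real (m j)) \<longlonglongrightarrow> x" using tendsto_diff[OF tendsto_const one_over_m, of x] by simp
qed simp

lemma limit_map_eq: assumes "related x y" shows "limit_map x = y"
proof -
  obtain J where J: "\<And>j. j \<ge> J \<Longrightarrow> cell (m j) y = target j x" and y: "y \<in> {0..<1}"
    using assms by (auto simp: related_def)
  have "(\<lambda>j. real (target j x) / real (m j)) \<longlonglongrightarrow> y"
    by (rule Lim_transform_eventually[OF cell_LIMSEQ[OF y]]) (use J in \<open>auto simp: eventually_sequentially\<close>)
  then show ?thesis unfolding limit_map_def by (rule limI)
qed

lemma limit_map_measurable [measurable]: "limit_map \<in> borel_measurable unit_interval"
  unfolding limit_map_def[abs_def] by (rule borel_measurable_lim_metric) (rule target_ratio_measurable)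

text \<open>The limit of the nested cells \<open>target j x\<close> lies in all of them unless, from some stage on, each
  cell is the rightmost part of the previous one.\<close>

lemma related_limit:
  assumes x: "x \<in> {0..<1}" and J: "\<And>j. j \<ge> J \<Longrightarrow> target (Suc j) x div r j = target j x"
    and right: "\<And>J. \<exists>j\<ge>J. target (Suc j) x \<noteq> target j x * r j + (r j - 1)"
  shows "\<exists>y. related x y"
proof -
  define a where "a j = real (target j x) / real (m j)" for j
  define b where "b j = (real (target j x) + 1) / real (m j)" for j
  have step: "a j \<le> a (Suc j)" "b (Suc j) \<le> b j"
    "target (Suc j) x \<noteq> target j x * r j + (r j - 1) \<Longrightarrow> b (Suc j) < b j" if "j \<ge> J" for j
  proof -
    have e: "target j x = target (Suc j) x div r j" using J[OF that] by simp
    have mr: "real (m (Suc j)) = real (m j) * real (r j)" by (simp add: mS)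
    have p: "0 < real (m j)" "0 < real (r j)" using m_pos[of j] r_pos[of j] by simp_all
    have 1: "target j x * r j \<le> target (Suc j) x" unfolding e by simp
    then have "real (target j x) * real (r j) \<le> real (target (Suc j) x)" by (metis of_nat_le_iff of_nat_mult)
    then show "a j \<le> a (Suc j)" using p by (simp add: a_def mr field_simps)
    have 2: "target (Suc j) x < target j x * r j + r j" unfolding e
      using dividend_less_div_times[OF r_pos[of j], of "target (Suc j) x"] by (simp add: add.commute)
    then have "real (target (Suc j) x + 1) \<le> real (target j x * r j + r j)" unfolding of_nat_le_iff by simp
    then have "real (target (Suc j) x) + 1 \<le> (real (target j x) + 1) * real (r j)" by (simp add: algebra_simps)
    then have "(real (target (Suc j) x) + 1) / (real (m j) * real (r j)) \<le>
        ((real (target j x) + 1) * real (r j)) / (real (m j) * real (r j))"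
      by (intro divide_right_mono) simp_all
    then show "b (Suc j) \<le> b j" using p by (simp add: b_def mr)
    assume "target (Suc j) x \<noteq> target j x * r j + (r j - 1)"
    then have "target (Suc j) x + 1 < target j x * r j + r j" using 2 r_pos[of j] by linarith
    then have "real (target (Suc j) x + 1) < real (target j x * r j + r j)" unfolding of_nat_less_iff .
    then have "real (target (Suc j) x) + 1 < (real (target j x) + 1) * real (r j)" by (simp add: algebra_simps)
    then have "(real (target (Suc j) x) + 1) / (real (m j) * real (r j)) <
        ((real (target j x) + 1) * real (r j)) / (real (m j) * real (r j))"
      using p by (intro divide_strict_right_mono) simp_all
    then show "b (Suc j) < b j" using p by (simp add: b_def mr)
  qed
  have amono: "a i \<le> a j" if "J \<le> i" "i \<le> j" for i j
    using that(2,1) by (induction rule: dec_induct) (auto intro: order.trans step)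
  have bmono: "b j \<le> b i" if "J \<le> i" "i \<le> j" for i j
    using that(2,1) by (induction rule: dec_induct) (auto intro: order.trans step)
  have ab: "a j < b j" for j using m_pos[of j] by (simp add: a_def b_def divide_strict_right_mono)
  have abij: "a i \<le> b j" if "J \<le> i" "J \<le> j" for i j
    using amono[of i "max i j"] bmono[of j "max i j"] ab[of "max i j"] that by linarith
  define y where "y = (SUP i\<in>{J..}. a i)"
  have bdd: "bdd_above (a ` {J..})" using abij[of _ J] by (intro bdd_aboveI2[where M = "b J"]) auto
  have ya: "a j \<le> y" if "J \<le> j" for j
    unfolding y_def using that bdd by (intro cSUP_upper) auto
  have yb: "y \<le> b j" if "J \<le> j" for j
    unfolding y_def using that abij by (intro cSUP_least) auto
  \<comment> \<open>One strict decrease of the right endpoints after stage \<open>j\<close> keeps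
    \<open>y\<close> away from the excluded end of the half-open cell.\<close>
  have yb': "y < b j" if "J \<le> j" for j
  proof -
    obtain i where i: "i \<ge> j" "target (Suc i) x \<noteq> target i x * r i + (r i - 1)" using right by blast
    have "y \<le> b (Suc i)" using i that by (intro yb) simp
    also have "\<dots> < b i" using step(3)[of i] i that by simp
    also have "\<dots> \<le> b j" using bmono[of j i] i that by simp
    finally show ?thesis .
  qed
  have "cell (m j) y = target j x" if "J \<le> j" for j
    using ya[OF that] yb'[OF that] m_pos[of j] by (intro cell_eqI) (auto simp: a_def b_def)
  moreover have "0 \<le> y" using ya[of J] by (simp add: a_def) (smt (verit) divide_nonneg_nonneg of_nat_0_le_iff)
  moreover have "y < 1"
  proof -
    have "b J \<le> 1" using target_less[OF x, of J] m_pos[of J] by (simp add: b_def field_simps)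
    then show ?thesis using yb'[of J] by simp
  qed
  ultimately show ?thesis using x unfolding related_def by (intro exI[of _ y]) auto
qed

text \<open>If every later target is the rightmost child, the target at stage \<open>J\<close>
  determines all of them. Hence at most \<open>m J\<close> cells out of \<open>m (J + i)\<close>
  qualify at stage \<open>J + i\<close>, and this proportion tends to 0.\<close>

lemma rightmost_null:
  "{x\<in>{0..<1}. \<forall>j\<ge>J. target (Suc j) x = target j x * r j + (r j - 1)} \<in> null_sets unit_interval" (is "?E \<in> _")
proof -
  have E: "?E \<in> sets unit_interval"
  proof -
    have "{x\<in>space unit_interval. \<forall>j\<ge>J. real (target (Suc j) x) = real (target j x * r j + (r j - 1))} \<in> sets unit_interval" by measurable
    then show ?thesis unfolding of_nat_eq_iff by simp
  qed
  have le: "measure unit_interval ?E \<le> real (m J) * (1 / real (m (J + i)))" for i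
  proof -
    \<comment> \<open>\<open>t k i\<close> is the rightmost descendant of cell \<open>k\<close>
      after \<open>i\<close> refinements.\<close>
    define t where "t k = rec_nat k (\<lambda>i v. v * r (J + i) + (r (J + i) - 1))" for k
    have t: "target (J + i) x = t (target J x) i" if "x \<in> ?E" for x i
      using that by (induction i) (auto simp: t_def)
    define A where "A = {k\<in>{..<m (J + i)}. s (J + i) k \<in> (\<lambda>k. t k i) ` {..<m J}}"
    have "inj_on (s (J + i)) A" using bij[of "J + i"] by (auto simp: A_def bij_betw_def intro: inj_on_subset)
    then have "card A = card (s (J + i) ` A)" by (simp add: card_image)
    also have "\<dots> \<le> card ((\<lambda>k. t k i) ` {..<m J})" by (intro card_mono) (auto simp: A_def)
    also have "\<dots> \<le> m J" using card_image_le[of "{..<m J}" "\<lambda>k. t k i"] by simp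
    finally have cA: "card A \<le> m J" .
    have "?E \<subseteq> {x\<in>{0..<1}. cell (m (J + i)) x \<in> A}"
    proof
      fix x assume x: "x \<in> ?E"
      then have "x \<in> {0..<1}" by simp
      moreover have "s (J + i) (cell (m (J + i)) x) = t (target J x) i" using t[OF x, of i] by (simp add: target_def)
      ultimately show "x \<in> {x\<in>{0..<1}. cell (m (J + i)) x \<in> A}"
        using cell_less[OF _ m_pos] target_less by (simp add: A_def)
    qed
    moreover have "{x\<in>{0..<1}. cell (m (J + i)) x \<in> A} \<in> sets unit_interval"
    proof -
      have "{x\<in>space unit_interval. cell (m (J + i)) x \<in> A} \<in> sets unit_interval" by measurable
      then show ?thesis by simp
    qed
    ultimately have "measure unit_interval ?E \<le> measure unit_interval {x\<in>{0..<1}. cell (m (J + i)) x \<in> A}"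
      by (intro UI.finite_measure_mono)
    also have "\<dots> = card A / m (J + i)" by (rule measure_cell_in[OF m_pos]) (auto simp: A_def)
    also have "\<dots> \<le> real (m J) * (1 / real (m (J + i)))" using cA by (simp add: divide_right_mono)
    finally show ?thesis .
  qed
  have "(\<lambda>i. real (m J) * (1 / real (m (J + i)))) \<longlonglongrightarrow> real (m J) * 0"
    using LIMSEQ_ignore_initial_segment[OF one_over_m, of J] by (intro tendsto_mult tendsto_const) (simp add: add.commute)
  then have "measure unit_interval ?E \<le> real (m J) * 0"
    by (rule LIMSEQ_le_const) (use le in auto)
  then have "measure unit_interval ?E = 0" by (intro antisym measure_nonneg) (simp only: mult_zero_right)
  then show ?thesis using E by (intro null_setsI) (simp_all add: UI.emeasure_eq_measure)
qed

text \<open>Borel-Cantelli removes the points with infinitely many jumps; the others can fail only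
  along an eventually rightmost path.\<close>

lemma AE_related: "AE x in unit_interval. \<exists>y. related x y"
proof -
  have "AE x in unit_interval. eventually (\<lambda>j. x \<in> space unit_interval - jump j) sequentially"
  proof (rule borel_cantelli_AE1[OF jump_sets])
    show "emeasure unit_interval (jump j) < \<infinity>" for j by (simp add: UI.emeasure_eq_measure)
    show "summable (\<lambda>j. measure unit_interval (jump j))"
      using measure_jump by (intro summable_comparison_test'[OF \<delta>, of 0]) auto
  qed
  moreover have "AE x in unit_interval. \<forall>J. x \<notin> {x\<in>{0..<1}. \<forall>j\<ge>J. target (Suc j) x = target j x * r j + (r j - 1)}"
    unfolding AE_all_countable using AE_not_in[OF rightmost_null] by blast
  moreover have "AE x in unit_interval. x \<in> space unit_interval" by (rule AE_space)
  ultimately show ?thesis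
  proof eventually_elim
    case (elim x)
    have x: "x \<in> {0..<1}" using elim(3) by simp
    obtain J where J: "\<And>j. j \<ge> J \<Longrightarrow> x \<notin> jump j" using elim(1) unfolding eventually_sequentially by auto
    show ?case
    proof (rule related_limit[OF x])
      show "target (Suc j) x div r j = target j x" if "j \<ge> J" for j
        using J[OF that] x unfolding jump_def by blast
      show "\<exists>j\<ge>J. target (Suc j) x \<noteq> target j x * r j + (r j - 1)" for J
        using elim(2) x by blast
    qed
  qed
qed

definition good :: "real set" where "good = {x\<in>{0..<1}. related x (limit_map x)}"

lemma good_sets: "good \<in> sets unit_interval"
proof -
  have [measurable]: "(\<lambda>x. cell (m j) (limit_map x)) \<in> measurable unit_interval (count_space UNIV)" for j
  proof -
    have "(\<lambda>x. \<lfloor>real (m j) * limit_map x\<rfloor>) \<in> measurable unit_interval (count_space UNIV)"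
      by (rule measurable_compose[OF _ measurable_real_floor]) measurable
    then have "(\<lambda>x. nat \<lfloor>real (m j) * limit_map x\<rfloor>) \<in> measurable unit_interval (count_space UNIV)"
      by (rule measurable_compose) simp
    then show ?thesis by (simp add: cell_def)
  qed
  have [measurable]: "(\<lambda>x. real (cell (m j) (limit_map x))) \<in> borel_measurable unit_interval" for j
    by (rule measurable_compose[of _ _ "count_space UNIV"]) measurable
  have "{x\<in>space unit_interval. limit_map x \<ge> 0 \<and> limit_map x < 1 \<and> (\<exists>J. \<forall>j\<ge>J. real (cell (m j) (limit_map x)) = real (target j x))} \<in> sets unit_interval"
    by measurable
  moreover have "good = {x\<in>space unit_interval. limit_map x \<ge> 0 \<and> limit_map x < 1 \<and> (\<exists>J. \<forall>j\<ge>J. real (cell (m j) (limit_map x)) = real (target j x))}"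
    by (auto simp: good_def related_def)
  ultimately show ?thesis by simp
qed

lemma AE_good: "AE x in unit_interval. x \<in> good"
  using AE_related
proof eventually_elim
  case (elim x)
  then obtain y where y: "related x y" by blast
  then show ?case using limit_map_eq[OF y] by (auto simp: good_def related_def)
qed

text \<open>Each \<open>s j\<close> permutes cells of equal length, so the left endpoints of the
  target cells and those of the cells themselves have the same characteristic function. Dominated
  convergence passes this equality to the limits.\<close>

lemma limit_map_distr: "distr unit_interval borel limit_map = distr unit_interval borel (\<lambda>x. x)"
proof (rule Levy_uniqueness)
  show "real_distribution (distr unit_interval borel limit_map)" "real_distribution (distr unit_interval borel (\<lambda>x. x))"
    by (auto intro!: UI.real_distribution_distr)
  have lim: "(\<lambda>j. LINT x|unit_interval. iexp (t * u j x)) \<longlonglongrightarrow> (LINT x|unit_interval. iexp (t * v x))"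
    if "AE x in unit_interval. (\<lambda>j. u j x) \<longlonglongrightarrow> v x" "v \<in> borel_measurable unit_interval"
      "\<And>j. u j \<in> borel_measurable unit_interval" for u and v :: "real \<Rightarrow> real" and t :: real
  proof (rule integral_dominated_convergence[where w = "\<lambda>_. 1"])
    note [measurable] = that(2,3)
    show "(\<lambda>x. iexp (t * v x)) \<in> borel_measurable unit_interval" "(\<lambda>x. iexp (t * u j x)) \<in> borel_measurable unit_interval" for j
      by measurable
    show "AE x in unit_interval. (\<lambda>j. iexp (t * u j x)) \<longlonglongrightarrow> iexp (t * v x)"
      using that(1) by eventually_elim (intro tendsto_intros)
  qed auto
  show "char (distr unit_interval borel limit_map) = char (distr unit_interval borel (\<lambda>x. x))"
  proof
    fix t :: real
    have "(\<lambda>j. LINT x|unit_interval. iexp (t * (real (target j x) / real (m j)))) \<longlonglongrightarrow> (LINT x|unit_interval. iexp (t * limit_map x))"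
    proof (rule lim)
      show "AE x in unit_interval. (\<lambda>j. real (target j x) / real (m j)) \<longlonglongrightarrow> limit_map x"
        using AE_good
      proof eventually_elim
        case (elim x)
        then have r: "related x (limit_map x)" by (simp add: good_def)
        then obtain J where J: "\<And>j. j \<ge> J \<Longrightarrow> cell (m j) (limit_map x) = target j x" and y: "limit_map x \<in> {0..<1}"
          by (auto simp: related_def)
        show ?case
          by (rule Lim_transform_eventually[OF cell_LIMSEQ[OF y]]) (use J in \<open>auto simp: eventually_sequentially\<close>)
      qed
    qed measurable
    moreover have "(\<lambda>j. LINT x|unit_interval. iexp (t * (real (cell (m j) x) / real (m j)))) \<longlonglongrightarrow> (LINT x|unit_interval. iexp (t * x))"
    proof (rule lim)
      show "AE x in unit_interval. (\<lambda>j. real (cell (m j) x) / real (m j)) \<longlonglongrightarrow> x"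
        by (intro AE_I2 cell_LIMSEQ) simp
    qed measurable
    moreover have "(LINT x|unit_interval. iexp (t * (real (target j x) / real (m j)))) =
        (LINT x|unit_interval. iexp (t * (real (cell (m j) x) / real (m j))))" for j
    proof -
      define g where "g k = iexp (t * (real k / real (m j)))" for k
      have "(LINT x|unit_interval. g (target j x)) = (\<Sum>k<m j. (1 / real (m j)) *\<^sub>R g (s j k))"
        unfolding target_def by (rule integral_cell[OF m_pos, where g = "\<lambda>k. g (s j k)"])
      also have "\<dots> = (\<Sum>k<m j. (1 / real (m j)) *\<^sub>R g k)"
        by (rule sum.reindex_bij_betw[OF bij[of j], where g = "\<lambda>k. (1 / real (m j)) *\<^sub>R g k"])
      also have "\<dots> = (LINT x|unit_interval. g (cell (m j) x))"
        by (rule integral_cell[OF m_pos, symmetric])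
      finally show ?thesis by (simp only: g_def)
    qed
    ultimately have "(LINT x|unit_interval. iexp (t * limit_map x)) = (LINT x|unit_interval. iexp (t * x))"
      by (auto intro: LIMSEQ_unique)
    then show "char (distr unit_interval borel limit_map) t = char (distr unit_interval borel (\<lambda>x. x)) t"
      unfolding char_def by (simp add: integral_distr)
  qed
qed

text \<open>Altered on a null set, with default 0, so that all values lie in the interval.\<close>

definition limit_map' :: "real \<Rightarrow> real" where
  "limit_map' x = (if limit_map x \<in> {0..<1} then limit_map x else 0)"

lemma limit_map'_good: "x \<in> good \<Longrightarrow> limit_map' x = limit_map x"
  by (auto simp: limit_map'_def good_def related_def)

lemma limit_map'_preserving:
  "limit_map' \<in> measurable unit_interval unit_interval" "distr unit_interval unit_interval limit_map' = unit_interval"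
proof -
  have m: "limit_map' \<in> borel_measurable unit_interval" unfolding limit_map'_def[abs_def] by measurable
  have "distr unit_interval borel limit_map' = distr unit_interval borel limit_map"
    using AE_good m by (intro distr_cong_AE) (auto simp: limit_map'_good elim!: eventually_mono)
  then have "distr unit_interval borel limit_map' = distr unit_interval borel (\<lambda>x. x)"
    by (simp add: limit_map_distr)
  then show "limit_map' \<in> measurable unit_interval unit_interval" "distr unit_interval unit_interval limit_map' = unit_interval"
    using measure_preserving_unit_interval[OF m] by (auto simp: limit_map'_def)
qed

text \<open>A cell where the inverses are incompatible is the image under \<open>s (Suc j)\<close>
  of one where the permutations are, so the mismatch bounds carry over unchanged.\<close>

lemma refining_inverse: "refining m r (\<lambda>j. inv_into {..<m j} (s j)) \<delta>"
proof
  fix j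
  have b: "bij_betw (s j) {..<m j} {..<m j}" for j by (rule bij)
  show "bij_betw (inv_into {..<m j} (s j)) {..<m j} {..<m j}" by (rule bij_betw_inv_into[OF bij])
  let ?A = "{k\<in>{..<m (Suc j)}. s (Suc j) k div r j \<noteq> s j (k div r j)}"
  let ?B = "{k\<in>{..<m (Suc j)}. inv_into {..<m (Suc j)} (s (Suc j)) k div r j \<noteq> inv_into {..<m j} (s j) (k div r j)}"
  have "?B \<subseteq> s (Suc j) ` ?A"
  proof
    fix k assume k: "k \<in> ?B"
    define l where "l = inv_into {..<m (Suc j)} (s (Suc j)) k"
    have l: "l < m (Suc j)" "s (Suc j) l = k"
      using k bij_betw_apply[OF bij_betw_inv_into[OF b], of k "Suc j"] bij_betw_inv_into_right[OF b, of k "Suc j"]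
      by (auto simp: l_def)
    have lr: "l div r j < m j" using l by (simp add: mS less_mult_imp_div_less)
    have "s (Suc j) l div r j \<noteq> s j (l div r j)"
    proof
      assume "s (Suc j) l div r j = s j (l div r j)"
      then have "inv_into {..<m j} (s j) (k div r j) = l div r j"
        using bij_betw_inv_into_left[OF b, of "l div r j" j] lr l by simp
      then show False using k by (simp add: l_def)
    qed
    then show "k \<in> s (Suc j) ` ?A" using l by auto
  qed
  then have "card ?B \<le> card ?A" by (rule surj_card_le[rotated]) simp
  then show "real (card ?B) \<le> \<delta> j * real (m (Suc j))" using mismatch[of j] by linarith
qed (use m0 mS r2 \<delta> in auto)

end

lemma (in refining) related_inverse:
  "refining.related m (\<lambda>j. inv_into {..<m j} (s j)) y x \<longleftrightarrow> related x y"
proof -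
  interpret inv: refining m r "\<lambda>j. inv_into {..<m j} (s j)" \<delta> by (rule refining_inverse)
  have "cell (m j) x = inv_into {..<m j} (s j) (cell (m j) y) \<longleftrightarrow> cell (m j) y = s j (cell (m j) x)"
    if "x \<in> {0..<1}" "y \<in> {0..<1}" for j
    using cell_less[OF that(1) m_pos[of j]] cell_less[OF that(2) m_pos[of j]]
      bij_betw_inv_into_left[OF bij[of j]] bij_betw_inv_into_right[OF bij[of j]] by auto
  then show ?thesis
    unfolding inv.related_def related_def inv.target_def target_def by auto
qed

text \<open>The limits of the permutations and of their inverses are mutually inverse almost
  everywhere. The limit of \<open>s\<close> becomes the inverse of \<open>S\<close>, since images
  under powers of \<open>S\<close> will be read along orbits of this inverse. Almost every point
  whose cell is misplaced at stage \<open>j\<close> jumps at stage \<open>j\<close> or later, whence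
  the tail sum.\<close>

theorem (in refining) limit_automorphism:
  "\<exists>S. automorphism unit_interval S \<and> (\<forall>j. measure unit_interval
     {x\<in>{0..<1}. cell (m j) (inv_into {0..<1} S x) \<noteq> s j (cell (m j) x)} \<le> (\<Sum>i. \<delta> (i + j)))"
proof -
  interpret inv: refining m r "\<lambda>j. inv_into {..<m j} (s j)" \<delta> by (rule refining_inverse)
  have 1: "limit_map' x \<in> inv.good \<and> inv.limit_map' (limit_map' x) = x" if "x \<in> good" for x
  proof -
    have r: "related x (limit_map x)" using that by (simp add: good_def)
    then have ri: "inv.related (limit_map x) x" by (simp add: related_inverse)
    then have g: "limit_map x \<in> inv.good" using inv.limit_map_eq[OF ri] by (simp add: inv.good_def inv.related_def)
    then show ?thesis using inv.limit_map_eq[OF ri] by (simp add: limit_map'_good[OF that] inv.limit_map'_good)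
  qed
  have 2: "inv.limit_map' y \<in> good \<and> limit_map' (inv.limit_map' y) = y" if "y \<in> inv.good" for y
  proof -
    have "inv.related y (inv.limit_map y)" using that by (simp add: inv.good_def)
    then have r: "related (inv.limit_map y) y" by (simp add: related_inverse)
    then have g: "inv.limit_map y \<in> good" using limit_map_eq[OF r] by (simp add: good_def related_def)
    then show ?thesis using limit_map_eq[OF r] by (simp add: inv.limit_map'_good[OF that] limit_map'_good)
  qed
  obtain S where S: "automorphism unit_interval S" "AE x in unit_interval. inv_into (space unit_interval) S x = limit_map' x"
    using automorphism_from_almost_inverse[OF limit_map'_preserving inv.limit_map'_preserving
        good_sets AE_good inv.good_sets inv.AE_good 1 2] by blast
  have "measure unit_interval {x\<in>{0..<1}. cell (m j) (inv_into {0..<1} S x) \<noteq> s j (cell (m j) x)} \<le> (\<Sum>i. \<delta> (i + j))" for j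
  proof -
    let ?E = "{x\<in>{0..<1}. cell (m j) (inv_into {0..<1} S x) \<noteq> s j (cell (m j) x)}"
    have sm: "summable (\<lambda>i. measure unit_interval (jump (i + j)))"
      using measure_jump by (intro summable_comparison_test'[OF summable_ignore_initial_segment[OF \<delta>], of 0]) auto
    have U: "(\<Union>i. jump (i + j)) \<in> sets unit_interval" using jump_sets by auto
    have "AE x in unit_interval. x \<in> ?E \<longrightarrow> x \<in> (\<Union>i. jump (i + j))"
      using S(2) AE_good
    proof eventually_elim
      case (elim x)
      show ?case
      proof (rule impI, rule ccontr)
        assume xE: "x \<in> ?E" and nx: "x \<notin> (\<Union>i. jump (i + j))"
        have x: "x \<in> {0..<1}" using xE by simp
        have r: "related x (limit_map x)" using elim(2) by (simp add: good_def)
        then obtain J where J: "\<And>j. j \<ge> J \<Longrightarrow> cell (m j) (limit_map x) = target j x" and y: "limit_map x \<in> {0..<1}"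
          by (auto simp: related_def)
        have Sx: "inv_into {0..<1} S x = limit_map x" using elim by (simp add: limit_map'_good)
        \<comment> \<open>Without jumps the agreement known at a late stage descends to stage
          \<open>j\<close>.\<close>
        have "cell (m (i + j)) (limit_map x) = target (i + j) x \<Longrightarrow> cell (m j) (limit_map x) = target j x" for i
        proof (induction i)
          case (Suc i)
          have "x \<notin> jump (i + j)" using nx by blast
          then have "target (Suc (i + j)) x div r (i + j) = target (i + j) x" using x by (auto simp: jump_def)
          then have "cell (m (i + j)) (limit_map x) = target (i + j) x"
            using Suc.prems cell_Suc[of "limit_map x" "i + j"] y by simp
          then show ?case by (rule Suc.IH)
        qed simp
        from this[of J] J[of "J + j"] have "cell (m j) (limit_map x) = target j x" by simp
        then show False using xE Sx by (simp add: target_def)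
      qed
    qed
    then have "measure unit_interval ?E \<le> measure unit_interval (\<Union>i. jump (i + j))"
      by (rule UI.finite_measure_mono_AE[OF _ U])
    also have "\<dots> \<le> (\<Sum>i. measure unit_interval (jump (i + j)))"
      using jump_sets sm by (intro UI.finite_measure_subadditive_countably) auto
    also have "\<dots> \<le> (\<Sum>i. \<delta> (i + j))"
      using measure_jump by (intro suminf_le sm summable_ignore_initial_segment[OF \<delta>]) auto
    finally show ?thesis .
  qed
  with S(1) show ?thesis by blast
qed

section \<open>Approximation by orbits of a vector\<close>

context koopman
begin

definition in_cyclic_space :: "('a \<Rightarrow> complex) \<Rightarrow> ('a \<Rightarrow> complex) \<Rightarrow> bool" where
  "in_cyclic_space h u \<longleftrightarrow> u \<in> L2 M \<and> (\<forall>e>0. \<exists>n c \<kappa>.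
     (LINT x|M. (cmod (u x - (\<Sum>i<(n::nat). c i * U (\<kappa> i) h x)))\<^sup>2) < e)"

text \<open>The cyclic space is closed. The quarters of \<open>e\<close> absorb the factor 2 in the
  bound for the squared norm of a sum.\<close>

lemma in_cyclic_space_limit:
  assumes h: "h \<in> L2 M" and u: "u \<in> L2 M"
    and lim: "\<And>e. e > 0 \<Longrightarrow> \<exists>v. in_cyclic_space h v \<and> (LINT x|M. (cmod (u x - v x))\<^sup>2) < e"
  shows "in_cyclic_space h u"
  unfolding in_cyclic_space_def
proof (intro conjI allI impI u)
  fix e :: real assume e: "e > 0"
  obtain v where v: "in_cyclic_space h v" "(LINT x|M. (cmod (u x - v x))\<^sup>2) < e / 4"
    using lim[of "e / 4"] e by auto
  have vL: "v \<in> L2 M" using v(1) by (simp add: in_cyclic_space_def)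
  have e4: "e / 4 > 0" using e by simp
  obtain n c \<kappa> where s: "(LINT x|M. (cmod (v x - (\<Sum>i<(n::nat). c i * U (\<kappa> i) h x)))\<^sup>2) < e / 4"
    using v(1) e4 unfolding in_cyclic_space_def by blast
  have "(LINT x|M. (cmod ((u x - v x) + (v x - (\<Sum>i<n. c i * U (\<kappa> i) h x))))\<^sup>2) \<le>
      2 * (LINT x|M. (cmod (u x - v x))\<^sup>2) + 2 * (LINT x|M. (cmod (v x - (\<Sum>i<n. c i * U (\<kappa> i) h x)))\<^sup>2)"
    by (intro integral_cmod_add_sq_le L2_diff u vL L2_trig h)
  also have "\<dots> < e" using v(2) s by simp
  finally have "(LINT x|M. (cmod (u x - (\<Sum>i<n. c i * U (\<kappa> i) h x)))\<^sup>2) < e" by simp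
  then show "\<exists>n c \<kappa>. (LINT x|M. (cmod (u x - (\<Sum>i<(n::nat). c i * U (\<kappa> i) h x)))\<^sup>2) < e" by blast
qed

lemma in_cyclic_space_tendsto:
  assumes h: "h \<in> L2 M" and u: "u \<in> L2 M" and v: "\<And>i. in_cyclic_space h (v i)"
    and lim: "(\<lambda>i. LINT x|M. (cmod (u x - v i x))\<^sup>2) \<longlonglongrightarrow> 0"
  shows "in_cyclic_space h u"
proof (rule in_cyclic_space_limit[OF h u])
  fix e :: real assume "e > 0"
  then have "\<forall>\<^sub>F i in sequentially. (LINT x|M. (cmod (u x - v i x))\<^sup>2) < e"
    using lim order_tendstoD(2) by blast
  then obtain i where "(LINT x|M. (cmod (u x - v i x))\<^sup>2) < e"
    unfolding eventually_sequentially by blast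
  then show "\<exists>v. in_cyclic_space h v \<and> (LINT x|M. (cmod (u x - v x))\<^sup>2) < e" using v by blast
qed

lemma in_cyclic_space_add:
  assumes h: "h \<in> L2 M" and u: "in_cyclic_space h u" and v: "in_cyclic_space h v"
  shows "in_cyclic_space h (\<lambda>x. u x + v x)"
  unfolding in_cyclic_space_def
proof (intro conjI allI impI)
  have uL: "u \<in> L2 M" and vL: "v \<in> L2 M" using u v by (auto simp: in_cyclic_space_def)
  show "(\<lambda>x. u x + v x) \<in> L2 M" by (rule L2_add[OF uL vL])
  fix e :: real assume "e > 0"
  then have e4: "e / 4 > 0" by simp
  obtain n c \<kappa> where 1: "(LINT x|M. (cmod (u x - (\<Sum>i<(n::nat). c i * U (\<kappa> i) h x)))\<^sup>2) < e / 4"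
    using u e4 unfolding in_cyclic_space_def by blast
  obtain n' c' \<kappa>' where 2: "(LINT x|M. (cmod (v x - (\<Sum>i<(n'::nat). c' i * U (\<kappa>' i) h x)))\<^sup>2) < e / 4"
    using v e4 unfolding in_cyclic_space_def by blast
  define d where "d i = (if i < n then c i else c' (i - n))" for i
  define l where "l i = (if i < n then \<kappa> i else \<kappa>' (i - n))" for i
  have s: "(\<Sum>i<n + n'. d i * U (l i) h x) = (\<Sum>i<n. c i * U (\<kappa> i) h x) + (\<Sum>i<n'. c' i * U (\<kappa>' i) h x)" for x
  proof -
    have "(\<Sum>i<n + k. d i * U (l i) h x) = (\<Sum>i<n. d i * U (l i) h x) + (\<Sum>i<k. d (n + i) * U (l (n + i)) h x)" for k
      by (induction k) auto
    then show ?thesis by (simp add: d_def l_def)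
  qed
  have "(LINT x|M. (cmod ((u x - (\<Sum>i<n. c i * U (\<kappa> i) h x)) + (v x - (\<Sum>i<n'. c' i * U (\<kappa>' i) h x))))\<^sup>2) \<le>
      2 * (LINT x|M. (cmod (u x - (\<Sum>i<n. c i * U (\<kappa> i) h x)))\<^sup>2) +
      2 * (LINT x|M. (cmod (v x - (\<Sum>i<n'. c' i * U (\<kappa>' i) h x)))\<^sup>2)"
    by (intro integral_cmod_add_sq_le L2_diff uL vL L2_trig h)
  also have "\<dots> < e" using 1 2 by simp
  finally have "(LINT x|M. (cmod (u x + v x - (\<Sum>i<n + n'. d i * U (l i) h x)))\<^sup>2) < e"
    unfolding s by (simp add: algebra_simps)
  then show "\<exists>n c \<kappa>. (LINT x|M. (cmod (u x + v x - (\<Sum>i<(n::nat). c i * U (\<kappa> i) h x)))\<^sup>2) < e" by blast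
qed

lemma in_cyclic_space_cmult:
  assumes h: "h \<in> L2 M" and u: "in_cyclic_space h u"
  shows "in_cyclic_space h (\<lambda>x. a * u x)"
  unfolding in_cyclic_space_def
proof (intro conjI allI impI)
  show "(\<lambda>x. a * u x) \<in> L2 M" using u by (intro L2_cmult) (simp add: in_cyclic_space_def)
  fix e :: real assume e: "e > 0"
  have a: "(cmod a)\<^sup>2 + 1 > 0" using zero_le_power2[of "cmod a"] by linarith
  then have e': "e / ((cmod a)\<^sup>2 + 1) > 0" using e by simp
  obtain n c \<kappa> where 1: "(LINT x|M. (cmod (u x - (\<Sum>i<(n::nat). c i * U (\<kappa> i) h x)))\<^sup>2) < e / ((cmod a)\<^sup>2 + 1)"
    using u e' unfolding in_cyclic_space_def by blast
  have "(LINT x|M. (cmod (a * u x - (\<Sum>i<n. (a * c i) * U (\<kappa> i) h x)))\<^sup>2) =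
      (LINT x|M. (cmod a)\<^sup>2 * (cmod (u x - (\<Sum>i<n. c i * U (\<kappa> i) h x)))\<^sup>2)"
  proof (intro Bochner_Integration.integral_cong refl)
    fix x
    have "a * u x - (\<Sum>i<n. (a * c i) * U (\<kappa> i) h x) = a * (u x - (\<Sum>i<n. c i * U (\<kappa> i) h x))"
      by (simp add: right_diff_distrib sum_distrib_left mult.assoc)
    then show "(cmod (a * u x - (\<Sum>i<n. (a * c i) * U (\<kappa> i) h x)))\<^sup>2 =
        (cmod a)\<^sup>2 * (cmod (u x - (\<Sum>i<n. c i * U (\<kappa> i) h x)))\<^sup>2"
      by (simp add: norm_mult power_mult_distrib)
  qed
  also have "\<dots> = (cmod a)\<^sup>2 * (LINT x|M. (cmod (u x - (\<Sum>i<n. c i * U (\<kappa> i) h x)))\<^sup>2)" by simp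
  also have "\<dots> \<le> (cmod a)\<^sup>2 * (e / ((cmod a)\<^sup>2 + 1))" using 1 by (intro mult_left_mono) auto
  also have "\<dots> < e" using e a by (simp add: field_simps)
  finally show "\<exists>n c \<kappa>. (LINT x|M. (cmod (a * u x - (\<Sum>i<(n::nat). c i * U (\<kappa> i) h x)))\<^sup>2) < e"
    by (intro exI[of _ n] exI[of _ "\<lambda>i. a * c i"] exI[of _ \<kappa>])
qed

lemma in_cyclic_space_zero: "in_cyclic_space h (\<lambda>x. 0)"
  unfolding in_cyclic_space_def by (auto intro!: L2_zero exI[of _ 0])

lemma in_cyclic_space_sum:
  assumes "h \<in> L2 M" "\<And>i. i \<in> I \<Longrightarrow> in_cyclic_space h (u i)"
  shows "in_cyclic_space h (\<lambda>x. \<Sum>i\<in>I. u i x)"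
  using assms(2)
  by (induction I rule: infinite_finite_induct) (auto intro: in_cyclic_space_zero in_cyclic_space_add[OF assms(1)])

lemma in_cyclic_space_cong:
  assumes h: "h \<in> L2 M" and u: "in_cyclic_space h u" and eq: "AE x in M. u x = v x" and v: "v \<in> borel_measurable M"
  shows "in_cyclic_space h v"
proof -
  have uL: "u \<in> L2 M" using u by (simp add: in_cyclic_space_def)
  have um: "u \<in> borel_measurable M" using uL by (simp add: L2_def)
  have "integrable M (\<lambda>x. (cmod (v x))\<^sup>2)"
    by (rule integrable_cong_AE_imp[OF L2_integrable_sq[OF uL]])
       (use eq v in \<open>auto elim!: eventually_mono\<close>)
  then have vL: "v \<in> L2 M" using v by (simp add: L2_def)
  show ?thesis
  proof (rule in_cyclic_space_limit[OF h vL])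
    fix e :: real assume e: "e > 0"
    have "(LINT x|M. (cmod (v x - u x))\<^sup>2) = 0"
      by (rule integral_eq_zero_AE) (use eq in \<open>auto elim!: eventually_mono\<close>)
    then show "\<exists>w. in_cyclic_space h w \<and> (LINT x|M. (cmod (v x - w x))\<^sup>2) < e"
      using u e by (intro exI[of _ u]) simp
  qed
qed

text \<open>Square-integrable functions are limits of dominated simple functions, and a simple
  function is a combination of indicators.\<close>

lemma approx_cyclic_if_indicators:
  assumes h: "h \<in> L2 M" and ind: "\<And>A. A \<in> sets M \<Longrightarrow> in_cyclic_space h (indicator A)"
  shows "approx_cyclic h"
proof -
  have "in_cyclic_space h g" if g: "g \<in> L2 M" for g
  proof -
    have gm [measurable]: "g \<in> borel_measurable M" using g by (simp add: L2_def)
    obtain s where s: "\<And>i. simple_function M (s i)" "\<And>x. x \<in> space M \<Longrightarrow> (\<lambda>i. s i x) \<longlonglongrightarrow> g x"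
      "\<And>i x. x \<in> space M \<Longrightarrow> dist (s i x) 0 \<le> 2 * dist (g x) 0"
      using borel_measurable_implies_sequence_metric[OF gm, of 0] by blast
    have sm [measurable]: "s i \<in> borel_measurable M" for i by (rule borel_measurable_simple_function[OF s(1)])
    have sV: "in_cyclic_space h (s i)" for i
    proof (rule in_cyclic_space_cong[OF h _ _ sm])
      show "in_cyclic_space h (\<lambda>x. \<Sum>y\<in>s i ` space M. y * indicator (s i -` {y} \<inter> space M) x)"
        by (intro in_cyclic_space_sum in_cyclic_space_cmult h ind simple_functionD(2)[OF s(1)])
      show "AE x in M. (\<Sum>y\<in>s i ` space M. y * indicator (s i -` {y} \<inter> space M) x) = s i x"
      proof (rule AE_I2)
        fix x assume x: "x \<in> space M"
        have "(\<Sum>y\<in>s i ` space M. y * indicator (s i -` {y} \<inter> space M) x) =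
            (\<Sum>y\<in>s i ` space M. if y = s i x then y else 0)"
          using x by (intro sum.cong) (auto simp: indicator_def)
        then show "(\<Sum>y\<in>s i ` space M. y * indicator (s i -` {y} \<inter> space M) x) = s i x"
          using x simple_functionD(1)[OF s(1)] by simp
      qed
    qed
    have "(\<lambda>i. LINT x|M. (cmod (g x - s i x))\<^sup>2) \<longlonglongrightarrow> (LINT x|M. 0)"
    \<comment> \<open>The constant is the square of \<open>1 + 2\<close>, as the approximants are
      bounded by \<open>2 * cmod (g x)\<close>.\<close>
    proof (rule integral_dominated_convergence[where w = "\<lambda>x. 9 * (cmod (g x))\<^sup>2"])
      show "integrable M (\<lambda>x. 9 * (cmod (g x))\<^sup>2)" using L2_integrable_sq[OF g] by simp
      show "AE x in M. (\<lambda>i. (cmod (g x - s i x))\<^sup>2) \<longlonglongrightarrow> 0"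
      proof (rule AE_I2)
        fix x assume "x \<in> space M"
        from s(2)[OF this] have "(\<lambda>i. (cmod (g x - s i x))\<^sup>2) \<longlonglongrightarrow> (cmod (g x - g x))\<^sup>2"
          by (intro tendsto_power tendsto_norm tendsto_diff tendsto_const)
        then show "(\<lambda>i. (cmod (g x - s i x))\<^sup>2) \<longlonglongrightarrow> 0" by simp
      qed
      show "AE x in M. norm ((cmod (g x - s i x))\<^sup>2) \<le> 9 * (cmod (g x))\<^sup>2" for i
      proof (rule AE_I2)
        fix x assume "x \<in> space M"
        from s(3)[OF this, of i] have "cmod (g x - s i x) \<le> 3 * cmod (g x)"
          using norm_triangle_ineq4[of "g x" "s i x"] by simp
        then have "(cmod (g x - s i x))\<^sup>2 \<le> (3 * cmod (g x))\<^sup>2" by (intro power_mono) auto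
        then show "norm ((cmod (g x - s i x))\<^sup>2) \<le> 9 * (cmod (g x))\<^sup>2" by (simp add: power_mult_distrib)
      qed
    qed measurable
    then show ?thesis by (intro in_cyclic_space_tendsto[OF h g sV]) simp
  qed
  then show ?thesis using h unfolding approx_cyclic_def in_cyclic_space_def by blast
qed

end

lemma (in finite_measure) bounded_L2:
  assumes u: "u \<in> borel_measurable M" and B: "\<And>x. x \<in> space M \<Longrightarrow> cmod (u x) \<le> B"
  shows "u \<in> L2 M"
proof -
  have "integrable M (\<lambda>x. (cmod (u x))\<^sup>2)"
  proof (rule integrable_const_bound[where B = "B\<^sup>2"])
    show "AE x in M. norm ((cmod (u x))\<^sup>2) \<le> B\<^sup>2"
      by (rule AE_I2) (use B in \<open>auto intro!: power_mono\<close>)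
  qed (use u in measurable)
  then show ?thesis using u by (simp add: L2_def)
qed

text \<open>Initial segments form an intersection-stable generator of the Borel sets, and the sets
  with indicator in the cyclic space are closed under complements and countable disjoint unions.
  Lebesgue sets are reached up to null sets.\<close>

lemma approx_cyclic_unit_interval:
  assumes S: "automorphism unit_interval S" and h: "h \<in> L2 unit_interval"
    and init: "\<And>c. koopman.in_cyclic_space unit_interval S h (indicator {..<c})"
  shows "koopman.approx_cyclic unit_interval S h"
proof -
  interpret koopman unit_interval S
    by (intro koopman.intro koopman_axioms.intro prob_space_unit_interval S)
  have BX: "A \<inter> {0..<1} \<in> sets unit_interval" if "A \<in> sets borel" for A :: "real set"
    using measurable_sets[OF id_measurable_unit_interval that] by (simp add: vimage_def Int_def conj_commute)
  have im: "(indicator A :: real \<Rightarrow> complex) \<in> borel_measurable unit_interval" if "A \<in> sets borel" for A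
    using that by (intro measurable_restrict_space1 measurable_completion) simp
  have bor: "in_cyclic_space h (indicator A)" if A: "A \<in> sets borel" for A
  proof -
    have A': "A \<in> sigma_sets UNIV (range (\<lambda>a::real. {..<a}))"
      using A unfolding borel_Iio by (simp add: sets_measure_of)
    have IS: "Int_stable (range (\<lambda>a::real. {..<a}))"
    proof -
      have "{..<a} \<inter> {..<b} = {..<min a b}" for a b :: real by auto
      then show ?thesis by (auto simp: Int_stable_def)
    qed
    have b: "B \<in> sets borel" if "B \<in> sigma_sets UNIV (range (\<lambda>a::real. {..<a}))" for B
      using that unfolding borel_Iio by (simp add: sets_measure_of)
    have sub: "range (\<lambda>a::real. {..<a}) \<subseteq> Pow UNIV" by simp
    from IS sub A' show ?thesis
    proof (induction A rule: sigma_sets_induct_disjoint[where \<Omega> = UNIV])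
      case (basic A)
      then show ?case using init by auto
    next
      case empty
      then show ?case using in_cyclic_space_zero[of h] by (simp add: indicator_def[abs_def])
    next
      case (compl A)
      \<comment> \<open>On the interval this indicator is the constant 1.\<close>
      have "in_cyclic_space h (indicator {..<1})" by (rule init)
      then have 1: "in_cyclic_space h (\<lambda>x. indicator {..<1} x + -1 * indicator A x)"
        using compl by (intro in_cyclic_space_add in_cyclic_space_cmult h) auto
      show ?case
      proof (rule in_cyclic_space_cong[OF h 1])
        show "AE x in unit_interval. indicator {..<1} x + -1 * indicator A x = (indicator (UNIV - A) x :: complex)"
          by (rule AE_I2) (auto simp: indicator_def)
        show "(indicator (UNIV - A) :: real \<Rightarrow> complex) \<in> borel_measurable unit_interval"
          using b[OF compl(1)] by (intro im) auto
      qed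
    next
      case (union A)
      have UA: "(\<Union>i. A i) \<in> sets borel" using b union(2) by blast
      have uL: "(indicator (\<Union>i. A i) :: real \<Rightarrow> complex) \<in> L2 unit_interval"
        by (rule UI.bounded_L2[OF im[OF UA], of 1]) (simp add: indicator_def)
      show ?case
      proof (rule in_cyclic_space_tendsto[OF h uL])
        show "in_cyclic_space h (\<lambda>x. \<Sum>i<n. indicator (A i) x)" for n
          using union by (intro in_cyclic_space_sum h) auto
        have [measurable]: "(indicator (A i) :: real \<Rightarrow> complex) \<in> borel_measurable unit_interval" for i
          using b union(2) by (intro im) blast
        note [measurable] = im[OF UA]
        have sums: "(\<lambda>i. indicator (A i) x :: complex) sums indicator (\<Union>i. A i) x" for x
        proof (cases "x \<in> (\<Union>i. A i)")
          case True
          then obtain i where i: "x \<in> A i" by blast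
          then have "x \<notin> A j" if "j \<noteq> i" for j
            using union(1) that by (auto simp: disjoint_family_on_def)
          then have "(\<lambda>i. indicator (A i) x :: complex) = (\<lambda>j. if j = i then 1 else 0)"
            using i by (auto simp: indicator_def fun_eq_iff)
          then show ?thesis using True sums_single[of i "\<lambda>_. 1 :: complex"] by simp
        qed auto
        have le1: "cmod (\<Sum>i<n. indicator (A i) x) \<le> 1" for n x
        proof (cases "\<exists>i<n. x \<in> A i")
          case True
          then obtain i where i: "i < n" "x \<in> A i" by blast
          then have "x \<notin> A j" if "j \<noteq> i" for j
            using union(1) that by (auto simp: disjoint_family_on_def)
          then have "(\<Sum>j<n. indicator (A j) x) = (\<Sum>j<n. if j = i then 1 else 0 :: complex)"
            using i by (intro sum.cong) (auto simp: indicator_def)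
          then show ?thesis using i by simp
        qed (simp add: indicator_def)
        have "(\<lambda>n. LINT x|unit_interval. (cmod (indicator (\<Union>i. A i) x - (\<Sum>i<n. indicator (A i) x)))\<^sup>2)
            \<longlonglongrightarrow> (LINT x|unit_interval. 0)"
        proof (rule integral_dominated_convergence[where w = "\<lambda>_. 4"])
          show "AE x in unit_interval. (\<lambda>n. (cmod (indicator (\<Union>i. A i) x - (\<Sum>i<n. indicator (A i) x)))\<^sup>2) \<longlonglongrightarrow> 0"
          proof (rule AE_I2)
            fix x
            have "(\<lambda>n. (cmod (indicator (\<Union>i. A i) x - (\<Sum>i<n. indicator (A i) x)))\<^sup>2) \<longlonglongrightarrow>
              (cmod (indicator (\<Union>i. A i) x - indicator (\<Union>i. A i) x))\<^sup>2"
              using sums[of x, unfolded sums_def] by (intro tendsto_power tendsto_norm tendsto_diff tendsto_const)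
            then show "(\<lambda>n. (cmod (indicator (\<Union>i. A i) x - (\<Sum>i<n. indicator (A i) x)))\<^sup>2) \<longlonglongrightarrow> 0" by simp
          qed
          show "AE x in unit_interval. norm ((cmod (indicator (\<Union>i. A i) x - (\<Sum>i<n. indicator (A i) x)))\<^sup>2) \<le> 4" for n
          proof (rule AE_I2)
            fix x
            have "cmod (indicator (\<Union>i. A i) x - (\<Sum>i<n. indicator (A i) x)) \<le> 1 + 1"
              by (rule order.trans[OF norm_triangle_ineq4 add_mono[OF _ le1]]) (simp add: indicator_def)
            then have "(cmod (indicator (\<Union>i. A i) x - (\<Sum>i<n. indicator (A i) x)))\<^sup>2 \<le> 2\<^sup>2"
              by (intro power_mono) auto
            then show "norm ((cmod (indicator (\<Union>i. A i) x - (\<Sum>i<n. indicator (A i) x)))\<^sup>2) \<le> 4" by simp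
          qed
        qed auto
        then show "(\<lambda>n. LINT x|unit_interval. (cmod (indicator (\<Union>i. A i) x - (\<Sum>i<n. indicator (A i) x)))\<^sup>2) \<longlonglongrightarrow> 0"
          by simp
      qed
    qed
  qed
  show ?thesis
  proof (rule approx_cyclic_if_indicators[OF h])
    fix A assume A: "A \<in> sets unit_interval"
    then have A': "A \<in> sets (completion lborel)" by (auto simp: sets_restrict_space_iff)
    obtain S' N N' where S': "A = S' \<union> N" "N \<subseteq> N'" "N' \<in> null_sets lborel" "S' \<in> sets lborel"
      using sets_completionE[OF A'] by blast
    show "in_cyclic_space h (indicator A)"
    proof (rule in_cyclic_space_cong[OF h bor[of S']])
      have "N' \<in> null_sets lebesgue" using S'(3) by (rule null_sets_completionI)
      then have "N' \<inter> {0..<1} \<in> null_sets unit_interval"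
        by (auto simp: null_sets_restrict_space intro: null_set_Int2)
      then have "AE x in unit_interval. x \<notin> N' \<inter> {0..<1}" by (rule AE_not_in)
      then show "AE x in unit_interval. indicator S' x = (indicator A x :: complex)"
        using AE_space by eventually_elim (use S' in \<open>auto simp: indicator_def\<close>)
      show "(indicator A :: real \<Rightarrow> complex) \<in> borel_measurable unit_interval" using A by simp
    qed (use S' in auto)
  qed
qed

section \<open>Cyclic orders on finite sets\<close>

text \<open>An enumeration of the cells continued periodically to all indices, so that times can be
  added without reduction modulo \<open>m\<close>.\<close>

definition cyclic_order :: "nat \<Rightarrow> (nat \<Rightarrow> nat) \<Rightarrow> bool" where
  "cyclic_order m \<phi> \<longleftrightarrow> 0 < m \<and> bij_betw \<phi> {..<m} {..<m} \<and> (\<forall>i. \<phi> (i + m) = \<phi> i)"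

text \<open>The permutation that moves each point to its successor; for a cyclic order it is a
  single cycle of length \<open>m\<close>.\<close>

definition next_in :: "nat \<Rightarrow> (nat \<Rightarrow> nat) \<Rightarrow> nat \<Rightarrow> nat" where
  "next_in m \<phi> k = \<phi> (Suc (inv_into {..<m} \<phi> k))"

lemma cyclic_order_mod: "cyclic_order m \<phi> \<Longrightarrow> \<phi> (i mod m) = \<phi> i"
proof -
  assume c: "cyclic_order m \<phi>"
  have "\<phi> (i + q * m) = \<phi> i" for i q
  proof (induction q)
    case (Suc q)
    have "i + Suc q * m = (i + q * m) + m" by simp
    then show ?case using c Suc by (simp only: cyclic_order_def)
  qed simp
  from this[of "i mod m" "i div m"] show ?thesis by simp
qed

lemma cyclic_order_mod_eq: "cyclic_order m \<phi> \<Longrightarrow> i mod m = j mod m \<Longrightarrow> \<phi> i = \<phi> j"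
  using cyclic_order_mod[of m \<phi> i] cyclic_order_mod[of m \<phi> j] by simp

lemma cyclic_order_less: "cyclic_order m \<phi> \<Longrightarrow> \<phi> i < m"
  using bij_betw_apply[of \<phi> "{..<m}" "{..<m}" "i mod m"]
  by (auto simp: cyclic_order_mod cyclic_order_def)

lemma cyclic_order_surj: "cyclic_order m \<phi> \<Longrightarrow> k < m \<Longrightarrow> \<exists>i<m. \<phi> i = k"
  unfolding cyclic_order_def bij_betw_def by (auto dest!: equalityD2 subsetD[of _ _ k])

lemma cyclic_order_eqD: "cyclic_order m \<phi> \<Longrightarrow> \<phi> i = \<phi> j \<Longrightarrow> i mod m = j mod m"
  using inj_onD[of \<phi> "{..<m}" "i mod m" "j mod m"]
  by (auto simp: cyclic_order_mod bij_betw_def cyclic_order_def)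

lemma next_in_order:
  assumes "cyclic_order m \<phi>" shows "next_in m \<phi> (\<phi> i) = \<phi> (Suc i)"
proof -
  have "inv_into {..<m} \<phi> (\<phi> i) = i mod m"
    using assms inv_into_f_f[of \<phi> "{..<m}" "i mod m"]
    by (auto simp: cyclic_order_mod bij_betw_def cyclic_order_def)
  moreover have "\<phi> (Suc (i mod m)) = \<phi> (Suc i)"
    by (rule cyclic_order_mod_eq[OF assms]) (simp add: mod_Suc_eq)
  ultimately show ?thesis by (simp add: next_in_def)
qed

lemma next_in_pow: "cyclic_order m \<phi> \<Longrightarrow> (next_in m \<phi> ^^ n) (\<phi> i) = \<phi> (i + n)"
  by (induction n) (auto simp: next_in_order)

lemma next_in_less: "cyclic_order m \<phi> \<Longrightarrow> k < m \<Longrightarrow> next_in m \<phi> k < m"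
  by (simp add: next_in_def cyclic_order_less)

lemma next_in_pow_period:
  assumes "cyclic_order m \<phi>" "k < m" shows "(next_in m \<phi> ^^ m) k = k"
proof -
  obtain i where "\<phi> i = k" using cyclic_order_surj[OF assms] by blast
  then show ?thesis using next_in_pow[OF assms(1), of m i] assms(1) by (simp add: cyclic_order_def)
qed

text \<open>With a uniformly distributed shift, the cell read at any fixed time is uniform; this is
  the form in which shifts are counted below.\<close>

lemma cyclic_order_shift_bij:
  assumes "cyclic_order m \<phi>" shows "bij_betw (\<lambda>x. \<phi> (i + x)) {..<m} {..<m}"
proof -
  have "inj_on (\<lambda>x. \<phi> (i + x)) {..<m}"
  proof (rule inj_onI)
    fix x y assume "x \<in> {..<m}" "y \<in> {..<m}" "\<phi> (i + x) = \<phi> (i + y)"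
    then have xy: "(i + x) mod m = (i + y) mod m" "x < m" "y < m"
      using cyclic_order_eqD[OF assms, of "i + x" "i + y"] by auto
    have ne: False if "x < y" "y < m" "(i + x) mod m = (i + y) mod m" for x y
    proof -
      have "m dvd (i + y) - (i + x)" using mod_eq_dvd_iff_nat[of "i + x" "i + y" m] that by simp
      then have "m dvd y - x" by simp
      then show False using that dvd_imp_le[of m "y - x"] by simp
    qed
    show "x = y"
      using ne[of x y] ne[of y x] xy by (cases x y rule: linorder_cases) simp_all
  qed
  moreover have "(\<lambda>x. \<phi> (i + x)) ` {..<m} \<subseteq> {..<m}"
    using cyclic_order_less[OF assms] by auto
  ultimately show ?thesis
    by (simp add: bij_betw_def endo_inj_surj)
qed

lemma next_in_bij:
  assumes "cyclic_order m \<phi>" shows "bij_betw (next_in m \<phi>) {..<m} {..<m}"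
proof -
  have "inj_on (next_in m \<phi>) {..<m}"
  proof (rule inj_onI)
    fix x y assume x: "x \<in> {..<m}" and y: "y \<in> {..<m}" and e: "next_in m \<phi> x = next_in m \<phi> y"
    obtain i j where ij: "i < m" "\<phi> i = x" "j < m" "\<phi> j = y"
      using cyclic_order_surj[OF assms] x y by blast
    then have "\<phi> (1 + i) = \<phi> (1 + j)" using e next_in_order[OF assms] by auto
    then have "i = j" using cyclic_order_shift_bij[OF assms, of 1] ij
      by (auto simp: bij_betw_def inj_on_def)
    then show "x = y" using ij by simp
  qed
  moreover have "next_in m \<phi> ` {..<m} \<subseteq> {..<m}"
    using next_in_less[OF assms] by auto
  ultimately show ?thesis
    by (simp add: bij_betw_def endo_inj_surj)
qed

section \<open>Cyclic vectors of finite rotations\<close>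

text \<open>Cyclicity of \<open>f\<close> for the finite rotation: every point mass is a combination
  of translates.\<close>

definition generating :: "nat \<Rightarrow> (nat \<Rightarrow> nat) \<Rightarrow> (nat \<Rightarrow> complex) \<Rightarrow> bool" where
  "generating m \<phi> f \<longleftrightarrow> (\<forall>a<m. \<exists>b. \<forall>k<m.
     (\<Sum>i<m. b i * f ((next_in m \<phi> ^^ i) k)) = (if k = a then 1 else 0))"

lemma sum_periodic_shift:
  fixes g :: "nat \<Rightarrow> complex"
  assumes "\<And>i. g (i + m) = g i"
  shows "(\<Sum>i<m. g (i + u)) = (\<Sum>i<m. g i)"
proof (induction u)
  case (Suc u)
  have "(\<Sum>i<m. g (i + Suc u)) + g u = (\<Sum>i<Suc m. g (i + u))"
    by (subst sum.lessThan_Suc_shift) simp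
  also have "\<dots> = (\<Sum>i<m. g (i + u)) + g u" using assms[of u] by (simp add: add.commute)
  finally show ?case using Suc by simp
qed simp

text \<open>For \<open>u \<noteq> a\<close> this is a geometric sum whose ratio differs from 1 and
  has \<open>m\<close>-th power 1.\<close>

lemma root_unity_orthogonal:
  assumes "u < m" "a < m"
  shows "(\<Sum>l<m. (cis (2 * pi * real l / real m)) ^ u / (cis (2 * pi * real l / real m)) ^ a) =
    (if u = a then of_nat m else 0)"
proof -
  define w where "w x = cis (2 * pi * real x / real m)" for x
  have m: "m > 0" using assms by simp
  have w0: "w x \<noteq> 0" for x by (simp add: w_def)
  have sw: "w l ^ u = w u ^ l" for l u by (simp add: w_def Complex.DeMoivre mult_ac)
  have wm: "w x ^ m = 1" for x
  proof -
    have "w x ^ m = cis (2 * pi * real x)" using m by (simp add: w_def Complex.DeMoivre)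
    then show ?thesis by (simp add: cis_multiple_2pi)
  qed
  have "(\<Sum>l<m. w l ^ u / w l ^ a) = (\<Sum>l<m. (w u / w a) ^ l)"
    by (simp add: sw power_divide)
  also have "\<dots> = (if u = a then of_nat m else 0)"
  proof (cases "u = a")
    case False
    have "inj_on w {..<m}"
      using Complex.bij_betw_roots_unity[OF m] by (simp add: bij_betw_def w_def[abs_def])
    then have "w u / w a \<noteq> 1" using False assms w0 by (auto simp: inj_on_def)
    then have "(\<Sum>l<m. (w u / w a) ^ l) = ((w u / w a) ^ m - 1) / (w u / w a - 1)"
      by (rule geometric_sum)
    then show ?thesis using False by (simp add: power_divide wm)
  qed (simp add: w0)
  finally show ?thesis by (simp add: w_def)
qed

text \<open>Convolution along the cycle is inverted by the discrete Fourier transform, where one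
  divides by exactly the coefficients assumed to be nonzero.\<close>

lemma generating_if_dft_nonzero:
  assumes c: "cyclic_order m \<phi>"
    and nz: "\<And>l. l < m \<Longrightarrow> (\<Sum>x<m. f (\<phi> x) / cis (2 * pi * real l / real m) ^ x) \<noteq> 0"
  shows "generating m \<phi> f"
  unfolding generating_def
proof (intro allI impI)
  fix a' assume "a' < m"
  then obtain a where a: "a < m" "\<phi> a = a'" using cyclic_order_surj[OF c] by blast
  have m: "m > 0" using a by simp
  define w where "w l = cis (2 * pi * real l / real m)" for l
  have w0: "w x \<noteq> 0" for x by (simp add: w_def)
  have wm: "w x ^ m = 1" for x
  proof -
    have "w x ^ m = cis (2 * pi * real x)" using m by (simp add: w_def Complex.DeMoivre)
    then show ?thesis by (simp add: cis_multiple_2pi)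
  qed
  define H where "H l = (\<Sum>x<m. f (\<phi> x) / w l ^ x)" for l
  have H: "H l \<noteq> 0" if "l < m" for l using nz[OF that] by (simp add: H_def w_def)
  \<comment> \<open>Fourier inversion of the point mass at position \<open>a\<close>, divided
    coefficientwise by \<open>H\<close>.\<close>
  define b where "b i = (\<Sum>l<m. 1 / (H l * w l ^ (i + a))) / of_nat m" for i
  have sh: "(\<Sum>i<m. f (\<phi> (i + u)) / w l ^ (i + u)) = H l" for l u
    unfolding H_def
    by (rule sum_periodic_shift[where g = "\<lambda>x. f (\<phi> x) / w l ^ x"])
       (use c in \<open>simp add: cyclic_order_def power_add wm\<close>)
  have "(\<Sum>i<m. b i * f (\<phi> (u + i))) = (if u = a then 1 else 0)" if u: "u < m" for u
  proof -
    have "(\<Sum>i<m. b i * f (\<phi> (u + i))) = (\<Sum>i<m. \<Sum>l<m. (w l ^ u / w l ^ a / H l / of_nat m) * (f (\<phi> (i + u)) / w l ^ (i + u)))"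
      unfolding b_def sum_divide_distrib sum_distrib_right
      by (intro sum.cong refl) (simp add: power_add w0 field_simps)
    also have "\<dots> = (\<Sum>l<m. (w l ^ u / w l ^ a / H l / of_nat m) * (\<Sum>i<m. f (\<phi> (i + u)) / w l ^ (i + u)))"
      unfolding sum_distrib_left by (rule sum.swap)
    also have "\<dots> = (\<Sum>l<m. w l ^ u / w l ^ a) / of_nat m"
      unfolding sh sum_divide_distrib by (intro sum.cong refl) (simp add: H)
    also have "\<dots> = (if u = a then 1 else 0)"
      unfolding w_def root_unity_orthogonal[OF u a(1)] using m by simp
    finally show ?thesis .
  qed
  note * = this
  have inj: "u = a \<longleftrightarrow> \<phi> u = a'" if "u < m" for u
    using that a cyclic_order_eqD[OF c, of u a] by auto
  show "\<exists>b. \<forall>k<m. (\<Sum>i<m. b i * f ((next_in m \<phi> ^^ i) k)) = (if k = a' then 1 else 0)"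
  proof (intro exI[of _ b] allI impI)
    fix k assume "k < m"
    then obtain u where u: "u < m" "\<phi> u = k" using cyclic_order_surj[OF c] by blast
    show "(\<Sum>i<m. b i * f ((next_in m \<phi> ^^ i) k)) = (if k = a' then 1 else 0)"
      using *[OF u(1)] inj[OF u(1)] by (simp add: u(2)[symmetric] next_in_pow[OF c])
  qed
qed

text \<open>The point 0 occurs once in the cycle, so the added value contributes \<open>t\<close>
  times a root of unity to each Fourier coefficient. Each of the \<open>m\<close> coefficients thus
  excludes a single \<open>t\<close>.\<close>

lemma finite_not_generating:
  assumes c: "cyclic_order m \<phi>"
  shows "finite {t. \<not> generating m \<phi> (\<lambda>k. f k + (if k = 0 then t else 0))}"
proof -
  define w where "w l = cis (2 * pi * real l / real m)" for l
  have w0: "w x \<noteq> 0" for x by (simp add: w_def)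
  have "0 < m" using c by (simp add: cyclic_order_def)
  then obtain u where u: "u < m" "\<phi> u = 0" using cyclic_order_surj[OF c] by blast
  have "{t. \<not> generating m \<phi> (\<lambda>k. f k + (if k = 0 then t else 0))} \<subseteq>
      (\<lambda>l. - (\<Sum>x<m. f (\<phi> x) / w l ^ x) * w l ^ u) ` {..<m}"
  proof
    fix t assume "t \<in> {t. \<not> generating m \<phi> (\<lambda>k. f k + (if k = 0 then t else 0))}"
    then obtain l where l: "l < m"
      "(\<Sum>x<m. (f (\<phi> x) + (if \<phi> x = 0 then t else 0)) / w l ^ x) = 0"
      using generating_if_dft_nonzero[OF c, of "\<lambda>k. f k + (if k = 0 then t else 0)"] unfolding w_def by blast
    have "(\<Sum>x<m. (f (\<phi> x) + (if \<phi> x = 0 then t else 0)) / w l ^ x) =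
        (\<Sum>x<m. f (\<phi> x) / w l ^ x) + (\<Sum>x<m. if x = u then t / w l ^ u else 0)"
      unfolding sum.distrib[symmetric]
    proof (intro sum.cong refl)
      fix x assume "x \<in> {..<m}"
      then have "\<phi> x = 0 \<longleftrightarrow> x = u"
        using u cyclic_order_eqD[OF c, of x u] by auto
      then show "(f (\<phi> x) + (if \<phi> x = 0 then t else 0)) / w l ^ x =
          f (\<phi> x) / w l ^ x + (if x = u then t / w l ^ u else 0)"
        by (simp add: add_divide_distrib)
    qed
    also have "\<dots> = (\<Sum>x<m. f (\<phi> x) / w l ^ x) + t / w l ^ u" using u by simp
    finally have "t / w l ^ u = - (\<Sum>x<m. f (\<phi> x) / w l ^ x)" using l by (simp add: add_eq_0_iff)
    then have "t = - (\<Sum>x<m. f (\<phi> x) / w l ^ x) * w l ^ u"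
      using w0[of l] by (simp add: field_simps)
    then show "t \<in> (\<lambda>l. - (\<Sum>x<m. f (\<phi> x) / w l ^ x) * w l ^ u) ` {..<m}" using l by blast
  qed
  then show ?thesis by (rule finite_subset) simp
qed

section \<open>The inductive step: independent block shifts\<close>

text \<open>Fibres of equal size are matched value by value and the bijections glued.\<close>

lemma bij_betw_matching_fibres:
  assumes "finite A" "finite B" "\<And>v. card {a\<in>A. f a = v} = card {b\<in>B. g b = v}"
  shows "\<exists>h. bij_betw h A B \<and> (\<forall>a\<in>A. g (h a) = f a)"
proof -
  have "\<exists>h. bij_betw h {a\<in>A. f a = v} {b\<in>B. g b = v}" for v
    using assms by (intro finite_same_card_bij) auto
  then obtain h where h: "\<And>v. bij_betw (h v) {a\<in>A. f a = v} {b\<in>B. g b = v}" by metis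
  have hB: "h (f a) a \<in> B \<and> g (h (f a) a) = f a" if "a \<in> A" for a
    using bij_betw_apply[OF h[of "f a"], of a] that by auto
  have "bij_betw (\<lambda>a. h (f a) a) A B"
    unfolding bij_betw_def
  proof
    show "inj_on (\<lambda>a. h (f a) a) A"
    proof (rule inj_onI)
      fix x y assume x: "x \<in> A" and y: "y \<in> A" and e: "h (f x) x = h (f y) y"
      then have "f x = f y" using hB[OF x] hB[OF y] by simp
      then show "x = y" using x y e bij_betw_imp_inj_on[OF h[of "f x"]] by (auto simp: inj_on_def)
    qed
    show "(\<lambda>a. h (f a) a) ` A = B"
    proof
      show "B \<subseteq> (\<lambda>a. h (f a) a) ` A"
      proof
        fix b assume "b \<in> B"
        then have "b \<in> h (g b) ` {a\<in>A. f a = g b}" using h[of "g b"] by (auto simp: bij_betw_def)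
        then obtain x where x: "x \<in> A" "f x = g b" "b = h (g b) x" by blast
        have "b = h (f x) x" unfolding x(2) by (rule x(3))
        with x(1) show "b \<in> (\<lambda>a. h (f a) a) ` A" by (rule image_eqI[rotated])
      qed
    qed (use hB in auto)
  qed
  then show ?thesis using hB by blast
qed

section \<open>Counting words of independent shifts\<close>

definition words :: "nat \<Rightarrow> nat \<Rightarrow> (nat \<Rightarrow> nat) set" where
  "words B m = ({..<B} \<rightarrow>\<^sub>E {..<m})"

lemma finite_words [simp]: "finite (words B m)"
  by (simp add: words_def finite_PiE)

lemma card_words: "card (words B m) = m ^ B"
  by (simp add: words_def card_PiE)

text \<open>The constraints sit on distinct letters and each is met by one value, because
  \<open>\<beta> k\<close> is a bijection; the remaining letters are free.\<close>

lemma card_words_constrained: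
  assumes K: "finite K" "inj_on bl K" "bl ` K \<subseteq> {..<B}"
    and \<beta>: "\<And>k. k \<in> K \<Longrightarrow> bij_betw (\<beta> k) {..<m} {..<m}" and t: "\<And>k. k \<in> K \<Longrightarrow> t k < m"
  shows "card {\<omega>\<in>words B m. \<forall>k\<in>K. \<beta> k (\<omega> (bl k)) = t k} = m ^ (B - card K)"
proof -
  define S where "S b = {x\<in>{..<m}. \<forall>k\<in>K. bl k = b \<longrightarrow> \<beta> k x = t k}" for b
  have "{\<omega>\<in>words B m. \<forall>k\<in>K. \<beta> k (\<omega> (bl k)) = t k} = PiE {..<B} S"
  proof (intro set_eqI iffI)
    fix \<omega> assume \<omega>: "\<omega> \<in> PiE {..<B} S"
    then have S: "\<omega> b \<in> S b" if "b < B" for b using that by (auto simp: PiE_iff)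
    have "\<beta> k (\<omega> (bl k)) = t k" if "k \<in> K" for k
    proof -
      have "bl k < B" using K(3) that by auto
      from S[OF this] show ?thesis using that by (simp add: S_def)
    qed
    then show "\<omega> \<in> {\<omega>\<in>words B m. \<forall>k\<in>K. \<beta> k (\<omega> (bl k)) = t k}"
      using \<omega> by (auto simp: words_def S_def PiE_iff)
  qed (auto simp: words_def S_def PiE_iff)
  moreover have "card (S b) = (if b \<in> bl ` K then 1 else m)" for b
  proof (cases "b \<in> bl ` K")
    case True
    then obtain k where k: "k \<in> K" "bl k = b" by auto
    have Sb: "S b = {x\<in>{..<m}. \<beta> k x = t k}"
      using k K(2) by (auto simp: S_def inj_on_def)
    obtain x where x: "x < m" "\<beta> k x = t k"
      using \<beta>[OF k(1)] t[OF k(1)] unfolding bij_betw_def by (metis imageE lessThan_iff)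
    then have "{x\<in>{..<m}. \<beta> k x = t k} = {x}"
      using \<beta>[OF k(1)] by (auto simp: bij_betw_def inj_on_def)
    then show ?thesis using True Sb by simp
  next
    case False
    then have "S b = {..<m}" by (auto simp: S_def)
    then show ?thesis using False by simp
  qed
  ultimately have "card {\<omega>\<in>words B m. \<forall>k\<in>K. \<beta> k (\<omega> (bl k)) = t k} = (\<Prod>b<B. if b \<in> bl ` K then 1 else m)"
    by (simp add: card_PiE)
  also have "\<dots> = (\<Prod>b\<in>{..<B} - bl ` K. m)"
    by (rule prod.mono_neutral_cong_right) auto
  also have "\<dots> = m ^ (B - card K)"
    using K by (simp add: card_Diff_subset card_image)
  finally show ?thesis .
qed

text \<open>A position is a pair of a time \<open>i\<close> and a word \<open>\<omega>\<close> of block shifts; inside each block of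
  length \<open>L\<close> the symbol read at time \<open>i\<close> runs through the given cyclic order.\<close>

definition reading :: "(nat \<Rightarrow> nat) \<Rightarrow> nat \<Rightarrow> nat \<times> (nat \<Rightarrow> nat) \<Rightarrow> nat" where
  "reading \<phi> L y = \<phi> (fst y + snd y (fst y div L))"

text \<open>The data that the identification has to respect. \<open>\<kappa>\<close> acts on future
  cells only, so that the present cell is preserved. If the horizon \<open>P\<close> leaves the word
  of length \<open>X\<close>, the future is replaced by \<open>None\<close>, and then only time and
  present cell are matched.\<close>

definition pattern ::
  "(nat \<Rightarrow> nat) \<Rightarrow> nat \<Rightarrow> (nat \<Rightarrow> nat) \<Rightarrow> (nat \<Rightarrow> nat) \<Rightarrow> nat set \<Rightarrow> nat \<Rightarrow> nat \<Rightarrow> nat \<times> (nat \<Rightarrow> nat)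
    \<Rightarrow> nat \<times> nat \<times> (nat \<Rightarrow> nat) option" where
  "pattern \<phi> L \<kappa> p I P X y = (fst y, reading \<phi> L y,
     if fst y + P < X then Some (\<lambda>n\<in>I. \<kappa> (reading \<phi> L (fst y + p n, snd y))) else None)"

text \<open>The bound \<open>L \<le> p n\<close> puts time \<open>p n\<close> into a later block
  than the present one, the gaps separate different \<open>n\<close>, and \<open>P\<close> is the
  horizon.\<close>

definition gapped :: "nat set \<Rightarrow> (nat \<Rightarrow> nat) \<Rightarrow> nat \<Rightarrow> nat \<Rightarrow> bool" where
  "gapped I p L P \<longleftrightarrow> (\<forall>n\<in>I. L \<le> p n \<and> p n \<le> P) \<and> (\<forall>n\<in>I. \<forall>n'\<in>I. n < n' \<longrightarrow> p n + L \<le> p n')"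

lemma div_less_div: "a + L \<le> b \<Longrightarrow> 0 < L \<Longrightarrow> a div L < b div (L::nat)"
  using div_le_mono[of "a + L" b L] by simp

lemma card_reading_fibre:
  assumes c: "cyclic_order m \<phi>" and L: "0 < L" and i: "i < B * L" and a: "a < m"
  shows "card {\<omega>\<in>words B m. reading \<phi> L (i, \<omega>) = a} = m ^ (B - 1)"
  using card_words_constrained[of "{()}" "\<lambda>_. i div L" B "\<lambda>_ x. \<phi> (i + x)" m "\<lambda>_. a"]
    cyclic_order_shift_bij[OF c, of i] a i
  by (simp add: reading_def less_mult_imp_div_less)

text \<open>The present time and the times \<open>p n\<close> lie in different blocks, so a complete
  pattern fixes \<open>Suc (card I)\<close> distinct letters. The count depends neither on the order
  nor on \<open>\<kappa>\<close> nor on the times, which is what makes two different systems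
  comparable.\<close>

lemma card_pattern_fibre:
  assumes c: "cyclic_order m \<phi>" and \<kappa>: "bij_betw \<kappa> {..<m} {..<m}" and I: "finite I"
    and L: "0 < L" and g: "gapped I p L P" and i: "i < B * L" and a: "a < m"
    and o: "if i + P < B * L then \<exists>h\<in>I \<rightarrow>\<^sub>E {..<m}. o' = Some h else o' = None"
  shows "card {y\<in>{..<B * L} \<times> words B m. pattern \<phi> L \<kappa> p I P (B * L) y = (i, a, o')} =
    m ^ (B - (if i + P < B * L then Suc (card I) else 1))"
proof (cases "i + P < B * L")
  case False
  then have "{y\<in>{..<B * L} \<times> words B m. pattern \<phi> L \<kappa> p I P (B * L) y = (i, a, o')} =
      {i} \<times> {\<omega>\<in>words B m. reading \<phi> L (i, \<omega>) = a}"
    using o i by (auto simp: pattern_def)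
  then show ?thesis
    using card_reading_fibre[OF c L i a] False by (simp add: card_cartesian_product_singleton)
next
  case True
  then obtain h where h: "h \<in> I \<rightarrow>\<^sub>E {..<m}" "o' = Some h" using o by auto
  \<comment> \<open>\<open>None\<close> indexes the present time, \<open>Some n\<close> the time
    \<open>p n\<close>.\<close>
  define K where "K = insert None (Some ` I)"
  define s where "s k = (case k of None \<Rightarrow> i | Some n \<Rightarrow> i + p n)" for k
  define \<beta> where "\<beta> k = (case k of None \<Rightarrow> (\<lambda>x. \<phi> (i + x)) | Some n \<Rightarrow> (\<lambda>x. \<kappa> (\<phi> (i + p n + x))))" for k
  define t where "t k = (case k of None \<Rightarrow> a | Some n \<Rightarrow> h n)" for k
  have "{y\<in>{..<B * L} \<times> words B m. pattern \<phi> L \<kappa> p I P (B * L) y = (i, a, o')} =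
      {i} \<times> {\<omega>\<in>words B m. \<forall>k\<in>K. \<beta> k (\<omega> (s k div L)) = t k}"
  proof -
    have "(\<lambda>n\<in>I. u n) = h \<longleftrightarrow> (\<forall>n\<in>I. u n = h n)" for u
      using h(1) by (auto simp: fun_eq_iff PiE_iff extensional_def)
    then show ?thesis
      using i True h(2) by (auto simp: pattern_def reading_def K_def s_def \<beta>_def t_def)
  qed
  moreover have "card {\<omega>\<in>words B m. \<forall>k\<in>K. \<beta> k (\<omega> (s k div L)) = t k} = m ^ (B - card K)"
  proof (rule card_words_constrained)
    show "finite K" using I by (simp add: K_def)
    show "(\<lambda>k. s k div L) ` K \<subseteq> {..<B}"
    proof
      fix b assume "b \<in> (\<lambda>k. s k div L) ` K"
      then obtain k where k: "k \<in> K" "b = s k div L" by auto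
      have "s k < B * L"
        using k(1) True g by (force simp: K_def s_def gapped_def)
      then show "b \<in> {..<B}" using k by (simp add: less_mult_imp_div_less)
    qed
    show "inj_on (\<lambda>k. s k div L) K"
    proof -
      have 1: "s None div L < s (Some n) div L" if "n \<in> I" for n
        using that g L by (intro div_less_div) (auto simp: s_def gapped_def)
      have 2: "s (Some n) div L < s (Some n') div L" if "n \<in> I" "n' \<in> I" "n < n'" for n n'
      proof (rule div_less_div[OF _ L])
        have "p n + L \<le> p n'" using that g by (simp add: gapped_def)
        then show "s (Some n) + L \<le> s (Some n')" by (simp add: s_def)
      qed
      show ?thesis
      proof (rule inj_onI)
        fix k k' assume k: "k \<in> K" "k' \<in> K" and e: "s k div L = s k' div L"
        show "k = k'"
        proof (cases k; cases k')
          fix n assume kk: "k = None" "k' = Some n"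
          then have "n \<in> I" using k by (auto simp: K_def)
          then show ?thesis using 1[of n] e kk by simp
        next
          fix n assume kk: "k = Some n" "k' = None"
          then have "n \<in> I" using k by (auto simp: K_def)
          then show ?thesis using 1[of n] e kk by simp
        next
          fix n n' assume kk: "k = Some n" "k' = Some n'"
          then have "n \<in> I" "n' \<in> I" using k by (auto simp: K_def)
          then show ?thesis using 2[of n n'] 2[of n' n] e kk by (cases n n' rule: linorder_cases) auto
        qed simp
      qed
    qed
    show "bij_betw (\<beta> k) {..<m} {..<m}" if "k \<in> K" for k
    proof (cases k)
      case None
      then show ?thesis using cyclic_order_shift_bij[OF c] by (simp add: \<beta>_def)
    next
      case (Some n)
      have "\<beta> k = \<kappa> \<circ> (\<lambda>x. \<phi> (i + p n + x))" by (auto simp: \<beta>_def Some fun_eq_iff)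
      then show ?thesis using bij_betw_trans[OF cyclic_order_shift_bij[OF c] \<kappa>] by simp
    qed
    show "t k < m" if "k \<in> K" for k
      using that a h(1) by (auto simp: K_def t_def PiE_iff)
  qed
  moreover have "card K = Suc (card I)" using I by (simp add: K_def card_image)
  ultimately show ?thesis using True by (simp add: card_cartesian_product_singleton)
qed

text \<open>Both systems have the same admissible patterns, described by \<open>valid\<close>, with
  fibres of the same size; other patterns do not occur. The permutation \<open>\<kappa>\<close> is
  charged to the first system only.\<close>

lemma bij_betw_same_pattern:
  assumes c: "cyclic_order m \<phi>" "cyclic_order m \<psi>" and \<kappa>: "bij_betw \<kappa> {..<m} {..<m}" and I: "finite I"
    and L: "0 < L" and g: "gapped I p L P" "gapped I q L P"
  shows "\<exists>h. bij_betw h ({..<B * L} \<times> words B m) ({..<B * L} \<times> words B m) \<and>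
    (\<forall>y\<in>{..<B * L} \<times> words B m. pattern \<psi> L id q I P (B * L) (h y) = pattern \<phi> L \<kappa> p I P (B * L) y)"
proof (rule bij_betw_matching_fibres)
  define Y where "Y = {..<B * L} \<times> words B m"
  define valid where "valid v \<longleftrightarrow> (case v of (i, a, o') \<Rightarrow> i < B * L \<and> a < m \<and>
    (if i + P < B * L then \<exists>h\<in>I \<rightarrow>\<^sub>E {..<m}. o' = Some h else o' = None))" for v
  have v: "valid (pattern \<tau> L \<eta> r I P (B * L) y)"
    if "cyclic_order m \<tau>" "bij_betw \<eta> {..<m} {..<m}" "y \<in> Y" for \<tau> \<eta> r y
  proof -
    have "\<eta> (\<tau> x) < m" for x
      using bij_betw_apply[OF that(2), of "\<tau> x"] cyclic_order_less[OF that(1), of x] by simp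
    then show ?thesis
      using that(3) cyclic_order_less[OF that(1)]
      by (auto simp: valid_def pattern_def Y_def reading_def)
  qed
  fix w
  show "card {y\<in>{..<B * L} \<times> words B m. pattern \<phi> L \<kappa> p I P (B * L) y = w} =
      card {y\<in>{..<B * L} \<times> words B m. pattern \<psi> L id q I P (B * L) y = w}"
  proof (cases "valid w")
    case True
    obtain i a o' where w: "w = (i, a, o')" by (cases w)
    show ?thesis
      using True card_pattern_fibre[OF c(1) \<kappa> I L g(1), of i B a o']
        card_pattern_fibre[OF c(2) bij_betw_id I L g(2), of i B a o']
      by (simp add: valid_def w)
  next
    case False
    then have "{y\<in>Y. pattern \<phi> L \<kappa> p I P (B * L) y = w} = {}" "{y\<in>Y. pattern \<psi> L id q I P (B * L) y = w} = {}"
      using v[OF c(1) \<kappa>] v[OF c(2) bij_betw_id] by blast+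
    then show ?thesis by (simp only: Y_def)
  qed
qed auto

text \<open>Each cell is read at \<open>m ^ (B - 1) * (B * L)\<close> positions, as many as it has
  children, so the positions can be numbered within the children of the cell being read.\<close>

lemma labelling_exists:
  assumes c: "cyclic_order m \<phi>" and L: "0 < L" and B: "0 < B"
  shows "\<exists>\<theta>. bij_betw \<theta> ({..<B * L} \<times> words B m) {..<m ^ B * (B * L)} \<and>
    (\<forall>y\<in>{..<B * L} \<times> words B m. \<theta> y div (m ^ (B - 1) * (B * L)) = reading \<phi> L y)"
proof (rule bij_betw_matching_fibres)
  fix a
  define r where "r = m ^ (B - 1) * (B * L)"
  have m: "m > 0" using c by (simp add: cyclic_order_def)
  have "m ^ B = m * m ^ (B - 1)" using B by (cases B) auto
  then have r: "r > 0" "m ^ B * (B * L) = m * r"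
    using m B L by (simp_all add: r_def)
  have "{y\<in>{..<B * L} \<times> words B m. reading \<phi> L y = a} =
      Sigma {..<B * L} (\<lambda>i. {\<omega>\<in>words B m. reading \<phi> L (i, \<omega>) = a})" by auto
  moreover have "card {\<omega>\<in>words B m. reading \<phi> L (i, \<omega>) = a} = (if a < m then m ^ (B - 1) else 0)"
    if "i < B * L" for i
  proof (cases "a < m")
    case False
    then have "{\<omega>\<in>words B m. reading \<phi> L (i, \<omega>) = a} = {}"
      using cyclic_order_less[OF c] by (auto simp: reading_def)
    then show ?thesis using False by (simp only: card.empty if_False)
  qed (simp add: card_reading_fibre[OF c L that])
  ultimately have 1: "card {y\<in>{..<B * L} \<times> words B m. reading \<phi> L y = a} = (if a < m then r else 0)"
    by (simp add: r_def)
  have 2: "{k\<in>{..<m * r}. k div r = a} = (if a < m then {a * r..<Suc a * r} else {})"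
  proof (cases "a < m")
    case True
    then have "Suc a * r \<le> m * r" by (intro mult_le_mono1) simp
    then show ?thesis using True r(1)
      by (auto simp: div_nat_eqI mult.commute less_mult_imp_div_less dest: dividend_less_times_div intro: order.strict_trans2 div_times_less_eq_dividend)
  next
    case False
    then show ?thesis using r(1) by (auto simp: less_mult_imp_div_less not_less dest: leD)
  qed
  show "card {y\<in>{..<B * L} \<times> words B m. reading \<phi> L y = a} =
      card {k\<in>{..<m ^ B * (B * L)}. k div (m ^ (B - 1) * (B * L)) = a}"
    unfolding 1 r(2) r_def[symmetric] 2 by simp
qed auto

text \<open>The new cycle runs through the words one after another, each at times \<open>0\<close>
  to \<open>B * L - 1\<close>. The cell read follows the old cycle except possibly at the ends of
  blocks, one position in \<open>L\<close>; transitions between words are among them.\<close>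

lemma order_of_labelling:
  assumes c: "cyclic_order m \<phi>" and L: "0 < L" and B: "0 < B"
    and \<theta>: "bij_betw \<theta> ({..<B * L} \<times> words B m) {..<m ^ B * (B * L)}"
    and read: "\<And>y. y \<in> {..<B * L} \<times> words B m \<Longrightarrow> \<theta> y div (m ^ (B - 1) * (B * L)) = reading \<phi> L y"
  shows "\<exists>\<phi>'. cyclic_order (m ^ B * (B * L)) \<phi>' \<and>
    (\<forall>i \<omega> n. i + n < B * L \<longrightarrow> \<omega> \<in> words B m \<longrightarrow>
       (next_in (m ^ B * (B * L)) \<phi>' ^^ n) (\<theta> (i, \<omega>)) = \<theta> (i + n, \<omega>)) \<and>
    card {k\<in>{..<m ^ B * (B * L)}. next_in (m ^ B * (B * L)) \<phi>' k div (m ^ (B - 1) * (B * L)) \<noteq>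
      next_in m \<phi> (k div (m ^ (B - 1) * (B * L)))} * L \<le> m ^ B * (B * L)"
proof -
  define X where "X = B * L"
  define N where "N = m ^ B * X"
  define r where "r = m ^ (B - 1) * X"
  have m: "m > 0" using c by (simp add: cyclic_order_def)
  have X: "X > 0" using B L by (simp add: X_def)
  have N: "N > 0" using m X by (simp add: N_def)
  obtain e where e: "bij_betw e {..<m ^ B} (words B m)"
    using finite_same_card_bij[of "{..<m ^ B}" "words B m"] by (auto simp: card_words)
  \<comment> \<open>\<open>e\<close> numbers the words; quotient and remainder by \<open>X\<close>
    give word and time.\<close>
  define J where "J j = (j mod X, e (j div X))" for j
  have divN: "j div X < m ^ B" if "j < N" for j using that by (simp add: N_def less_mult_imp_div_less)
  have J: "bij_betw J {..<N} ({..<X} \<times> words B m)"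
  proof (rule bij_betwI')
    fix i j assume "i \<in> {..<N}" "j \<in> {..<N}"
    then have "i div X < m ^ B" "j div X < m ^ B" using divN by auto
    then have "e (i div X) = e (j div X) \<longleftrightarrow> i div X = j div X"
      using e by (auto simp: bij_betw_def inj_on_def)
    then show "(J i = J j) = (i = j)"
      unfolding J_def prod.inject by (metis div_mult_mod_eq)
  next
    fix j assume "j \<in> {..<N}"
    then show "J j \<in> {..<X} \<times> words B m"
      using divN[of j] bij_betw_apply[OF e, of "j div X"] X by (auto simp: J_def)
  next
    fix y assume "y \<in> {..<X} \<times> words B m"
    then obtain i \<omega> where i: "i < X" "y = (i, \<omega>)" "\<omega> \<in> words B m" by auto
    then obtain d where "d < m ^ B" "\<omega> = e d" using e unfolding bij_betw_def by (metis imageE lessThan_iff)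
    with i have y: "i < X" "y = (i, e d)" "d < m ^ B" by simp_all
    have "d * X + i < N"
    proof -
      have "d * X + i < Suc d * X" using y by simp
      also have "\<dots> \<le> m ^ B * X" using y by (intro mult_le_mono1) simp
      finally show ?thesis by (simp add: N_def)
    qed
    moreover have "y = J (d * X + i)" using y by (simp add: J_def)
    ultimately show "\<exists>j\<in>{..<N}. y = J j" by auto
  qed
  \<comment> \<open>There is no carry into the word index as long as the time stays below
    \<open>X\<close>.\<close>
  have Jplus: "J (j + n) = (j mod X + n, e (j div X)) \<and> j + n < N" if "j < N" "j mod X + n < X" for j n
  proof -
    have j: "j + n = (j div X) * X + (j mod X + n)" by simp
    have a: "((j div X) * X + (j mod X + n)) mod X = j mod X + n" "((j div X) * X + (j mod X + n)) div X = j div X"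
    proof -
      have "(d * X + t) mod X = t \<and> (d * X + t) div X = d" if "t < X" for d t using that by simp
      from this[OF that(2), of "j div X"]
      show "((j div X) * X + (j mod X + n)) mod X = j mod X + n" "((j div X) * X + (j mod X + n)) div X = j div X"
        by blast+
    qed
    have "(j div X) * X + (j mod X + n) < (j div X) * X + X" using that(2) by (rule add_strict_left_mono)
    also have "\<dots> = Suc (j div X) * X" by simp
    also have "\<dots> \<le> m ^ B * X" using divN[OF that(1)] by (intro mult_le_mono1) simp
    finally have "j + n < N" unfolding j[symmetric] N_def .
    then show ?thesis using a unfolding J_def j[symmetric] by (simp only: simp_thms)
  qed
  define \<phi>' where "\<phi>' j = \<theta> (J (j mod N))" for j
  have "bij_betw (\<theta> \<circ> J) {..<N} {..<N}"
    using bij_betw_trans[OF J] \<theta> by (simp add: X_def N_def)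
  then have "bij_betw \<phi>' {..<N} {..<N}"
    by (subst bij_betw_cong[of _ _ "\<theta> \<circ> J"]) (simp_all add: \<phi>'_def)
  then have c': "cyclic_order N \<phi>'" using N by (simp add: cyclic_order_def \<phi>'_def)
  have run: "(next_in N \<phi>' ^^ n) (\<theta> (i, \<omega>)) = \<theta> (i + n, \<omega>)"
    if "i + n < X" "\<omega> \<in> words B m" for i \<omega> n
  proof -
    have "(i, \<omega>) \<in> {..<X} \<times> words B m" using that by auto
    then obtain j where j: "j < N" "J j = (i, \<omega>)" using J unfolding bij_betw_def by (metis imageE lessThan_iff)
    then have ji: "j mod X = i" "e (j div X) = \<omega>" by (auto simp: J_def)
    have "(next_in N \<phi>' ^^ n) (\<phi>' j) = \<phi>' (j + n)" by (rule next_in_pow[OF c'])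
    then show ?thesis using j ji Jplus[of j n] that by (simp add: \<phi>'_def)
  qed
  \<comment> \<open>A mismatch needs a block boundary between \<open>j\<close> and
    \<open>Suc j\<close>; as \<open>X\<close> is a multiple of \<open>L\<close>, divisibility of
    \<open>Suc j\<close> detects the boundaries in all words.\<close>
  have "{k\<in>{..<N}. next_in N \<phi>' k div r \<noteq> next_in m \<phi> (k div r)} \<subseteq> \<phi>' ` {j\<in>{..<N}. L dvd Suc j}"
  proof
    fix k assume k: "k \<in> {k\<in>{..<N}. next_in N \<phi>' k div r \<noteq> next_in m \<phi> (k div r)}"
    then obtain j where j: "j < N" "\<phi>' j = k" using cyclic_order_surj[OF c', of k] by auto
    have "L dvd Suc j"
    proof (rule ccontr)
      assume nd: "\<not> L dvd Suc j"
      define i where "i = j mod X"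
      define \<omega> where "\<omega> = e (j div X)"
      have Sj: "Suc j = (j div X) * X + Suc i" by (simp add: i_def)
      have "L dvd (j div X) * X" by (simp add: X_def)
      then have ndi: "\<not> L dvd Suc i" using nd Sj by (metis dvd_add)
      have "i < X" using X by (simp add: i_def)
      moreover have "Suc i \<noteq> X" using ndi by (auto simp: X_def)
      ultimately have iX: "i + 1 < X" by simp
      have \<omega>: "\<omega> \<in> words B m" using bij_betw_apply[OF e, of "j div X"] divN[OF j(1)] by (simp add: \<omega>_def)
      have kj: "k = \<theta> (i, \<omega>)" using j by (auto simp: \<phi>'_def J_def i_def \<omega>_def)
      have "next_in N \<phi>' k = \<theta> (i + 1, \<omega>)" using run[OF iX \<omega>] kj by simp
      then have "next_in N \<phi>' k div r = reading \<phi> L (i + 1, \<omega>)"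
        using read[of "(i + 1, \<omega>)"] iX \<omega> by (simp add: r_def X_def)
      also have "\<dots> = next_in m \<phi> (reading \<phi> L (i, \<omega>))"
        using ndi by (simp add: reading_def next_in_order[OF c] div_Suc mod_eq_0_iff_dvd)
      also have "reading \<phi> L (i, \<omega>) = k div r"
        using read[of "(i, \<omega>)"] iX \<omega> kj by (simp add: r_def X_def)
      finally show False using k by simp
    qed
    then show "k \<in> \<phi>' ` {j\<in>{..<N}. L dvd Suc j}" using j by auto
  qed
  then have "card {k\<in>{..<N}. next_in N \<phi>' k div r \<noteq> next_in m \<phi> (k div r)} \<le> card {j\<in>{..<N}. L dvd Suc j}"
    by (rule surj_card_le[rotated]) simp
  also have "\<dots> \<le> card {1..N div L}"
  proof (rule card_inj_on_le[where f = "\<lambda>j. Suc j div L"])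
    show "inj_on (\<lambda>j. Suc j div L) {j\<in>{..<N}. L dvd Suc j}"
      using L by (auto simp: inj_on_def elim!: dvdE)
    show "(\<lambda>j. Suc j div L) ` {j\<in>{..<N}. L dvd Suc j} \<subseteq> {1..N div L}"
    proof
      fix b assume "b \<in> (\<lambda>j. Suc j div L) ` {j\<in>{..<N}. L dvd Suc j}"
      then obtain j where j: "j < N" "L dvd Suc j" "b = Suc j div L" by auto
      then have "L * b = Suc j" by simp
      then have "b > 0" by (cases b) auto
      then show "b \<in> {1..N div L}"
        using j div_le_mono[of "Suc j" N L] by simp
    qed
  qed simp
  also have "\<dots> = N div L" by simp
  finally have "card {k\<in>{..<N}. next_in N \<phi>' k div r \<noteq> next_in m \<phi> (k div r)} * L \<le> N div L * L"
    by (rule mult_le_mono1)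
  also have "\<dots> \<le> N" by simp
  finally show ?thesis
    using c' run unfolding X_def N_def r_def by (intro exI[of _ \<phi>']) blast
qed

text \<open>The labelling for \<open>\<psi>\<close> is that for \<open>\<phi>\<close> transported
  along the pattern-preserving bijection. A new cell then names one position in either system, with
  the same time, the same present cell and, away from the ends of words, futures related by
  \<open>\<kappa>\<close>.\<close>

lemma refinement_step:
  assumes c: "cyclic_order m \<phi>" "cyclic_order m \<psi>" and \<kappa>: "bij_betw \<kappa> {..<m} {..<m}" and I: "finite I"
    and L: "0 < L" "1 / real L \<le> \<delta>" and g: "gapped I p L P" "gapped I q L P"
  shows "\<exists>r \<phi>' \<psi>'. 2 \<le> r \<and> cyclic_order (m * r) \<phi>' \<and> cyclic_order (m * r) \<psi>' \<and>
    real (card {k\<in>{..<m * r}. next_in (m * r) \<phi>' k div r \<noteq> next_in m \<phi> (k div r)}) \<le> \<delta> * real (m * r) \<and>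
    real (card {k\<in>{..<m * r}. next_in (m * r) \<psi>' k div r \<noteq> next_in m \<psi> (k div r)}) \<le> \<delta> * real (m * r) \<and>
    real (card {k\<in>{..<m * r}. \<exists>n\<in>I. (next_in (m * r) \<psi>' ^^ q n) k div r \<noteq>
      \<kappa> ((next_in (m * r) \<phi>' ^^ p n) k div r)}) \<le> \<delta> * real (m * r)"
proof -
  have \<delta>: "\<delta> > 0" using L by (smt (verit) divide_pos_pos of_nat_0_less_iff)
  \<comment> \<open>Words so long that the last \<open>P\<close> times form at most a fraction
    \<open>\<delta>\<close>; the summand 2 gives \<open>B \<ge> 2\<close> and hence
    \<open>2 \<le> r\<close>.\<close>
  define B where "B = nat \<lceil>real P / \<delta>\<rceil> + 2"
  have B: "0 < B" "2 \<le> B" "real P \<le> \<delta> * real B"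
  proof -
    have "real P / \<delta> \<le> real B" unfolding B_def by linarith
    then show "real P \<le> \<delta> * real B" using \<delta> by (simp add: field_simps)
  qed (simp_all add: B_def)
  define X where "X = B * L"
  define N where "N = m ^ B * X"
  define r where "r = m ^ (B - 1) * X"
  define Y where "Y = {..<X} \<times> words B m"
  have m: "m > 0" using c by (simp add: cyclic_order_def)
  have X: "X > 0" using B L by (simp add: X_def)
  have "m ^ B = m * m ^ (B - 1)" using B by (cases B) auto
  then have N: "N = m * r" by (simp add: N_def r_def)
  have "B * 1 \<le> B * L" using L by (intro mult_le_mono2) simp
  then have BX: "B \<le> X" by (simp add: X_def)
  have r2: "2 \<le> r"
  proof -
    have "1 * B \<le> m ^ (B - 1) * X" using m BX by (intro mult_le_mono) simp_all
    then show ?thesis using B by (simp add: r_def)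
  qed
  obtain \<theta> where \<theta>: "bij_betw \<theta> Y {..<N}" and \<theta>r: "\<And>y. y \<in> Y \<Longrightarrow> \<theta> y div r = reading \<phi> L y"
    using labelling_exists[OF c(1) L(1) B(1)] unfolding Y_def N_def r_def X_def by blast
  obtain h where h: "bij_betw h Y Y"
    and hp: "\<And>y. y \<in> Y \<Longrightarrow> pattern \<psi> L id q I P X (h y) = pattern \<phi> L \<kappa> p I P X y"
    using bij_betw_same_pattern[OF c \<kappa> I L(1) g] unfolding Y_def X_def by blast
  define \<theta>2 where "\<theta>2 y = \<theta> (inv_into Y h y)" for y
  have hi: "bij_betw (inv_into Y h) Y Y" by (rule bij_betw_inv_into[OF h])
  have "bij_betw (\<theta> \<circ> inv_into Y h) Y {..<N}" by (rule bij_betw_trans[OF hi \<theta>])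
  then have \<theta>2: "bij_betw \<theta>2 Y {..<N}" by (simp add: \<theta>2_def[abs_def] comp_def)
  have \<theta>2h: "\<theta>2 (h y) = \<theta> y" if "y \<in> Y" for y
    using h that by (simp add: \<theta>2_def bij_betw_inv_into_left)
  \<comment> \<open>The transported label still lies in the right old cell because the pattern
    contains the present reading.\<close>
  have \<theta>2r: "\<theta>2 y div r = reading \<psi> L y" if y: "y \<in> Y" for y
  proof -
    define z where "z = inv_into Y h y"
    have z: "z \<in> Y" "h z = y"
      using bij_betw_apply[OF hi y] h y by (simp_all add: z_def bij_betw_inv_into_right)
    then show ?thesis using hp[OF z(1)] \<theta>r[OF z(1)] by (simp add: \<theta>2_def z_def pattern_def)
  qed
  obtain \<phi>' where \<phi>': "cyclic_order N \<phi>'"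
    and \<phi>run: "\<And>i \<omega> n. i + n < X \<Longrightarrow> \<omega> \<in> words B m \<Longrightarrow> (next_in N \<phi>' ^^ n) (\<theta> (i, \<omega>)) = \<theta> (i + n, \<omega>)"
    and \<phi>card: "card {k\<in>{..<N}. next_in N \<phi>' k div r \<noteq> next_in m \<phi> (k div r)} * L \<le> N"
    using order_of_labelling[OF c(1) L(1) B(1) \<theta>[unfolded Y_def N_def X_def] \<theta>r[unfolded Y_def r_def X_def]]
    unfolding N_def r_def X_def by blast
  obtain \<psi>' where \<psi>': "cyclic_order N \<psi>'"
    and \<psi>run: "\<And>i \<omega> n. i + n < X \<Longrightarrow> \<omega> \<in> words B m \<Longrightarrow> (next_in N \<psi>' ^^ n) (\<theta>2 (i, \<omega>)) = \<theta>2 (i + n, \<omega>)"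
    and \<psi>card: "card {k\<in>{..<N}. next_in N \<psi>' k div r \<noteq> next_in m \<psi> (k div r)} * L \<le> N"
    using order_of_labelling[OF c(2) L(1) B(1) \<theta>2[unfolded Y_def N_def X_def] \<theta>2r[unfolded Y_def r_def X_def]]
    unfolding N_def r_def X_def by blast
  have small: "real a \<le> \<delta> * real N" if "a * L \<le> N" for a
  proof -
    have "real a * real L \<le> real N" using that by (metis of_nat_le_iff of_nat_mult)
    then have "real a \<le> (1 / real L) * real N" using L by (simp add: field_simps)
    also have "\<dots> \<le> \<delta> * real N" using L by (intro mult_right_mono) auto
    finally show ?thesis .
  qed
  define bad where "bad = {k\<in>{..<N}. \<exists>n\<in>I. (next_in N \<psi>' ^^ q n) k div r \<noteq> \<kappa> ((next_in N \<phi>' ^^ p n) k div r)}"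
  \<comment> \<open>Before the last \<open>P\<close> times the pattern is complete, and equality of
    patterns is the desired relation at all \<open>n\<close> in \<open>I\<close>.\<close>
  have "bad \<subseteq> \<theta> ` ({X - P..<X} \<times> words B m)"
  proof
    fix k assume k: "k \<in> bad"
    then have "k \<in> \<theta> ` Y" using \<theta> by (auto simp: bad_def bij_betw_def)
    then obtain i \<omega> where y: "(i, \<omega>) \<in> Y" "k = \<theta> (i, \<omega>)" by auto
    have "\<not> i + P < X"
    proof
      assume iP: "i + P < X"
      obtain i' \<omega>' where hy: "h (i, \<omega>) = (i', \<omega>')" by fastforce
      have pe: "pattern \<psi> L id q I P X (i', \<omega>') = pattern \<phi> L \<kappa> p I P X (i, \<omega>)"
        using hp[OF y(1)] hy by simp
      then have i': "i' = i" by (simp add: pattern_def)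
      have "(i', \<omega>') \<in> Y" using bij_betw_apply[OF h y(1)] hy by simp
      then have w: "\<omega> \<in> words B m" "\<omega>' \<in> words B m" using y(1) by (auto simp: Y_def)
      have "(next_in N \<psi>' ^^ q n) k div r = \<kappa> ((next_in N \<phi>' ^^ p n) k div r)" if n: "n \<in> I" for n
      proof -
        have b: "i + p n < X" "i + q n < X" using iP n g by (force simp: gapped_def)+
        have k2: "k = \<theta>2 (i, \<omega>')" using \<theta>2h[OF y(1)] hy y(2) i' by simp
        have "(\<lambda>n\<in>I. id (reading \<psi> L (i + q n, \<omega>'))) = (\<lambda>n\<in>I. \<kappa> (reading \<phi> L (i + p n, \<omega>)))"
          using pe iP by (simp add: pattern_def i')
        from fun_cong[OF this, of n] have "reading \<psi> L (i + q n, \<omega>') = \<kappa> (reading \<phi> L (i + p n, \<omega>))"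
          using n by simp
        moreover have "(next_in N \<psi>' ^^ q n) k div r = reading \<psi> L (i + q n, \<omega>')"
          using \<psi>run[OF b(2) w(2)] \<theta>2r[of "(i + q n, \<omega>')"] b w by (simp add: k2 Y_def)
        moreover have "(next_in N \<phi>' ^^ p n) k div r = reading \<phi> L (i + p n, \<omega>)"
          using \<phi>run[OF b(1) w(1)] \<theta>r[of "(i + p n, \<omega>)"] b w by (simp add: y(2) Y_def)
        ultimately show ?thesis by simp
      qed
      then show False using k by (auto simp: bad_def)
    qed
    then show "k \<in> \<theta> ` ({X - P..<X} \<times> words B m)"
      using y by (intro image_eqI[of _ _ "(i, \<omega>)"]) (auto simp: Y_def)
  qed
  then have "card bad \<le> card ({X - P..<X} \<times> words B m)"
    by (rule surj_card_le[rotated]) simp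
  also have "\<dots> = (X - (X - P)) * m ^ B" by (simp add: card_cartesian_product card_words)
  also have "\<dots> \<le> P * m ^ B" by (rule mult_le_mono1) arith
  finally have "real (card bad) \<le> real P * real m ^ B" by (metis of_nat_le_iff of_nat_mult of_nat_power)
  also have "\<dots> \<le> (\<delta> * real X) * real m ^ B"
  proof (rule mult_right_mono)
    have "\<delta> * real B \<le> \<delta> * real X" using BX \<delta> by simp
    then show "real P \<le> \<delta> * real X" using B(3) by simp
  qed simp
  also have "\<dots> = \<delta> * real N" by (simp add: N_def)
  finally have "real (card bad) \<le> \<delta> * real N" .
  then show ?thesis
    using r2 \<phi>' \<psi>' small[OF \<phi>card] small[OF \<psi>card] unfolding N bad_def
    by (intro exI[of _ r] exI[of _ \<phi>'] exI[of _ \<psi>'] conjI)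
qed

section \<open>Correlations along the two sequences\<close>

definition swap_halves :: "nat \<Rightarrow> nat \<Rightarrow> nat" where
  "swap_halves m k = (if k < m div 2 then k + m div 2 else k - m div 2)"

lemma swap_halves_bij: assumes "even m" shows "bij_betw (swap_halves m) {..<m} {..<m}"
proof -
  obtain h where h: "m = 2 * h" using assms by (rule evenE)
  show ?thesis unfolding h
    by (rule bij_betw_byWitness[where f' = "swap_halves (2 * h)"]) (auto simp: swap_halves_def)
qed

lemma swap_halves_less_iff:
  assumes "even m" "k < m" shows "swap_halves m k < m div 2 \<longleftrightarrow> \<not> k < m div 2"
proof -
  obtain h where h: "m = 2 * h" using assms(1) by (rule evenE)
  then show ?thesis using assms(2) by (auto simp: swap_halves_def)
qed

text \<open>For even \<open>m\<close> the midpoint is an endpoint of old cells, so a new cell lies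
  in the left half exactly when its parent does.\<close>

lemma half_refined:
  fixes m r k :: nat
  assumes "even m" "0 < r"
  shows "k < (m * r) div 2 \<longleftrightarrow> k div r < m div 2"
proof -
  obtain h where h: "m = 2 * h" using assms(1) by (rule evenE)
  have "(m * r) div 2 = h * r" by (simp add: h)
  then show ?thesis using assms(2) by (simp add: h div_less_iff_less_mult)
qed

text \<open>The finite counterpart of the intersection whose measure is averaged, with the left half
  as \<open>C\<close>; the first order belongs to \<open>S\<close>, the second to
  \<open>T\<close>.\<close>

definition both_low :: "nat \<Rightarrow> (nat \<Rightarrow> nat) \<Rightarrow> (nat \<Rightarrow> nat) \<Rightarrow> nat \<Rightarrow> nat \<Rightarrow> nat set" where
  "both_low m \<phi> \<psi> u v =
     {k\<in>{..<m}. (next_in m \<phi> ^^ u) k < m div 2 \<and> (next_in m \<psi> ^^ v) k < m div 2}"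

lemma next_in_pow_bij:
  assumes "cyclic_order m \<phi>" shows "bij_betw (next_in m \<phi> ^^ n) {..<m} {..<m}"
proof (induction n)
  case (Suc n)
  show ?case unfolding funpow.simps(2) by (rule bij_betw_trans[OF Suc next_in_bij[OF assms]])
qed (simp add: bij_betw_def)

text \<open>Beyond some index the increments are at least \<open>L\<close>, and at least 1, so the
  values themselves eventually pass \<open>L\<close> as well.\<close>

lemma eventually_gapped:
  fixes p :: "nat \<Rightarrow> int"
  assumes "filterlim (\<lambda>n. p (n + 1) - p n) at_top sequentially"
  shows "\<forall>\<^sub>F a in sequentially. \<forall>n\<ge>a. int L \<le> p n \<and> (\<forall>n'>n. p n + int L \<le> p n')"
proof -
  have "\<forall>\<^sub>F n in sequentially. p (n + 1) - p n \<ge> max 1 (int L)"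
    by (rule spec[OF filterlim_at_top[THEN iffD1, OF assms]])
  then obtain n0 where n0: "\<And>n. n \<ge> n0 \<Longrightarrow> p (n + 1) - p n \<ge> max 1 (int L)"
    by (auto simp: eventually_sequentially)
  have grow: "p n0 + int i \<le> p (n0 + i)" for i
  proof (induction i)
    case (Suc i)
    then show ?case using n0[of "n0 + i"] by simp
  qed simp
  have gap: "p n + int L \<le> p (n + Suc i)" if "n \<ge> n0" for n i
  proof (induction i)
    case 0
    then show ?case using n0[OF that] by simp
  next
    case (Suc i)
    then show ?case using n0[of "n + Suc i"] that by simp
  qed
  \<comment> \<open>Increments of at least 1 from \<open>p n0\<close> on reach the level
    \<open>L\<close> after at most this many further indices.\<close>
  define a0 where "a0 = n0 + nat (int L - p n0)"
  have "int L \<le> p n" if "n \<ge> a0" for n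
    using grow[of "n - n0"] that by (simp add: a0_def)
  moreover have "p n + int L \<le> p n'" if "n \<ge> a0" "n < n'" for n n'
    using gap[of n "n' - n - 1"] that by (simp add: a0_def)
  ultimately show ?thesis
    unfolding eventually_sequentially by (intro exI[of _ a0]) (meson order.trans)
qed

text \<open>\<open>b\<close> selects the aim: nearly equal future cells, with correlation about
  \<open>1/2\<close>, or opposite halves, with correlation about \<open>0\<close>. The bound
  \<open>j \<le> N\<close> is there to send the windows to infinity over the stages.\<close>

lemma correlation_step:
  fixes p q :: "nat \<Rightarrow> int"
  assumes p: "filterlim (\<lambda>n. p (n + 1) - p n) at_top sequentially"
    and q: "filterlim (\<lambda>n. q (n + 1) - q n) at_top sequentially"
    and c: "cyclic_order m \<phi>" "cyclic_order m \<psi>" and m: "even m" and \<delta>: "0 < \<delta>"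
  shows "\<exists>r \<phi>' \<psi>' a N P. 2 \<le> r \<and> cyclic_order (m * r) \<phi>' \<and> cyclic_order (m * r) \<psi>' \<and>
    real (card {k\<in>{..<m * r}. next_in (m * r) \<phi>' k div r \<noteq> next_in m \<phi> (k div r)}) \<le> \<delta> * real (m * r) \<and>
    real (card {k\<in>{..<m * r}. next_in (m * r) \<psi>' k div r \<noteq> next_in m \<psi> (k div r)}) \<le> \<delta> * real (m * r) \<and>
    j \<le> N \<and> 1 \<le> N \<and> 10 * a \<le> N \<and>
    (\<forall>n\<in>{a..N}. 0 \<le> p n \<and> p n \<le> int P \<and> 0 \<le> q n \<and> q n \<le> int P \<and>
      (if b then (1/2 - \<delta>) * real (m * r) \<le> real (card (both_low (m * r) \<phi>' \<psi>' (nat (p n)) (nat (q n))))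
       else real (card (both_low (m * r) \<phi>' \<psi>' (nat (p n)) (nat (q n)))) \<le> \<delta> * real (m * r)))"
proof -
  define L where "L = nat \<lceil>1 / \<delta>\<rceil> + 1"
  have L: "0 < L" "1 / real L \<le> \<delta>"
  proof -
    have "1 / \<delta> \<le> real L" unfolding L_def by linarith
    then have "1 \<le> \<delta> * real L" using \<delta> by (simp add: pos_divide_le_eq mult.commute)
    moreover have "0 < real L" by (simp add: L_def)
    ultimately show "1 / real L \<le> \<delta>" by (simp add: pos_divide_le_eq)
  qed (simp add: L_def)
  obtain a where a: "\<And>n. n \<ge> a \<Longrightarrow> int L \<le> p n \<and> (\<forall>n'>n. p n + int L \<le> p n')"
    "\<And>n. n \<ge> a \<Longrightarrow> int L \<le> q n \<and> (\<forall>n'>n. q n + int L \<le> q n')"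
  proof -
    obtain a1 a2 where "\<And>n. n \<ge> a1 \<Longrightarrow> \<forall>n'\<ge>n. int L \<le> p n' \<and> (\<forall>n''>n'. p n' + int L \<le> p n'')"
      "\<And>n. n \<ge> a2 \<Longrightarrow> \<forall>n'\<ge>n. int L \<le> q n' \<and> (\<forall>n''>n'. q n' + int L \<le> q n'')"
      using eventually_gapped[OF p, of L] eventually_gapped[OF q, of L]
      unfolding eventually_sequentially by auto
    then show ?thesis by (intro that[of "max a1 a2"]) auto
  qed
  \<comment> \<open>The uncontrolled indices below \<open>a\<close> are at most a tenth of
    \<open>N\<close>.\<close>
  define N where "N = 10 * a + j + 1"
  \<comment> \<open>On the window both sequences increase, so their last values bound all times that
    occur.\<close>
  define P where "P = nat (p N) + nat (q N)"
  have P: "p n \<le> int P \<and> q n \<le> int P" if "n \<in> {a..N}" for n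
  proof -
    have n: "n \<ge> a" "n = N \<or> n < N" using that by auto
    have "p n \<le> p N" "q n \<le> q N" using a(1)[OF n(1)] a(2)[OF n(1)] n(2) by (auto dest!: spec[of _ N])
    then show ?thesis by (simp add: P_def)
  qed
  have g: "gapped {a..N} (\<lambda>n. nat (p n)) L P" "gapped {a..N} (\<lambda>n. nat (q n)) L P"
  proof -
    have "L \<le> nat (p n) \<and> nat (p n) \<le> P \<and> L \<le> nat (q n) \<and> nat (q n) \<le> P" if "n \<in> {a..N}" for n
      using a[of n] P[OF that] that by auto
    moreover have "nat (p n) + L \<le> nat (p n') \<and> nat (q n) + L \<le> nat (q n')"
      if "n \<in> {a..N}" "n < n'" for n n'
    proof -
      have "int L \<le> p n" "p n + int L \<le> p n'" "int L \<le> q n" "q n + int L \<le> q n'"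
        using a[of n] that by auto
      then show ?thesis by linarith
    qed
    ultimately show "gapped {a..N} (\<lambda>n. nat (p n)) L P" "gapped {a..N} (\<lambda>n. nat (q n)) L P"
      unfolding gapped_def by blast+
  qed
  define \<kappa> where "\<kappa> = (if b then id else swap_halves m)"
  have \<kappa>: "bij_betw \<kappa> {..<m} {..<m}" using swap_halves_bij[OF m] by (simp add: \<kappa>_def)
  obtain r \<phi>' \<psi>' where r: "2 \<le> r" and c': "cyclic_order (m * r) \<phi>'" "cyclic_order (m * r) \<psi>'"
    and mis: "real (card {k\<in>{..<m * r}. next_in (m * r) \<phi>' k div r \<noteq> next_in m \<phi> (k div r)}) \<le> \<delta> * real (m * r)"
      "real (card {k\<in>{..<m * r}. next_in (m * r) \<psi>' k div r \<noteq> next_in m \<psi> (k div r)}) \<le> \<delta> * real (m * r)"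
    and bad: "real (card {k\<in>{..<m * r}. \<exists>n\<in>{a..N}. (next_in (m * r) \<psi>' ^^ nat (q n)) k div r \<noteq>
      \<kappa> ((next_in (m * r) \<phi>' ^^ nat (p n)) k div r)}) \<le> \<delta> * real (m * r)"
    using refinement_step[OF c \<kappa> finite_atLeastAtMost L g] by blast
  let ?B = "{k\<in>{..<m * r}. \<exists>n\<in>{a..N}. (next_in (m * r) \<psi>' ^^ nat (q n)) k div r \<noteq>
      \<kappa> ((next_in (m * r) \<phi>' ^^ nat (p n)) k div r)}"
  have r0: "0 < r" using r by simp
  have corr: "if b then (1/2 - \<delta>) * real (m * r) \<le> real (card (both_low (m * r) \<phi>' \<psi>' (nat (p n)) (nat (q n))))
       else real (card (both_low (m * r) \<phi>' \<psi>' (nat (p n)) (nat (q n)))) \<le> \<delta> * real (m * r)"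
    if n: "n \<in> {a..N}" for n
  proof (cases b)
    case True
    \<comment> \<open>Exactly half of the cells have a low image under the \<open>p n\<close>-th
      power. Apart from bad cells, the \<open>q n\<close>-th power of the other permutation leads
      into the same old cell, hence is low too.\<close>
    let ?H = "{k\<in>{..<m * r}. (next_in (m * r) \<phi>' ^^ nat (p n)) k < (m * r) div 2}"
    have "bij_betw (next_in (m * r) \<phi>' ^^ nat (p n)) ?H {..<(m * r) div 2}"
    proof (rule bij_betw_subset[OF next_in_pow_bij[OF c'(1), of "nat (p n)"]])
      let ?f = "next_in (m * r) \<phi>' ^^ nat (p n)"
      have im: "?f ` {..<m * r} = {..<m * r}" using next_in_pow_bij[OF c'(1)] by (simp add: bij_betw_def)
      show "?f ` ?H = {..<(m * r) div 2}"
      proof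
        show "{..<(m * r) div 2} \<subseteq> ?f ` ?H"
        proof
          fix y assume y: "y \<in> {..<(m * r) div 2}"
          then have "y \<in> ?f ` {..<m * r}" unfolding im by simp
          then obtain x where "x < m * r" "y = ?f x" by auto
          then show "y \<in> ?f ` ?H" using y by auto
        qed
      qed auto
    qed auto
    then have cH: "card ?H = (m * r) div 2" by (simp add: bij_betw_same_card)
    have sub: "?H \<subseteq> both_low (m * r) \<phi>' \<psi>' (nat (p n)) (nat (q n)) \<union> ?B"
    proof
      fix k assume k: "k \<in> ?H"
      let ?u = "(next_in (m * r) \<phi>' ^^ nat (p n)) k"
      let ?v = "(next_in (m * r) \<psi>' ^^ nat (q n)) k"
      show "k \<in> both_low (m * r) \<phi>' \<psi>' (nat (p n)) (nat (q n)) \<union> ?B"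
      proof (cases "?v div r = ?u div r")
        case True
        then have "?v < (m * r) div 2" using k by (simp add: half_refined[OF m r0])
        then show ?thesis using k by (simp add: both_low_def)
      next
        case False
        then have "?v div r \<noteq> \<kappa> (?u div r)" using \<open>b\<close> by (simp add: \<kappa>_def)
        then show ?thesis using k n by blast
      qed
    qed
    have "finite (both_low (m * r) \<phi>' \<psi>' (nat (p n)) (nat (q n)) \<union> ?B)"
      by (simp add: both_low_def)
    from card_mono[OF this sub]
    have "(m * r) div 2 \<le> card (both_low (m * r) \<phi>' \<psi>' (nat (p n)) (nat (q n)) \<union> ?B)"
      by (simp only: cH)
    also have "\<dots> \<le> card (both_low (m * r) \<phi>' \<psi>' (nat (p n)) (nat (q n))) + card ?B" by (rule card_Un_le)
    finally have "real ((m * r) div 2) \<le> real (card (both_low (m * r) \<phi>' \<psi>' (nat (p n)) (nat (q n)))) + real (card ?B)"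
      by (simp only: of_nat_add[symmetric] of_nat_le_iff)
    moreover have "real ((m * r) div 2) = real (m * r) / 2" using real_of_nat_div[of 2 "m * r"] m by simp
    ultimately show ?thesis using bad True by (simp add: algebra_simps)
  next
    case False
    \<comment> \<open>Exchanging the halves puts the two images on opposite sides unless the cell is
      bad.\<close>
    have "both_low (m * r) \<phi>' \<psi>' (nat (p n)) (nat (q n)) \<subseteq> ?B"
    proof
      fix k assume k: "k \<in> both_low (m * r) \<phi>' \<psi>' (nat (p n)) (nat (q n))"
      let ?u = "(next_in (m * r) \<phi>' ^^ nat (p n)) k div r"
      let ?v = "(next_in (m * r) \<psi>' ^^ nat (q n)) k div r"
      have uv: "k < m * r" "?u < m div 2" "?v < m div 2"
        using k by (auto simp: both_low_def half_refined[OF m r0])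
      then have "\<not> \<kappa> ?u < m div 2" using swap_halves_less_iff[OF m, of ?u] False by (simp add: \<kappa>_def)
      then have "?v \<noteq> \<kappa> ?u" using uv(3) by auto
      then show "k \<in> ?B" using n uv(1) by blast
    qed
    then have "card (both_low (m * r) \<phi>' \<psi>' (nat (p n)) (nat (q n))) \<le> card ?B"
      by (intro card_mono) auto
    then show ?thesis using bad False by simp
  qed
  have pq0: "0 \<le> p n \<and> 0 \<le> q n" if "n \<in> {a..N}" for n
    using a(1)[of n] a(2)[of n] that by force
  show ?thesis
  proof (rule exI[of _ r], rule exI[of _ \<phi>'], rule exI[of _ \<psi>'], rule exI[of _ a], rule exI[of _ N],
      rule exI[of _ P], intro conjI ballI)
    fix n assume n: "n \<in> {a..N}"
    show "0 \<le> p n" "p n \<le> int P" "0 \<le> q n" "q n \<le> int P" using P[OF n] pq0[OF n] by blast+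
    show "if b then (1/2 - \<delta>) * real (m * r) \<le> real (card (both_low (m * r) \<phi>' \<psi>' (nat (p n)) (nat (q n))))
       else real (card (both_low (m * r) \<phi>' \<psi>' (nat (p n)) (nat (q n)))) \<le> \<delta> * real (m * r)"
      by (rule corr[OF n])
  next
    show "j \<le> N" "1 \<le> N" "10 * a \<le> N" by (simp_all add: N_def)
  qed (rule r c' mis)+
qed

section \<open>Consequences of a good cyclic approximation\<close>

lemma integral_sq_le:
  fixes u :: "real \<Rightarrow> complex"
  assumes u: "u \<in> borel_measurable unit_interval" and D: "D \<in> sets unit_interval" "measure unit_interval D \<le> \<epsilon>"
    and \<alpha>: "\<And>x. x \<in> {0..<1} \<Longrightarrow> x \<notin> D \<Longrightarrow> cmod (u x) \<le> \<alpha>" and \<beta>: "\<And>x. x \<in> {0..<1} \<Longrightarrow> cmod (u x) \<le> \<beta>"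
  shows "(LINT x|unit_interval. (cmod (u x))\<^sup>2) \<le> \<alpha>\<^sup>2 + \<beta>\<^sup>2 * \<epsilon>"
proof -
  have i: "integrable unit_interval (indicator D :: real \<Rightarrow> real)"
    using D by (simp add: UI.emeasure_eq_measure)
  have "(LINT x|unit_interval. (cmod (u x))\<^sup>2) \<le> (LINT x|unit_interval. \<alpha>\<^sup>2 + \<beta>\<^sup>2 * indicator D x)"
  proof (rule integral_mono)
    show "integrable unit_interval (\<lambda>x. (cmod (u x))\<^sup>2)"
      by (rule L2_integrable_sq[OF UI.bounded_L2[OF u, of \<beta>]]) (simp add: \<beta>)
    show "(cmod (u x))\<^sup>2 \<le> \<alpha>\<^sup>2 + \<beta>\<^sup>2 * indicator D x" if "x \<in> space unit_interval" for x
    proof (cases "x \<in> D")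
      case True
      have "(cmod (u x))\<^sup>2 \<le> \<beta>\<^sup>2" using \<beta>[of x] that by (intro power_mono) auto
      moreover have "\<beta>\<^sup>2 * indicator D x = \<beta>\<^sup>2" using True by simp
      ultimately show ?thesis using zero_le_power2[of \<alpha>] by linarith
    next
      case False
      have "(cmod (u x))\<^sup>2 \<le> \<alpha>\<^sup>2" using \<alpha>[of x] False that by (intro power_mono) auto
      then show ?thesis using False by simp
    qed
  qed (use i in auto)
  also have "\<dots> = \<alpha>\<^sup>2 + \<beta>\<^sup>2 * measure unit_interval D"
  proof -
    have "D \<inter> {0..<1} = D" using sets.sets_into_space[OF D(1)] by auto
    then have "(LINT x|unit_interval. indicator D x) = measure unit_interval D" by simp
    then show ?thesis using i UI.prob_space by (subst Bochner_Integration.integral_add) simp_all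
  qed
  also have "\<dots> \<le> \<alpha>\<^sup>2 + \<beta>\<^sup>2 * \<epsilon>" using D(2) by (intro add_left_mono mult_left_mono) auto
  finally show ?thesis .
qed

lemma cell_less_half_iff:
  assumes "even m" "0 < m" "0 \<le> y" shows "cell m y < m div 2 \<longleftrightarrow> y < 1/2"
proof -
  obtain h where h: "m = 2 * h" using assms(1) by (rule evenE)
  have "0 \<le> \<lfloor>real m * y\<rfloor>" using assms(3) by simp
  then have "cell m y < h \<longleftrightarrow> \<lfloor>real m * y\<rfloor> < int h" unfolding cell_def by (rule nat_less_iff)
  also have "\<dots> \<longleftrightarrow> real m * y < real h" by (simp add: floor_less_iff)
  also have "\<dots> \<longleftrightarrow> y < 1/2" using assms(2) by (simp add: h field_simps)
  finally show ?thesis by (simp add: h)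
qed

locale cyclic_approximation =
  fixes S :: "real \<Rightarrow> real" and m :: nat and \<phi> :: "nat \<Rightarrow> nat" and \<eta> :: real
  assumes aut: "automorphism unit_interval S" and c: "cyclic_order m \<phi>"
    and err: "measure unit_interval {x\<in>{0..<1}. cell m (inv_into {0..<1} S x) \<noteq> next_in m \<phi> (cell m x)} \<le> \<eta>"

sublocale cyclic_approximation \<subseteq> koopman unit_interval S
  by (intro koopman.intro koopman_axioms.intro prob_space_unit_interval aut)

context cyclic_approximation
begin

abbreviation "F \<equiv> inv_into {0..<1} S"

lemma m_pos: "0 < m" using c by (simp add: cyclic_order_def)

lemma It_F: "It (- int i) x = (F ^^ i) x"
  by (cases "i = 0") (simp_all add: iterate_def)

lemma F_pow_measurable [measurable]: "F ^^ i \<in> measurable unit_interval unit_interval"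
  using meas_It[of "- int i"] It_F[of i] by (simp add: fun_eq_iff[symmetric] cong: measurable_cong)

lemma F_pow_space: "x \<in> {0..<1} \<Longrightarrow> (F ^^ i) x \<in> {0..<1}"
  using It_space[of x "- int i"] by (simp add: It_F)

lemma measure_F_pow:
  assumes "E \<in> sets unit_interval"
  shows "measure unit_interval {x\<in>{0..<1}. (F ^^ i) x \<in> E} = measure unit_interval E"
proof -
  have "measure unit_interval E = measure (distr unit_interval unit_interval (It (- int i))) E"
    by (simp add: distr_It)
  also have "\<dots> = measure unit_interval (It (- int i) -` E \<inter> space unit_interval)"
    by (rule measure_distr[OF meas_It assms])
  also have "It (- int i) -` E \<inter> space unit_interval = {x\<in>{0..<1}. (F ^^ i) x \<in> E}"
    by (auto simp: It_F)
  finally show ?thesis by simp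
qed

definition deviating :: "nat \<Rightarrow> real set" where
  "deviating K = {x\<in>{0..<1}. \<exists>i\<le>K. cell m ((F ^^ i) x) \<noteq> (next_in m \<phi> ^^ i) (cell m x)}"

lemma cell_fun_measurable [measurable]:
  "(\<lambda>x. real (h (cell m ((F ^^ i) x)))) \<in> borel_measurable unit_interval"
proof -
  have "(\<lambda>x. cell m ((F ^^ i) x)) \<in> measurable unit_interval (count_space UNIV)"
    by (rule measurable_compose[OF F_pow_measurable cell_measurable])
  then show ?thesis by (rule measurable_compose) simp
qed

lemma deviating_sets: "deviating K \<in> sets unit_interval"
proof -
  have [measurable]: "(\<lambda>x. real (h (cell m x))) \<in> borel_measurable unit_interval" for h :: "nat \<Rightarrow> nat"
    using cell_fun_measurable[of h 0] by simp
  have "{x\<in>space unit_interval. \<exists>i\<le>K. real (id (cell m ((F ^^ i) x))) \<noteq> real ((next_in m \<phi> ^^ i) (cell m x))} \<in> sets unit_interval"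
    by measurable
  then show ?thesis by (simp add: deviating_def)
qed

text \<open>A first deviation at time \<open>Suc i\<close> means that the \<open>i\<close>-th
  iterate lies in the one-step error set, and preimages of that set keep its measure.\<close>

lemma measure_deviating: "measure unit_interval (deviating K) \<le> real K * \<eta>"
proof -
  let ?E = "{x\<in>{0..<1}. cell m (F x) \<noteq> next_in m \<phi> (cell m x)}"
  have E: "?E \<in> sets unit_interval"
  proof -
    have [measurable]: "(\<lambda>x. real (h (cell m x))) \<in> borel_measurable unit_interval" for h :: "nat \<Rightarrow> nat"
      using cell_fun_measurable[of h 0] by simp
    have "{x\<in>space unit_interval. real (id (cell m ((F ^^ 1) x))) \<noteq> real (next_in m \<phi> (cell m x))} \<in> sets unit_interval"
      by measurable
    then show ?thesis by simp
  qed
  have Ei: "{x\<in>{0..<1}. (F ^^ i) x \<in> ?E} \<in> sets unit_interval" for i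
  proof -
    have "(F ^^ i) -` ?E \<inter> space unit_interval \<in> sets unit_interval" by (rule measurable_sets[OF F_pow_measurable E])
    moreover have "(F ^^ i) -` ?E \<inter> space unit_interval = {x\<in>{0..<1}. (F ^^ i) x \<in> ?E}" by auto
    ultimately show ?thesis by simp
  qed
  have "deviating K \<subseteq> (\<Union>i<K. {x\<in>{0..<1}. (F ^^ i) x \<in> ?E})"
  proof (rule subsetI, rule ccontr)
    fix x assume x: "x \<in> deviating K" and n: "x \<notin> (\<Union>i<K. {x\<in>{0..<1}. (F ^^ i) x \<in> ?E})"
    have x1: "x \<in> {0..<1}" using x by (simp add: deviating_def)
    have "cell m ((F ^^ i) x) = (next_in m \<phi> ^^ i) (cell m x)" if "i \<le> K" for i
      using that
    proof (induction i)
      case (Suc i)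
      then have "(F ^^ i) x \<notin> ?E" using n x1 by auto
      then have "cell m (F ((F ^^ i) x)) = next_in m \<phi> (cell m ((F ^^ i) x))"
        using F_pow_space[OF x1, of i] by blast
      then show ?case using Suc by simp
    qed simp
    then show False using x by (auto simp: deviating_def)
  qed
  then have "measure unit_interval (deviating K) \<le> measure unit_interval (\<Union>i<K. {x\<in>{0..<1}. (F ^^ i) x \<in> ?E})"
    using Ei by (intro UI.finite_measure_mono) auto
  also have "\<dots> \<le> (\<Sum>i<K. measure unit_interval {x\<in>{0..<1}. (F ^^ i) x \<in> ?E})"
    using Ei by (intro measure_UNION_le) auto
  also have "\<dots> = (\<Sum>i<K. measure unit_interval ?E)"
    by (intro sum.cong refl measure_F_pow E)
  also have "\<dots> \<le> (\<Sum>i<K. \<eta>)" by (intro sum_mono err)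
  finally show ?thesis by simp
qed

lemma not_deviating:
  "x \<in> {0..<1} \<Longrightarrow> x \<notin> deviating K \<Longrightarrow> i \<le> K \<Longrightarrow> cell m ((F ^^ i) x) = (next_in m \<phi> ^^ i) (cell m x)"
  by (auto simp: deviating_def)

text \<open>Where the orbit follows the cycle, replacing \<open>f\<close> by \<open>h\<close> costs
  \<open>\<eta>\<close> per unit of coefficient; elsewhere, on measure at most
  \<open>real m * \<eta>\<close>, the trivial bound is used. The exponents are negative because
  \<open>F\<close> is the inverse of \<open>S\<close>.\<close>

lemma indicator_approximation:
  assumes h: "h \<in> borel_measurable unit_interval" "\<And>x. x \<in> {0..<1} \<Longrightarrow> cmod (h x) \<le> 2"
    and hf: "\<And>x. x \<in> {0..<1} \<Longrightarrow> cmod (h x - f (cell m x)) \<le> \<eta>" and \<eta>: "0 < \<eta>" "\<eta> \<le> 1"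
    and b: "\<And>k. k < m \<Longrightarrow> (\<Sum>i<m. b i * f ((next_in m \<phi> ^^ i) k)) = of_bool (k \<in> A)"
  shows "(LINT x|unit_interval. (cmod (of_bool (cell m x \<in> A) - (\<Sum>i<m. b i * U (- int i) h x)))\<^sup>2)
    \<le> (1 + 2 * (\<Sum>i<m. cmod (b i)))\<^sup>2 * (real m + 1) * \<eta>"
proof -
  define B where "B = (\<Sum>i<m. cmod (b i))"
  have B: "B \<ge> 0" by (simp add: B_def sum_nonneg)
  have Uh: "U (- int i) h x = h ((F ^^ i) x)" for i x by (simp add: koopman_power_def It_F)
  have hm: "(\<lambda>x. U (- int i) h x) \<in> borel_measurable unit_interval" for i
    unfolding koopman_power_def by (rule measurable_compose[OF meas_It h(1)])
  have im: "(\<lambda>x. of_bool (cell m x \<in> A) :: complex) \<in> borel_measurable unit_interval"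
    by (rule measurable_compose[OF cell_measurable]) simp
  have "(LINT x|unit_interval. (cmod (of_bool (cell m x \<in> A) - (\<Sum>i<m. b i * U (- int i) h x)))\<^sup>2)
      \<le> (B * \<eta>)\<^sup>2 + (1 + 2 * B)\<^sup>2 * (real m * \<eta>)"
  proof (rule integral_sq_le[OF _ deviating_sets measure_deviating])
    show "(\<lambda>x. of_bool (cell m x \<in> A) - (\<Sum>i<m. b i * U (- int i) h x)) \<in> borel_measurable unit_interval"
      using hm im by measurable
    fix x :: real assume x: "x \<in> {0..<1}"
    have "cmod (\<Sum>i<m. b i * U (- int i) h x) \<le> (\<Sum>i<m. cmod (b i) * 2)"
      using h(2)[OF F_pow_space[OF x]]
      by (intro sum_norm_le) (auto simp: norm_mult Uh intro!: mult_left_mono)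
    also have "\<dots> = 2 * B" by (simp add: B_def sum_distrib_left mult.commute)
    finally have 1: "cmod (\<Sum>i<m. b i * U (- int i) h x) \<le> 2 * B" .
    have "cmod (of_bool (cell m x \<in> A)) \<le> 1" by simp
    with 1 show "cmod (of_bool (cell m x \<in> A) - (\<Sum>i<m. b i * U (- int i) h x)) \<le> 1 + 2 * B"
      using norm_triangle_ineq4[of "of_bool (cell m x \<in> A)" "\<Sum>i<m. b i * U (- int i) h x"] by linarith
    assume nd: "x \<notin> deviating m"
    have "of_bool (cell m x \<in> A) - (\<Sum>i<m. b i * U (- int i) h x) =
        (\<Sum>i<m. b i * (f ((next_in m \<phi> ^^ i) (cell m x)) - h ((F ^^ i) x)))"
      using b[OF cell_less[OF x m_pos]] by (simp add: Uh right_diff_distrib sum_subtractf)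
    also have "cmod \<dots> \<le> (\<Sum>i<m. cmod (b i) * \<eta>)"
    proof (intro sum_norm_le)
      fix i assume "i \<in> {..<m}"
      then have "f ((next_in m \<phi> ^^ i) (cell m x)) = f (cell m ((F ^^ i) x))"
        using not_deviating[OF x nd, of i] by simp
      then show "cmod (b i * (f ((next_in m \<phi> ^^ i) (cell m x)) - h ((F ^^ i) x))) \<le> cmod (b i) * \<eta>"
        using hf[OF F_pow_space[OF x, of i]] by (simp add: norm_mult norm_minus_commute mult_left_mono)
    qed
    finally show "cmod (of_bool (cell m x \<in> A) - (\<Sum>i<m. b i * U (- int i) h x)) \<le> B * \<eta>"
      by (simp add: B_def sum_distrib_right)
  qed
  also have "(B * \<eta>)\<^sup>2 \<le> (1 + 2 * B)\<^sup>2 * \<eta>"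
  proof -
    have "\<eta>\<^sup>2 \<le> \<eta>" using \<eta> by (simp add: power2_eq_square mult_left_le)
    moreover have "B\<^sup>2 \<le> (1 + 2 * B)\<^sup>2" using B by (intro power_mono) auto
    ultimately show ?thesis unfolding power_mult_distrib by (intro mult_mono) auto
  qed
  finally show ?thesis by (simp add: B_def algebra_simps)
qed

text \<open>After \<open>m\<close> steps the cycle is back at its start, so off the deviating set
  both values of \<open>h\<close> are within \<open>\<eta>\<close> of the same value of
  \<open>f\<close>.\<close>

lemma rigid_approximation:
  assumes h: "h \<in> borel_measurable unit_interval" "\<And>x. x \<in> {0..<1} \<Longrightarrow> cmod (h x) \<le> 2"
    and hf: "\<And>x. x \<in> {0..<1} \<Longrightarrow> cmod (h x - f (cell m x)) \<le> \<eta>" and \<eta>: "0 < \<eta>" "\<eta> \<le> 1"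
  shows "(LINT x|unit_interval. (cmod (U (- int m) h x - h x))\<^sup>2) \<le> 20 * ((real m + 1) * \<eta>)"
proof -
  have Uh: "U (- int m) h x = h ((F ^^ m) x)" for x by (simp add: koopman_power_def It_F)
  have hm: "U (- int m) h \<in> borel_measurable unit_interval"
    unfolding koopman_power_def by (rule measurable_compose[OF meas_It h(1)])
  have "(LINT x|unit_interval. (cmod (U (- int m) h x - h x))\<^sup>2) \<le> (2 * \<eta>)\<^sup>2 + 4\<^sup>2 * (real m * \<eta>)"
  proof (rule integral_sq_le[OF _ deviating_sets measure_deviating])
    show "(\<lambda>x. U (- int m) h x - h x) \<in> borel_measurable unit_interval" using hm h(1) by measurable
    fix x :: real assume x: "x \<in> {0..<1}"
    show "cmod (U (- int m) h x - h x) \<le> 4"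
      using h(2)[OF x] h(2)[OF F_pow_space[OF x, of m]] norm_triangle_ineq4[of "h ((F ^^ m) x)" "h x"] by (simp add: Uh)
    assume nd: "x \<notin> deviating m"
    have "cell m ((F ^^ m) x) = cell m x"
      using not_deviating[OF x nd, of m] next_in_pow_period[OF c cell_less[OF x m_pos]] by simp
    then have "cmod (h ((F ^^ m) x) - f (cell m x)) \<le> \<eta>" using hf[OF F_pow_space[OF x, of m]] by simp
    moreover have "cmod (f (cell m x) - h x) \<le> \<eta>" using hf[OF x] by (simp add: norm_minus_commute)
    ultimately show "cmod (U (- int m) h x - h x) \<le> 2 * \<eta>"
      using norm_triangle_ineq[of "h ((F ^^ m) x) - f (cell m x)" "f (cell m x) - h x"] by (simp add: Uh)
  qed
  also have "\<dots> \<le> 20 * ((real m + 1) * \<eta>)"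
  proof -
    have "\<eta>\<^sup>2 \<le> \<eta>" using \<eta> by (simp add: power2_eq_square mult_left_le)
    moreover have "0 \<le> real m * \<eta>" using \<eta> by simp
    moreover have "20 * ((real m + 1) * \<eta>) = 20 * (real m * \<eta>) + 20 * \<eta>" by (simp add: algebra_simps)
    moreover have "(2 * \<eta>)\<^sup>2 + 4\<^sup>2 * (real m * \<eta>) = 4 * \<eta>\<^sup>2 + 16 * (real m * \<eta>)" by (simp add: power_mult_distrib)
    ultimately show ?thesis using \<eta> by linarith
  qed
  finally show ?thesis .
qed

text \<open>This turns images under \<open>S\<close> into conditions on orbits of \<open>F\<close>,
  the form in which the permutations describe them.\<close>

lemma image_iterate:
  assumes "C \<subseteq> {0..<1}" shows "It (int u) ` C = {x\<in>{0..<1}. (F ^^ u) x \<in> C}"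
proof
  show "It (int u) ` C \<subseteq> {x\<in>{0..<1}. (F ^^ u) x \<in> C}"
  proof
    fix y assume "y \<in> It (int u) ` C"
    then obtain x where x: "x \<in> C" "y = It (int u) x" by blast
    have xs: "x \<in> {0..<1}" using x assms by auto
    have "(F ^^ u) y = x" using It_add[of x "- int u" "int u"] xs x by (simp add: It_F)
    then show "y \<in> {x\<in>{0..<1}. (F ^^ u) x \<in> C}" using x It_space[of x "int u"] xs by simp
  qed
  show "{x\<in>{0..<1}. (F ^^ u) x \<in> C} \<subseteq> It (int u) ` C"
  proof
    fix y assume y: "y \<in> {x\<in>{0..<1}. (F ^^ u) x \<in> C}"
    have "It (int u) ((F ^^ u) y) = y" using It_add[of y "int u" "- int u"] y by (simp add: It_F)
    then show "y \<in> It (int u) ` C" using y by (intro image_eqI[of _ _ "(F ^^ u) y"]) auto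
  qed
qed

end

section \<open>The inductive construction\<close>

text \<open>The tolerance \<open>\<eta>\<close> is chosen after the stage-\<open>j\<close> data and bounds everything that later stages may
  change.\<close>

definition tolerant :: "nat \<Rightarrow> nat \<Rightarrow> (nat \<Rightarrow> nat) \<Rightarrow> (nat \<Rightarrow> complex) \<Rightarrow> real \<Rightarrow> bool" where
  "tolerant j m \<phi> f \<eta> \<longleftrightarrow> (\<forall>A\<subseteq>{..<m}. \<exists>b.
     (\<forall>k<m. (\<Sum>i<m. b i * f ((next_in m \<phi> ^^ i) k)) = of_bool (k \<in> A)) \<and>
     (1 + 2 * (\<Sum>i<m. cmod (b i)))\<^sup>2 * (real m + 1) * \<eta> \<le> (1/2) ^ j)"

text \<open>There are finitely many sets \<open>A\<close>, so one \<open>\<eta>0\<close> serves all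
  their coefficient systems.\<close>

lemma tolerant_exists:
  assumes "generating m \<phi> f"
  shows "\<exists>\<eta>0>0. \<forall>\<eta>. 0 < \<eta> \<and> \<eta> \<le> \<eta>0 \<longrightarrow> tolerant j m \<phi> f \<eta>"
proof -
  have "\<exists>b. \<forall>k<m. (\<Sum>i<m. b i * f ((next_in m \<phi> ^^ i) k)) = of_bool (k \<in> A)" if A: "A \<subseteq> {..<m}" for A
  proof -
    have "\<forall>a\<in>{..<m}. \<exists>b. \<forall>k<m. (\<Sum>i<m. b i * f ((next_in m \<phi> ^^ i) k)) = (if k = a then 1 else 0)"
      using assms unfolding generating_def by blast
    from bchoice[OF this] obtain b where b: "\<forall>a\<in>{..<m}. \<forall>k<m.
        (\<Sum>i<m. b a i * f ((next_in m \<phi> ^^ i) k)) = (if k = a then 1 else 0)" by blast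
    have "(\<Sum>i<m. (\<Sum>a\<in>A. b a i) * f ((next_in m \<phi> ^^ i) k)) = of_bool (k \<in> A)" if k: "k < m" for k
    proof -
      have "(\<Sum>i<m. (\<Sum>a\<in>A. b a i) * f ((next_in m \<phi> ^^ i) k)) =
          (\<Sum>a\<in>A. \<Sum>i<m. b a i * f ((next_in m \<phi> ^^ i) k))"
        unfolding sum_distrib_right by (rule sum.swap)
      also have "\<dots> = (\<Sum>a\<in>A. if k = a then 1 else 0)"
      proof (intro sum.cong refl)
        fix a assume "a \<in> A"
        then have "a \<in> {..<m}" using A by blast
        from bspec[OF b this] k show "(\<Sum>i<m. b a i * f ((next_in m \<phi> ^^ i) k)) = (if k = a then 1 else 0)" by blast
      qed
      also have "\<dots> = of_bool (k \<in> A)" using finite_subset[OF A] by simp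
      finally show ?thesis .
    qed
    then show ?thesis by (intro exI[of _ "\<lambda>i. \<Sum>a\<in>A. b a i"] allI impI)
  qed
  then have "\<forall>A\<in>Pow {..<m}. \<exists>b. \<forall>k<m. (\<Sum>i<m. b i * f ((next_in m \<phi> ^^ i) k)) = of_bool (k \<in> A)"
    by blast
  from bchoice[OF this] obtain b where "\<forall>A\<in>Pow {..<m}. \<forall>k<m.
      (\<Sum>i<m. b A i * f ((next_in m \<phi> ^^ i) k)) = of_bool (k \<in> A)" ..
  then have b: "\<forall>k<m. (\<Sum>i<m. b A i * f ((next_in m \<phi> ^^ i) k)) = of_bool (k \<in> A)" if "A \<subseteq> {..<m}" for A
    using that by blast
  define w where "w A = (1 + 2 * (\<Sum>i<m. cmod (b A i)))\<^sup>2" for A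
  define W where "W = (\<Sum>A\<in>Pow {..<m}. w A) * (real m + 1) + 1"
  have w0: "0 \<le> w A" for A by (simp add: w_def)
  have W: "W > 0" unfolding W_def by (intro add_nonneg_pos mult_nonneg_nonneg sum_nonneg w0) auto
  have "tolerant j m \<phi> f \<eta>" if \<eta>: "0 < \<eta>" "\<eta> \<le> (1/2) ^ j / W" for \<eta>
    unfolding tolerant_def
  proof (intro allI impI)
    fix A assume A: "A \<subseteq> {..<m}"
    have "w A \<le> (\<Sum>A\<in>Pow {..<m}. w A)" using A w0 by (intro member_le_sum) auto
    then have "w A * (real m + 1) \<le> (\<Sum>A\<in>Pow {..<m}. w A) * (real m + 1)" by (intro mult_right_mono) auto
    then have "w A * (real m + 1) \<le> W" unfolding W_def by linarith
    then have "w A * (real m + 1) * \<eta> \<le> W * \<eta>" using \<eta> by (intro mult_right_mono) auto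
    also have "\<dots> \<le> (1/2) ^ j" using \<eta>(2) W by (simp add: pos_le_divide_eq mult.commute)
    finally show "\<exists>b. (\<forall>k<m. (\<Sum>i<m. b i * f ((next_in m \<phi> ^^ i) k)) = of_bool (k \<in> A)) \<and>
      (1 + 2 * (\<Sum>i<m. cmod (b i)))\<^sup>2 * (real m + 1) * \<eta> \<le> (1/2) ^ j"
      using b[OF A] by (intro exI[of _ "b A"]) (simp add: w_def)
  qed
  moreover have "(1/2) ^ j / W > 0" using W by simp
  ultimately show ?thesis by blast
qed

lemma avoid_finite:
  fixes e :: real
  assumes "finite B" "0 < e"
  shows "\<exists>t. 0 < t \<and> t \<le> e \<and> complex_of_real t \<notin> B"
proof -
  have "inj_on complex_of_real {0<..e}" by (auto intro: inj_onI)
  then have "infinite (complex_of_real ` {0<..e})"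
    using assms(2) infinite_Ioc[of 0 e] by (simp add: finite_image_iff)
  then obtain z where "z \<in> complex_of_real ` {0<..e} - B"
    using assms(1) by (metis Diff_infinite_finite ex_in_conv finite.emptyI)
  then show ?thesis by auto
qed

type_synonym stage = "nat \<times> (nat \<Rightarrow> nat) \<times> (nat \<Rightarrow> nat) \<times> (nat \<Rightarrow> complex) \<times> real"

text \<open>The components are the number of cells, the two cyclic orders, the step function
  approximating the cyclic vector, and the tolerance for all later changes. The bound at stage 0
  keeps the limit vector bounded.\<close>

definition stage :: "nat \<Rightarrow> stage \<Rightarrow> bool" where
  "stage j s \<longleftrightarrow> (case s of (m, \<phi>, \<psi>, f, \<eta>) \<Rightarrow>
     even m \<and> cyclic_order m \<phi> \<and> cyclic_order m \<psi> \<and>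
     generating m \<phi> f \<and> generating m \<psi> f \<and> tolerant j m \<phi> f \<eta> \<and> tolerant j m \<psi> f \<eta> \<and>
     0 < \<eta> \<and> \<eta> \<le> 1 \<and> (j = 0 \<longrightarrow> (\<forall>k. cmod (f k) \<le> 1)))"

text \<open>Halving the tolerance bounds the total change after a stage by its
  \<open>\<eta>\<close>. Apart from refinement, the step function changes only at the new cell 0.
  The new tolerance is small against the horizon \<open>P\<close>, which protects the window of this
  stage; even stages aim at \<open>1/2\<close>, odd ones at \<open>0\<close>.\<close>

definition linked ::
  "(nat \<Rightarrow> int) \<Rightarrow> (nat \<Rightarrow> int) \<Rightarrow> nat \<Rightarrow> stage \<Rightarrow> stage \<Rightarrow> nat \<Rightarrow> real \<Rightarrow> nat \<Rightarrow> nat \<Rightarrow> nat \<Rightarrow> bool" where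
  "linked p q j s s' r t a N P \<longleftrightarrow> (case (s, s') of ((m, \<phi>, \<psi>, f, \<eta>), (m', \<phi>', \<psi>', f', \<eta>')) \<Rightarrow>
     2 \<le> r \<and> m' = m * r \<and>
     real (card {k\<in>{..<m'}. next_in m' \<phi>' k div r \<noteq> next_in m \<phi> (k div r)}) \<le> \<eta> / 2 * real m' \<and>
     real (card {k\<in>{..<m'}. next_in m' \<psi>' k div r \<noteq> next_in m \<psi> (k div r)}) \<le> \<eta> / 2 * real m' \<and>
     0 < t \<and> t \<le> \<eta> / 2 \<and> f' = (\<lambda>k. f (k div r) + (if k = 0 then of_real t else 0)) \<and> \<eta>' \<le> \<eta> / 2 \<and>
     j \<le> N \<and> 1 \<le> N \<and> 10 * a \<le> N \<and> real P * \<eta>' \<le> 1/100 \<and>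
     (\<forall>n\<in>{a..N}. 0 \<le> p n \<and> p n \<le> int P \<and> 0 \<le> q n \<and> q n \<le> int P \<and>
       (if even j then 49/100 * real m' \<le> real (card (both_low m' \<phi>' \<psi>' (nat (p n)) (nat (q n))))
        else real (card (both_low m' \<phi>' \<psi>' (nat (p n)) (nat (q n)))) \<le> 1/100 * real m')))"

text \<open>Two cells with one and the same order for both systems; evenness makes the left half a
  union of cells at every stage.\<close>

lemma stage_initial: "\<exists>s. stage 0 s"
proof -
  define \<phi> where "\<phi> = (\<lambda>i::nat. i mod 2)"
  have c: "cyclic_order 2 \<phi>"
  proof -
    have "{..<2} = {0, 1::nat}" by auto
    then show ?thesis by (simp add: cyclic_order_def \<phi>_def bij_betw_def)
  qed
  obtain t where t: "0 < t" "t \<le> 1"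
    "complex_of_real t \<notin> {t. \<not> generating 2 \<phi> (\<lambda>k. 0 + (if k = 0 then t else 0))}"
    using avoid_finite[OF finite_not_generating[OF c, of "\<lambda>_. 0"], of 1] by auto
  define f where "f = (\<lambda>k::nat. 0 + (if k = 0 then complex_of_real t else 0))"
  have g: "generating 2 \<phi> f" using t(3) by (simp add: f_def)
  obtain \<eta>0 where \<eta>0: "\<eta>0 > 0" "\<And>\<eta>. 0 < \<eta> \<Longrightarrow> \<eta> \<le> \<eta>0 \<Longrightarrow> tolerant 0 2 \<phi> f \<eta>"
    using tolerant_exists[OF g] by blast
  have "cmod (f k) \<le> 1" for k using t by (simp add: f_def)
  then have "stage 0 (2, \<phi>, \<phi>, f, min 1 \<eta>0)"
    using c g \<eta>0 by (simp add: stage_def)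
  then show ?thesis by blast
qed

lemma stage_step:
  assumes p: "filterlim (\<lambda>n. p (n + 1) - p n) at_top sequentially"
    and q: "filterlim (\<lambda>n. q (n + 1) - q n) at_top sequentially"
    and s: "stage j s"
  shows "\<exists>s'. stage (Suc j) s' \<and> (\<exists>r t a N P. linked p q j s s' r t a N P)"
proof -
  obtain m \<phi> \<psi> f \<eta> where sd: "s = (m, \<phi>, \<psi>, f, \<eta>)" by (cases s)
  have m: "even m" and c: "cyclic_order m \<phi>" "cyclic_order m \<psi>" and \<eta>: "0 < \<eta>" "\<eta> \<le> 1"
    using s by (auto simp: stage_def sd)
  \<comment> \<open>One bound serves the change of the permutations and the accuracy of the
    correlations.\<close>
  define \<delta> where "\<delta> = min (\<eta> / 2) (1/100)"
  have \<delta>: "0 < \<delta>" using \<eta> by (simp add: \<delta>_def)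
  obtain r \<phi>' \<psi>' a N P where r: "2 \<le> r" and c': "cyclic_order (m * r) \<phi>'" "cyclic_order (m * r) \<psi>'"
    and mis: "real (card {k\<in>{..<m * r}. next_in (m * r) \<phi>' k div r \<noteq> next_in m \<phi> (k div r)}) \<le> \<delta> * real (m * r)"
      "real (card {k\<in>{..<m * r}. next_in (m * r) \<psi>' k div r \<noteq> next_in m \<psi> (k div r)}) \<le> \<delta> * real (m * r)"
    and N: "j \<le> N" "1 \<le> N" "10 * a \<le> N"
    and pq: "\<forall>n\<in>{a..N}. 0 \<le> p n \<and> p n \<le> int P \<and> 0 \<le> q n \<and> q n \<le> int P \<and>
      (if even j then (1/2 - \<delta>) * real (m * r) \<le> real (card (both_low (m * r) \<phi>' \<psi>' (nat (p n)) (nat (q n))))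
       else real (card (both_low (m * r) \<phi>' \<psi>' (nat (p n)) (nat (q n)))) \<le> \<delta> * real (m * r))"
    using correlation_step[OF p q c m \<delta>, of j "even j"] by (elim exE conjE) (rule that)
  have le: "\<delta> * real (m * r) \<le> \<eta> / 2 * real (m * r)" "\<delta> * real (m * r) \<le> 1/100 * real (m * r)"
    "49/100 * real (m * r) \<le> (1/2 - \<delta>) * real (m * r)"
    by (intro mult_right_mono; simp add: \<delta>_def)+
  have e2: "0 < \<eta> / 2" using \<eta> by simp
  \<comment> \<open>Each order excludes finitely many values of \<open>t\<close>, so one
    \<open>t\<close> serves both.\<close>
  define bad where "bad = {t. \<not> generating (m * r) \<phi>' (\<lambda>k. f (k div r) + (if k = 0 then t else 0))} \<union>
      {t. \<not> generating (m * r) \<psi>' (\<lambda>k. f (k div r) + (if k = 0 then t else 0))}"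
  have "finite bad" unfolding bad_def by (intro finite_UnI finite_not_generating c')
  from avoid_finite[OF this e2] obtain t where t: "0 < t" "t \<le> \<eta> / 2" "complex_of_real t \<notin> bad" by blast
  define f' where "f' = (\<lambda>k. f (k div r) + (if k = 0 then complex_of_real t else 0))"
  have g: "generating (m * r) \<phi>' f'" "generating (m * r) \<psi>' f'" using t(3) unfolding bad_def f'_def by blast+
  obtain \<eta>1 where \<eta>1: "\<eta>1 > 0" "\<And>\<eta>. 0 < \<eta> \<Longrightarrow> \<eta> \<le> \<eta>1 \<Longrightarrow> tolerant (Suc j) (m * r) \<phi>' f' \<eta>"
    using tolerant_exists[OF g(1)] by blast
  obtain \<eta>2 where \<eta>2: "\<eta>2 > 0" "\<And>\<eta>. 0 < \<eta> \<Longrightarrow> \<eta> \<le> \<eta>2 \<Longrightarrow> tolerant (Suc j) (m * r) \<psi>' f' \<eta>"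
    using tolerant_exists[OF g(2)] by blast
  \<comment> \<open>The last term yields \<open>real P * \<eta>' \<le> 1/100\<close>; its summand 1
    covers \<open>P = 0\<close>.\<close>
  define \<eta>' where "\<eta>' = min (min \<eta>1 \<eta>2) (min (\<eta> / 2) (1 / (100 * (real P + 1))))"
  have \<eta>': "0 < \<eta>'" "\<eta>' \<le> \<eta>1" "\<eta>' \<le> \<eta>2" "\<eta>' \<le> \<eta> / 2" "\<eta>' \<le> 1"
    using \<eta>1(1) \<eta>2(1) \<eta> by (auto simp: \<eta>'_def)
  have P: "real P * \<eta>' \<le> 1/100"
  proof -
    have "real P * \<eta>' \<le> real P * (1 / (100 * (real P + 1)))" by (intro mult_left_mono) (simp_all add: \<eta>'_def)
    also have "\<dots> \<le> 1/100" by (simp add: field_simps)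
    finally show ?thesis .
  qed
  have "stage (Suc j) (m * r, \<phi>', \<psi>', f', \<eta>')"
    using m c' g \<eta>1(2)[OF \<eta>'(1,2)] \<eta>2(2)[OF \<eta>'(1,3)] \<eta>' by (simp add: stage_def)
  moreover have "linked p q j s (m * r, \<phi>', \<psi>', f', \<eta>') r t a N P"
    unfolding linked_def sd split_conv prod.case
  proof (intro conjI ballI)
    show "real (card {k\<in>{..<m * r}. next_in (m * r) \<phi>' k div r \<noteq> next_in m \<phi> (k div r)}) \<le> \<eta> / 2 * real (m * r)"
      "real (card {k\<in>{..<m * r}. next_in (m * r) \<psi>' k div r \<noteq> next_in m \<psi> (k div r)}) \<le> \<eta> / 2 * real (m * r)"
      using mis le(1) by linarith+
    fix n assume "n \<in> {a..N}"
    note n = bspec[OF pq this]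
    show "0 \<le> p n" "p n \<le> int P" "0 \<le> q n" "q n \<le> int P" using n by blast+
    show "if even j then 49/100 * real (m * r) \<le> real (card (both_low (m * r) \<phi>' \<psi>' (nat (p n)) (nat (q n))))
      else real (card (both_low (m * r) \<phi>' \<psi>' (nat (p n)) (nat (q n)))) \<le> 1/100 * real (m * r)"
    proof (cases "even j")
      case True
      then have "(1/2 - \<delta>) * real (m * r) \<le> real (card (both_low (m * r) \<phi>' \<psi>' (nat (p n)) (nat (q n))))" using n by simp
      with le(3) True show ?thesis by simp
    next
      case False
      then have "real (card (both_low (m * r) \<phi>' \<psi>' (nat (p n)) (nat (q n)))) \<le> \<delta> * real (m * r)" using n by simp
      with le(2) False show ?thesis by simp
    qed
  qed (use r t N P \<eta>' in \<open>simp_all add: f'_def\<close>)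
  ultimately show ?thesis by blast
qed

section \<open>The limit of the stages\<close>

locale construction =
  fixes p q :: "nat \<Rightarrow> int" and m :: "nat \<Rightarrow> nat" and \<phi> \<psi> :: "nat \<Rightarrow> nat \<Rightarrow> nat" and f :: "nat \<Rightarrow> nat \<Rightarrow> complex"
    and \<eta> :: "nat \<Rightarrow> real" and r :: "nat \<Rightarrow> nat" and t :: "nat \<Rightarrow> real" and a N P :: "nat \<Rightarrow> nat"
  assumes stages: "\<And>j. stage j (m j, \<phi> j, \<psi> j, f j, \<eta> j)"
    and links: "\<And>j. linked p q j (m j, \<phi> j, \<psi> j, f j, \<eta> j)
      (m (Suc j), \<phi> (Suc j), \<psi> (Suc j), f (Suc j), \<eta> (Suc j)) (r j) (t j) (a j) (N j) (P j)"
begin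

lemma stage_facts: "even (m j)" "cyclic_order (m j) (\<phi> j)" "cyclic_order (m j) (\<psi> j)"
    "tolerant j (m j) (\<phi> j) (f j) (\<eta> j)" "tolerant j (m j) (\<psi> j) (f j) (\<eta> j)" "0 < \<eta> j" "\<eta> j \<le> 1"
    "cmod (f 0 k) \<le> 1"
  using stages[of j] stages[of 0] by (auto simp: stage_def)

lemma link_facts: "2 \<le> r j" "m (Suc j) = m j * r j" "0 < t j" "t j \<le> \<eta> j / 2" "\<eta> (Suc j) \<le> \<eta> j / 2"
    "f (Suc j) = (\<lambda>k. f j (k div r j) + (if k = 0 then of_real (t j) else 0))"
    "j \<le> N j" "1 \<le> N j" "10 * a j \<le> N j" "real (P j) * \<eta> (Suc j) \<le> 1/100"
  and link_mis: "real (card {k\<in>{..<m (Suc j)}. next_in (m (Suc j)) (\<phi> (Suc j)) k div r j \<noteq> next_in (m j) (\<phi> j) (k div r j)})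
      \<le> \<eta> j / 2 * real (m (Suc j))"
    "real (card {k\<in>{..<m (Suc j)}. next_in (m (Suc j)) (\<psi> (Suc j)) k div r j \<noteq> next_in (m j) (\<psi> j) (k div r j)})
      \<le> \<eta> j / 2 * real (m (Suc j))"
  using links[of j, unfolded linked_def prod.case] by blast+

lemma link_window:
  assumes "n \<in> {a j..N j}"
  shows "0 \<le> p n" "p n \<le> int (P j)" "0 \<le> q n" "q n \<le> int (P j)"
    "if even j then 49/100 * real (m (Suc j)) \<le>
      real (card (both_low (m (Suc j)) (\<phi> (Suc j)) (\<psi> (Suc j)) (nat (p n)) (nat (q n))))
     else real (card (both_low (m (Suc j)) (\<phi> (Suc j)) (\<psi> (Suc j)) (nat (p n)) (nat (q n)))) \<le> 1/100 * real (m (Suc j))"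
  using links[of j, unfolded linked_def prod.case] assms by blast+

lemma m_pos: "0 < m j" using stage_facts(2)[of j] by (simp add: cyclic_order_def)

lemma \<eta>_decay: "\<eta> (i + j) \<le> \<eta> j * (1/2) ^ i"
proof (induction i)
  case (Suc i)
  then show ?case using link_facts(5)[of "i + j"] by simp
qed simp

lemma geometric: "(\<lambda>i. \<eta> j / 2 * (1/2) ^ i) sums \<eta> j"
  using sums_mult[OF geometric_sums[of "1/2::real"], of "\<eta> j / 2"] by simp

lemma \<eta>_summable: "summable (\<lambda>j. \<eta> j / 2)"
proof (rule summable_comparison_test'[OF sums_summable[OF geometric[of 0]], of 0])
  show "norm (\<eta> n / 2) \<le> \<eta> 0 / 2 * (1/2) ^ n" for n using \<eta>_decay[of n 0] stage_facts(6)[of n] by simp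
qed

text \<open>The tolerances at least halve from stage to stage; the tail sum is the error of the
  limit automorphism at stage \<open>j\<close>.\<close>

lemma suminf_\<eta>: "(\<Sum>i. \<eta> (i + j) / 2) \<le> \<eta> j"
proof -
  have "(\<Sum>i. \<eta> (i + j) / 2) \<le> (\<Sum>i. \<eta> j / 2 * (1/2) ^ i)"
    using \<eta>_decay[of _ j]
    by (intro suminf_le summable_ignore_initial_segment[OF \<eta>_summable] sums_summable[OF geometric]) simp
  then show ?thesis using sums_unique[OF geometric[of j]] by simp
qed

lemma \<eta>_half_power: "\<eta> j \<le> (1/2) ^ j"
proof -
  have "\<eta> j \<le> \<eta> 0 * (1/2) ^ j" using \<eta>_decay[of j 0] by simp
  also have "\<dots> \<le> 1 * (1/2) ^ j" using stage_facts(7)[of 0] by (intro mult_right_mono) auto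
  finally show ?thesis by simp
qed

text \<open>Both systems share \<open>m\<close> and \<open>r\<close>, so the cells of either
  stage-\<open>j\<close> permutation are the same subsets of the interval.\<close>

lemma approximations:
  obtains S T where "\<And>j. cyclic_approximation S (m j) (\<phi> j) (\<eta> j)" "\<And>j. cyclic_approximation T (m j) (\<psi> j) (\<eta> j)"
proof -
  interpret R1: refining m r "\<lambda>j. next_in (m j) (\<phi> j)" "\<lambda>j. \<eta> j / 2"
    by unfold_locales (use m_pos link_facts next_in_bij[OF stage_facts(2)] \<eta>_summable link_mis in simp_all)
  interpret R2: refining m r "\<lambda>j. next_in (m j) (\<psi> j)" "\<lambda>j. \<eta> j / 2"
    by unfold_locales (use m_pos link_facts next_in_bij[OF stage_facts(3)] \<eta>_summable link_mis in simp_all)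
  obtain S where S: "automorphism unit_interval S" "\<And>j. measure unit_interval
     {x\<in>{0..<1}. cell (m j) (inv_into {0..<1} S x) \<noteq> next_in (m j) (\<phi> j) (cell (m j) x)} \<le> (\<Sum>i. \<eta> (i + j) / 2)"
    using R1.limit_automorphism by blast
  obtain T where T: "automorphism unit_interval T" "\<And>j. measure unit_interval
     {x\<in>{0..<1}. cell (m j) (inv_into {0..<1} T x) \<noteq> next_in (m j) (\<psi> j) (cell (m j) x)} \<le> (\<Sum>i. \<eta> (i + j) / 2)"
    using R2.limit_automorphism by blast
  show ?thesis
  proof (rule that)
    show "cyclic_approximation S (m j) (\<phi> j) (\<eta> j)" for j
      using S(1) stage_facts(2) order.trans[OF S(2) suminf_\<eta>] by (rule cyclic_approximation.intro)
    show "cyclic_approximation T (m j) (\<psi> j) (\<eta> j)" for j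
      using T(1) stage_facts(3) order.trans[OF T(2) suminf_\<eta>] by (rule cyclic_approximation.intro)
  qed
qed

definition limit_vector :: "real \<Rightarrow> complex" where
  "limit_vector x = lim (\<lambda>j. f j (cell (m j) x))"

lemma f_step: assumes "x \<in> {0..<1}"
  shows "cmod (f (Suc j) (cell (m (Suc j)) x) - f j (cell (m j) x)) \<le> \<eta> j / 2"
proof -
  have "cell (m (Suc j)) x div r j = cell (m j) x"
    using assms link_facts(1)[of j] by (simp add: link_facts(2) cell_div)
  then show ?thesis using link_facts(3,4)[of j] stage_facts(6)[of j] by (simp add: link_facts(6))
qed

text \<open>The factor \<open>1 - (1/2) ^ i\<close> is a partial geometric sum, kept to make the
  induction close.\<close>

lemma f_close: assumes "x \<in> {0..<1}"
  shows "cmod (f (i + j) (cell (m (i + j)) x) - f j (cell (m j) x)) \<le> \<eta> j * (1 - (1/2) ^ i)"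
proof (induction i)
  case (Suc i)
  have "cmod (f (Suc (i + j)) (cell (m (Suc (i + j))) x) - f j (cell (m j) x)) \<le>
      cmod (f (Suc (i + j)) (cell (m (Suc (i + j))) x) - f (i + j) (cell (m (i + j)) x)) +
      cmod (f (i + j) (cell (m (i + j)) x) - f j (cell (m j) x))"
    by (rule norm_diff_triangle_ineq[of _ _ "f (i + j) (cell (m (i + j)) x)" "f j (cell (m j) x)", simplified] order.trans[OF _ norm_triangle_ineq], simp)
  also have "\<dots> \<le> \<eta> j * (1/2) ^ i / 2 + \<eta> j * (1 - (1/2) ^ i)"
    using f_step[OF assms, of "i + j"] \<eta>_decay[of i j] Suc by linarith
  also have "\<dots> = \<eta> j * (1 - (1/2) ^ Suc i)" by (simp add: algebra_simps)
  finally show ?case by simp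
qed simp

lemma limit_vector_LIMSEQ: assumes "x \<in> {0..<1}" shows "(\<lambda>j. f j (cell (m j) x)) \<longlonglongrightarrow> limit_vector x"
proof -
  have "Cauchy (\<lambda>j. f j (cell (m j) x))"
  proof (rule metric_CauchyI)
    fix e :: real assume e: "e > 0"
    then obtain J where J: "(1/2::real) ^ J < e / 2" using real_arch_pow_inv[of "e/2" "1/2"] by auto
    have "dist (f i (cell (m i) x)) (f J (cell (m J) x)) < e / 2" if "i \<ge> J" for i
    proof -
      have "dist (f i (cell (m i) x)) (f J (cell (m J) x)) \<le> \<eta> J * (1 - (1/2) ^ (i - J))"
        using f_close[OF assms, of "i - J" J] that by (simp add: dist_norm)
      also have "\<dots> \<le> \<eta> J * 1" using stage_facts(6)[of J] by (intro mult_left_mono) auto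
      also have "\<dots> < e / 2" using \<eta>_half_power[of J] J by simp
      finally show ?thesis .
    qed
    then have "dist (f i (cell (m i) x)) (f k (cell (m k) x)) < e" if "i \<ge> J" "k \<ge> J" for i k
      using dist_triangle_half_l[of _ "f J (cell (m J) x)" e] that by blast
    then show "\<exists>J. \<forall>i\<ge>J. \<forall>k\<ge>J. dist (f i (cell (m i) x)) (f k (cell (m k) x)) < e" by blast
  qed
  then show ?thesis unfolding limit_vector_def by (simp add: Cauchy_convergent_iff convergent_LIMSEQ_iff)
qed

lemma limit_vector_close: assumes "x \<in> {0..<1}" shows "cmod (limit_vector x - f j (cell (m j) x)) \<le> \<eta> j"
proof (rule Lim_norm_ubound)
  show "(\<lambda>i. f (i + j) (cell (m (i + j)) x) - f j (cell (m j) x)) \<longlonglongrightarrow> limit_vector x - f j (cell (m j) x)"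
    by (intro tendsto_diff tendsto_const LIMSEQ_ignore_initial_segment limit_vector_LIMSEQ assms)
  have "\<eta> j * (1 - (1/2) ^ i) \<le> \<eta> j * 1" for i using stage_facts(6)[of j] by (intro mult_left_mono) auto
  then show "\<forall>\<^sub>F i in sequentially. cmod (f (i + j) (cell (m (i + j)) x) - f j (cell (m j) x)) \<le> \<eta> j"
    using f_close[OF assms, of _ j] by (intro always_eventually allI) (metis mult.right_neutral order.trans)
qed simp

lemma limit_vector_bound: assumes "x \<in> {0..<1}" shows "cmod (limit_vector x) \<le> 2"
  using limit_vector_close[OF assms, of 0] stage_facts(7)[of 0] stage_facts(8)[of "cell (m 0) x"]
    norm_triangle_sub[of "limit_vector x" "f 0 (cell (m 0) x)"] by simp

lemma limit_vector_measurable: "limit_vector \<in> borel_measurable unit_interval"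
  unfolding limit_vector_def[abs_def]
  by (rule borel_measurable_lim_metric) (rule measurable_compose[OF cell_measurable], simp)

lemma limit_vector_L2: "limit_vector \<in> L2 unit_interval"
  by (rule UI.bounded_L2[OF limit_vector_measurable, of 2]) (simp add: limit_vector_bound)

lemma m_ge: "2 ^ j \<le> m j"
proof (induction j)
  case 0
  then show ?case using m_pos[of 0] by simp
next
  case (Suc j)
  have "2 ^ j * 2 \<le> m j * r j" using Suc link_facts(1)[of j] by (rule mult_le_mono)
  then show ?case by (simp add: link_facts(2))
qed

text \<open>Stated for one transformation and one family of orders, to be used for \<open>S\<close>
  and for \<open>T\<close> with the same vector.\<close>

lemma spectral_properties:
  assumes approx: "\<And>j. cyclic_approximation R (m j) (\<omega> j) (\<eta> j)"
    and tol: "\<And>j. tolerant j (m j) (\<omega> j) (f j) (\<eta> j)"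
  shows "simple_spectrum unit_interval R" "singular_spectrum unit_interval R"
proof -
  interpret k: koopman unit_interval R
    using cyclic_approximation.aut[OF approx[of 0]]
    by (intro koopman.intro koopman_axioms.intro prob_space_unit_interval)
  have small: "\<exists>j. C * (1/2::real) ^ j < e" if "e > 0" "C > 0" for C e :: real
    using real_arch_pow_inv[of "e / C" "1/2"] that by (auto simp: field_simps)
  have init: "k.in_cyclic_space limit_vector (indicator {..<c})" for c
    unfolding k.in_cyclic_space_def
  proof (intro conjI allI impI)
    have im: "(indicator {..<c} :: real \<Rightarrow> complex) \<in> borel_measurable unit_interval"
      by (intro measurable_restrict_space1 measurable_completion) simp
    show iL: "(indicator {..<c} :: real \<Rightarrow> complex) \<in> L2 unit_interval"
      by (rule UI.bounded_L2[OF im, of 1]) (simp add: indicator_def)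
    fix e :: real assume "e > 0"
    then obtain j where j: "4 * (1/2::real) ^ j < e" using small[of e 4] by auto
    interpret ca: cyclic_approximation R "m j" "\<omega> j" "\<eta> j" by (rule approx)
    \<comment> \<open>Keeping only cells entirely to the left of \<open>c\<close> confines the error
      to the cell that \<open>c\<close> cuts.\<close>
    define A where "A = {k\<in>{..<m j}. (real k + 1) / real (m j) \<le> c}"
    have "A \<subseteq> {..<m j}" by (auto simp: A_def)
    then obtain b where b: "\<And>k. k < m j \<Longrightarrow> (\<Sum>i<m j. b i * f j ((next_in (m j) (\<omega> j) ^^ i) k)) = of_bool (k \<in> A)"
      and bt: "(1 + 2 * (\<Sum>i<m j. cmod (b i)))\<^sup>2 * (real (m j) + 1) * \<eta> j \<le> (1/2) ^ j"
      using tol[of j] unfolding tolerant_def by blast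
    have 1: "(LINT x|unit_interval. (cmod (of_bool (cell (m j) x \<in> A) - (\<Sum>i<m j. b i * k.U (- int i) limit_vector x)))\<^sup>2) \<le> (1/2) ^ j"
      using ca.indicator_approximation[OF limit_vector_measurable limit_vector_bound limit_vector_close stage_facts(6,7) b] bt by linarith
    have bm: "(\<lambda>x. of_bool (cell (m j) x \<in> A) :: complex) \<in> borel_measurable unit_interval"
      by (rule measurable_compose[OF cell_measurable]) simp
    have bL: "(\<lambda>x. of_bool (cell (m j) x \<in> A) :: complex) \<in> L2 unit_interval"
      by (rule UI.bounded_L2[OF bm, of 1]) simp
    \<comment> \<open>The only cell that \<open>c\<close> can cut; the intersection with
      \<open>{..<m j}\<close> below takes care of \<open>c\<close> outside the interval.\<close>
    define k0 where "k0 = nat \<lfloor>real (m j) * c\<rfloor>"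
    define D where "D = {x\<in>{0..<1}. cell (m j) x \<in> {k0} \<inter> {..<m j}}"
    have D: "D \<in> sets unit_interval"
    proof -
      have "cell (m j) -` ({k0} \<inter> {..<m j}) \<inter> space unit_interval \<in> sets unit_interval"
        by (rule measurable_sets[OF cell_measurable]) simp
      moreover have "cell (m j) -` ({k0} \<inter> {..<m j}) \<inter> space unit_interval = D" by (auto simp: D_def)
      ultimately show ?thesis by simp
    qed
    have "card ({k0} \<inter> {..<m j}) \<le> card {k0}" by (rule card_mono) auto
    then have Dm: "measure unit_interval D \<le> 1 / real (m j)"
      unfolding D_def by (subst measure_cell_in[OF m_pos]) (auto intro!: divide_right_mono)
    have 2: "(LINT x|unit_interval. (cmod (indicator {..<c} x - of_bool (cell (m j) x \<in> A)))\<^sup>2) \<le> 0\<^sup>2 + 1\<^sup>2 * (1 / real (m j))"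
    proof (rule integral_sq_le[OF _ D Dm])
      show "(\<lambda>x. indicator {..<c} x - of_bool (cell (m j) x \<in> A) :: complex) \<in> borel_measurable unit_interval"
        using im bm by measurable
      fix x :: real assume x: "x \<in> {0..<1}"
      show "cmod (indicator {..<c} x - of_bool (cell (m j) x \<in> A)) \<le> 1" by (simp add: indicator_def)
      assume nD: "x \<notin> D"
      have cb: "real (cell (m j) x) / real (m j) \<le> x" "x < (real (cell (m j) x) + 1) / real (m j)" "cell (m j) x < m j"
        using cell_bounds[OF m_pos[of j], of x] cell_less[OF x m_pos[of j]] x by auto
      have "x < c \<longleftrightarrow> cell (m j) x \<in> A"
      proof
        assume xc: "x < c"
        show "cell (m j) x \<in> A"
        proof (rule ccontr)
          assume "cell (m j) x \<notin> A"
          then have "c < (real (cell (m j) x) + 1) / real (m j)" using cb(3) by (auto simp: A_def)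
          moreover have "real (cell (m j) x) / real (m j) < c" using cb(1) xc by linarith
          ultimately have "real (m j) * c < real (cell (m j) x) + 1" "real (cell (m j) x) \<le> real (m j) * c"
            using m_pos[of j] by (simp_all add: field_simps)
          then have "\<lfloor>real (m j) * c\<rfloor> = int (cell (m j) x)" by (intro floor_unique) auto
          then have "cell (m j) x = k0" by (simp add: k0_def)
          then show False using nD x cb(3) by (simp add: D_def)
        qed
      qed (use cb in \<open>auto simp: A_def\<close>)
      then show "cmod (indicator {..<c} x - of_bool (cell (m j) x \<in> A)) \<le> 0" by (simp add: indicator_def)
    qed
    have 3: "1 / real (m j) \<le> (1/2) ^ j"
    proof -
      have "(2::real) ^ j \<le> real (m j)" using m_ge[of j] by (metis of_nat_le_iff of_nat_numeral of_nat_power)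
      then show ?thesis by (simp add: power_divide frac_le)
    qed
    have "(LINT x|unit_interval. (cmod ((indicator {..<c} x - of_bool (cell (m j) x \<in> A)) +
        (of_bool (cell (m j) x \<in> A) - (\<Sum>i<m j. b i * k.U (- int i) limit_vector x))))\<^sup>2) \<le>
      2 * (LINT x|unit_interval. (cmod (indicator {..<c} x - of_bool (cell (m j) x \<in> A)))\<^sup>2) +
      2 * (LINT x|unit_interval. (cmod (of_bool (cell (m j) x \<in> A) - (\<Sum>i<m j. b i * k.U (- int i) limit_vector x)))\<^sup>2)"
      by (intro integral_cmod_add_sq_le L2_diff iL bL k.L2_trig limit_vector_L2)
    also have "\<dots> < e" using 1 2 3 j by simp
    finally have "(LINT x|unit_interval. (cmod (indicator {..<c} x - (\<Sum>i<m j. b i * k.U (- int i) limit_vector x)))\<^sup>2) < e" by simp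
    then show "\<exists>n d \<kappa>. (LINT x|unit_interval. (cmod (indicator {..<c} x - (\<Sum>i<(n::nat). d i * k.U (\<kappa> i) limit_vector x)))\<^sup>2) < e"
      by (intro exI[of _ "m j"] exI[of _ b] exI[of _ "\<lambda>i. - int i"])
  qed
  have cyc: "k.approx_cyclic limit_vector"
    by (rule approx_cyclic_unit_interval[OF k.automorphism limit_vector_L2 init])
  have rig: "k.rigid_vector limit_vector"
    unfolding k.rigid_vector_def
  proof (intro allI impI)
    fix e :: real assume "e > 0"
    then obtain j where j: "20 * (1/2::real) ^ j < e" using small[of e 20] by auto
    interpret ca: cyclic_approximation R "m j" "\<omega> j" "\<eta> j" by (rule approx)
    \<comment> \<open>Any admissible set of cells will do: the factor containing \<open>b\<close> is
      at least 1, so the tolerance bounds \<open>(real (m j) + 1) * \<eta> j\<close>.\<close>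
    obtain b where bt: "(1 + 2 * (\<Sum>i<m j. cmod (b i)))\<^sup>2 * (real (m j) + 1) * \<eta> j \<le> (1/2) ^ j"
      using tol[of j] unfolding tolerant_def by blast
    define B where "B = 1 + 2 * (\<Sum>i<m j. cmod (b i))"
    have "1 \<le> B" by (simp add: B_def sum_nonneg)
    then have "1 * ((real (m j) + 1) * \<eta> j) \<le> B\<^sup>2 * ((real (m j) + 1) * \<eta> j)"
      using stage_facts(6)[of j] by (intro mult_right_mono) (auto simp: one_le_power)
    then have "(real (m j) + 1) * \<eta> j \<le> B\<^sup>2 * ((real (m j) + 1) * \<eta> j)" by (simp only: mult_1_left)
    also have "\<dots> \<le> (1/2) ^ j" using bt by (simp only: B_def mult.assoc)
    finally have "(real (m j) + 1) * \<eta> j \<le> (1/2) ^ j" .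
    then have "(LINT x|unit_interval. (cmod (k.U (- int (m j)) limit_vector x - limit_vector x))\<^sup>2) < e"
      using ca.rigid_approximation[OF limit_vector_measurable limit_vector_bound limit_vector_close stage_facts(6,7)] j by linarith
    then show "\<exists>r. r \<noteq> 0 \<and> (LINT x|unit_interval. (cmod (k.U r limit_vector x - limit_vector x))\<^sup>2) < e"
      using m_pos[of j] by (intro exI[of _ "- int (m j)"]) simp
  qed
  show "simple_spectrum unit_interval R" by (rule k.simple_spectrum_if_approx_cyclic[OF cyc])
  show "singular_spectrum unit_interval R" by (rule k.singular_spectrum_if_cyclic_rigid[OF cyc rig])
qed

end

text \<open>Off the two deviating sets, each of measure at most \<open>real K * \<eta>\<close>, both
  orbits follow their cycles up to time \<open>K\<close>, and the half of the interval is decided by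
  the cell.\<close>

lemma measure_both_low:
  assumes S: "cyclic_approximation S m \<phi> \<eta>" and T: "cyclic_approximation T m \<psi> \<eta>"
    and m: "even m" and u: "u \<le> K" and v: "v \<le> K"
  shows "\<bar>measure unit_interval {x\<in>{0..<1}. (inv_into {0..<1} S ^^ u) x < 1/2 \<and> (inv_into {0..<1} T ^^ v) x < 1/2}
    - real (card (both_low m \<phi> \<psi> u v)) / real m\<bar> \<le> 2 * (real K * \<eta>)"
proof -
  interpret S: cyclic_approximation S m \<phi> \<eta> by fact
  interpret T: cyclic_approximation T m \<psi> \<eta> by fact
  let ?A = "{x\<in>{0..<1}. (S.F ^^ u) x < 1/2 \<and> (T.F ^^ v) x < 1/2}"
  let ?B = "{x\<in>{0..<1}. cell m x \<in> both_low m \<phi> \<psi> u v}"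
  let ?D = "S.deviating K \<union> T.deviating K"
  have [measurable]: "S.F ^^ u \<in> borel_measurable unit_interval" "T.F ^^ v \<in> borel_measurable unit_interval"
    using measurable_compose[OF S.F_pow_measurable id_measurable_unit_interval]
      measurable_compose[OF T.F_pow_measurable id_measurable_unit_interval] by simp_all
  have A: "?A \<in> sets unit_interval"
  proof -
    have "{x\<in>space unit_interval. (S.F ^^ u) x < 1/2 \<and> (T.F ^^ v) x < 1/2} \<in> sets unit_interval" by measurable
    then show ?thesis by simp
  qed
  have B: "?B \<in> sets unit_interval"
  proof -
    have "cell m -` both_low m \<phi> \<psi> u v \<inter> space unit_interval \<in> sets unit_interval"
      by (rule measurable_sets[OF cell_measurable]) simp
    moreover have "cell m -` both_low m \<phi> \<psi> u v \<inter> space unit_interval = ?B" by auto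
    ultimately show ?thesis by (simp only:)
  qed
  have D: "?D \<in> sets unit_interval" using S.deviating_sets T.deviating_sets by auto
  have "measure unit_interval ?D \<le> measure unit_interval (S.deviating K) + measure unit_interval (T.deviating K)"
    by (rule measure_Un_le[OF S.deviating_sets T.deviating_sets])
  then have Dm: "measure unit_interval ?D \<le> 2 * (real K * \<eta>)"
    using S.measure_deviating[of K] T.measure_deviating[of K] by linarith
  have AB: "x \<in> ?A \<longleftrightarrow> x \<in> ?B" if x: "x \<in> {0..<1}" and nD: "x \<notin> ?D" for x
  proof -
    have "(S.F ^^ u) x < 1/2 \<longleftrightarrow> (next_in m \<phi> ^^ u) (cell m x) < m div 2"
      using S.not_deviating[OF x, of K u] nD u S.F_pow_space[OF x, of u]
        cell_less_half_iff[OF m S.m_pos, of "(S.F ^^ u) x"] by auto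
    moreover have "(T.F ^^ v) x < 1/2 \<longleftrightarrow> (next_in m \<psi> ^^ v) (cell m x) < m div 2"
      using T.not_deviating[OF x, of K v] nD v T.F_pow_space[OF x, of v]
        cell_less_half_iff[OF m T.m_pos, of "(T.F ^^ v) x"] by auto
    ultimately show ?thesis using x cell_less[OF x S.m_pos] by (simp add: both_low_def)
  qed
  have "measure unit_interval ?A \<le> measure unit_interval (?B \<union> ?D)"
    using B D AB by (intro UI.finite_measure_mono) blast+
  also have "\<dots> \<le> measure unit_interval ?B + measure unit_interval ?D"
    by (rule measure_Un_le[OF B D])
  finally have 1: "measure unit_interval ?A \<le> measure unit_interval ?B + measure unit_interval ?D" .
  have "measure unit_interval ?B \<le> measure unit_interval (?A \<union> ?D)"
    using A D AB by (intro UI.finite_measure_mono) blast+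
  also have "\<dots> \<le> measure unit_interval ?A + measure unit_interval ?D"
    by (rule measure_Un_le[OF A D])
  finally have 2: "measure unit_interval ?B \<le> measure unit_interval ?A + measure unit_interval ?D" .
  have "measure unit_interval ?B = real (card (both_low m \<phi> \<psi> u v)) / real m"
    by (rule measure_cell_in[OF S.m_pos]) (auto simp: both_low_def)
  then show ?thesis using 1 2 Dm by linarith
qed

context construction
begin

lemma averages_diverge:
  assumes S: "\<And>j. cyclic_approximation S (m j) (\<phi> j) (\<eta> j)" and T: "\<And>j. cyclic_approximation T (m j) (\<psi> j) (\<eta> j)"
  shows "\<not> convergent (\<lambda>N. (1 / real N) * (\<Sum>n=1..N. measure unit_interval
    (iterate unit_interval S (p n) ` {0..<1/2} \<inter> iterate unit_interval T (q n) ` {0..<1/2})))"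
    (is "\<not> convergent ?avg")
proof
  define M where "M n = measure unit_interval
    (iterate unit_interval S (p n) ` {0..<1/2} \<inter> iterate unit_interval T (q n) ` {0..<1/2})" for n
  have M01: "0 \<le> M n" "M n \<le> 1" for n by (simp_all add: M_def)
  \<comment> \<open>Two deviating sets contribute, each of measure at most
    \<open>real (P j) * \<eta> (Suc j) \<le> 1/100\<close>.\<close>
  have close: "\<bar>M n - real (card (both_low (m (Suc j)) (\<phi> (Suc j)) (\<psi> (Suc j)) (nat (p n)) (nat (q n)))) / real (m (Suc j))\<bar> \<le> 2/100"
    if n: "n \<in> {a j..N j}" for n j
  proof -
    interpret S: cyclic_approximation S "m (Suc j)" "\<phi> (Suc j)" "\<eta> (Suc j)" by (rule S)
    interpret T: cyclic_approximation T "m (Suc j)" "\<psi> (Suc j)" "\<eta> (Suc j)" by (rule T)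
    note w = link_window[OF n]
    have "S.It (p n) ` {0..<1/2} \<inter> T.It (q n) ` {0..<1/2} =
        {x\<in>{0..<1}. (S.F ^^ nat (p n)) x < 1/2 \<and> (T.F ^^ nat (q n)) x < 1/2}"
      using S.image_iterate[of "{0..<1/2}" "nat (p n)"] T.image_iterate[of "{0..<1/2}" "nat (q n)"]
        S.F_pow_space[of _ "nat (p n)"] T.F_pow_space[of _ "nat (q n)"] w by auto
    then show ?thesis
      using measure_both_low[OF S.cyclic_approximation_axioms T.cyclic_approximation_axioms stage_facts(1), of "nat (p n)" "P j" "nat (q n)"]
        w link_facts(10)[of j] by (simp add: M_def nat_le_iff)
  qed
  \<comment> \<open>\<open>49/100 - 2/100\<close> on at least nine tenths of the indices exceeds
    \<open>42/100\<close>.\<close>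
  have high: "42/100 \<le> ?avg (N j)" if "even j" for j
  proof -
    have NJ: "0 < real (N j)" "10 * real (a j) \<le> real (N j)" using link_facts(8,9)[of j] by linarith+
    have "(\<Sum>n=1..N j. 47/100 * of_bool (a j < n)) \<le> (\<Sum>n=1..N j. M n)"
    proof (rule sum_mono)
      fix n assume n: "n \<in> {1..N j}"
      show "47/100 * of_bool (a j < n) \<le> M n"
      proof (cases "a j < n")
        case True
        then have n': "n \<in> {a j..N j}" using n by auto
        have "49/100 * real (m (Suc j)) \<le> real (card (both_low (m (Suc j)) (\<phi> (Suc j)) (\<psi> (Suc j)) (nat (p n)) (nat (q n))))"
          using link_window(5)[OF n'] that by simp
        then have "49/100 \<le> real (card (both_low (m (Suc j)) (\<phi> (Suc j)) (\<psi> (Suc j)) (nat (p n)) (nat (q n)))) / real (m (Suc j))"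
          using m_pos[of "Suc j"] by (simp add: pos_le_divide_eq)
        then have "47/100 \<le> M n" using close[OF n'] by linarith
        then show ?thesis using True by simp
      qed (simp add: M01)
    qed
    moreover have "(\<Sum>n=1..N j. 47/100 * of_bool (a j < n)) = 47/100 * (real (N j) - real (a j))"
    proof -
      have "(\<Sum>n=1..N j. of_bool (a j < n) :: real) = (\<Sum>n\<in>{a j<..N j}. 1)"
        by (rule sum.mono_neutral_cong_right) auto
      also have "\<dots> = real (N j) - real (a j)" using link_facts(9)[of j] by (simp add: of_nat_diff)
      finally show ?thesis by (simp only: sum_distrib_left[symmetric])
    qed
    ultimately have "47/100 * (real (N j) - real (a j)) \<le> (\<Sum>n=1..N j. M n)" by simp
    then have "42/100 * real (N j) \<le> (\<Sum>n=1..N j. M n)" using NJ by (simp add: field_simps)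
    then show ?thesis using NJ(1) by (simp add: M_def[symmetric] pos_le_divide_eq)
  qed
  \<comment> \<open>\<open>1/100 + 2/100\<close> on the window, and the trivial bound 1 on at most a
    tenth of the indices, stay below \<open>14/100\<close>.\<close>
  have low: "?avg (N j) \<le> 14/100" if "odd j" for j
  proof -
    have NJ: "0 < real (N j)" "10 * real (a j) \<le> real (N j)" using link_facts(8,9)[of j] by linarith+
    have "(\<Sum>n=1..N j. M n) \<le> (\<Sum>n=1..N j. 3/100 + of_bool (n \<le> a j))"
    proof (rule sum_mono)
      fix n assume n: "n \<in> {1..N j}"
      show "M n \<le> 3/100 + of_bool (n \<le> a j)"
      proof (cases "n \<le> a j")
        case True
        then show ?thesis using M01(2)[of n] by simp
      next
        case False
        then have n': "n \<in> {a j..N j}" using n by auto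
        have "real (card (both_low (m (Suc j)) (\<phi> (Suc j)) (\<psi> (Suc j)) (nat (p n)) (nat (q n)))) \<le> 1/100 * real (m (Suc j))"
          using link_window(5)[OF n'] that by simp
        then have "real (card (both_low (m (Suc j)) (\<phi> (Suc j)) (\<psi> (Suc j)) (nat (p n)) (nat (q n)))) / real (m (Suc j)) \<le> 1/100"
          using m_pos[of "Suc j"] by (simp add: pos_divide_le_eq)
        then have "M n \<le> 3/100" using close[OF n'] by linarith
        then show ?thesis using False by simp
      qed
    qed
    also have "\<dots> = 3/100 * real (N j) + real (a j)"
    proof -
      have "(\<Sum>n=1..N j. of_bool (n \<le> a j) :: real) = (\<Sum>n\<in>{1..a j}. 1)"
        using link_facts(9)[of j] by (intro sum.mono_neutral_cong_right) auto
      then show ?thesis by (simp add: sum.distrib)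
    qed
    finally have "(\<Sum>n=1..N j. M n) \<le> 14/100 * real (N j)" using NJ by linarith
    then show ?thesis using NJ(1) by (simp add: M_def[symmetric] pos_divide_le_eq)
  qed
  assume "convergent ?avg"
  then obtain l where "?avg \<longlonglongrightarrow> l" by (auto simp: convergent_def)
  then obtain J where J: "\<And>n. n \<ge> J \<Longrightarrow> \<bar>?avg n - l\<bar> < 1/10"
    using LIMSEQ_D[of ?avg l "1/10"] by auto
  \<comment> \<open>Since \<open>j \<le> N j\<close>, both indices lie beyond \<open>J\<close>; two
    averages within \<open>1/10\<close> of \<open>l\<close> cannot differ by
    \<open>28/100\<close>.\<close>
  have "\<bar>?avg (N (2 * J)) - l\<bar> < 1/10" "\<bar>?avg (N (Suc (2 * J))) - l\<bar> < 1/10"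
    using link_facts(7)[of "2 * J"] link_facts(7)[of "Suc (2 * J)"] by (intro J; linarith)+
  moreover have "42/100 \<le> ?avg (N (2 * J))" "?avg (N (Suc (2 * J))) \<le> 14/100"
    by (intro high low; simp)+
  ultimately show False by linarith
qed

end

theorem theorem2:
  fixes p q :: "nat \<Rightarrow> int"
  assumes "filterlim (\<lambda>n. p (n + 1) - p n) at_top sequentially"
    and "filterlim (\<lambda>n. q (n + 1) - q n) at_top sequentially"
  shows "\<exists>(M :: real measure) S T.
    lebesgue_probability_space M \<and>
    automorphism M S \<and> simple_spectrum M S \<and> singular_spectrum M S \<and>
    automorphism M T \<and> simple_spectrum M T \<and> singular_spectrum M T \<and>
    (\<exists>C\<in>sets M.
      \<not> convergent (\<lambda>N. (1 / real N) *
          (\<Sum>n=1..N. measure M (iterate M S (p n) ` C \<inter> iterate M T (q n) ` C))))"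
proof -
  \<comment> \<open>Dependent choice is needed because the tolerance of a stage is fixed by data of
    that stage and limits the next one.\<close>
  have "\<exists>s. \<forall>j. stage j (s j) \<and> (\<exists>r t a N P. linked p q j (s j) (s (Suc j)) r t a N P)"
    by (rule dependent_nat_choice) (use stage_initial stage_step[OF assms] in auto)
  then obtain s where s: "\<And>j. stage j (s j)"
    and l: "\<And>j. \<exists>r t a N P. linked p q j (s j) (s (Suc j)) r t a N P" by blast
  obtain r t a N P where l': "\<And>j. linked p q j (s j) (s (Suc j)) (r j) (t j) (a j) (N j) (P j)"
    using l by metis
  define m where "m j = fst (s j)" for j
  define \<phi> where "\<phi> j = fst (snd (s j))" for j
  define \<psi> where "\<psi> j = fst (snd (snd (s j)))" for j
  define f where "f j = fst (snd (snd (snd (s j))))" for j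
  define \<eta> where "\<eta> j = snd (snd (snd (snd (s j))))" for j
  have sj: "s j = (m j, \<phi> j, \<psi> j, f j, \<eta> j)" for j
    by (simp add: m_def \<phi>_def \<psi>_def f_def \<eta>_def)
  interpret construction p q m \<phi> \<psi> f \<eta> r t a N P
    by (rule construction.intro) (use s l' in \<open>simp_all only: sj\<close>)
  obtain S T where S: "\<And>j. cyclic_approximation S (m j) (\<phi> j) (\<eta> j)"
    and T: "\<And>j. cyclic_approximation T (m j) (\<psi> j) (\<eta> j)"
    using approximations by blast
  have C: "{0..<1/2::real} \<in> sets unit_interval" by (subst sets_restrict_space_iff) auto
  show ?thesis
    using lebesgue_probability_space_unit_interval cyclic_approximation.aut[OF S[of 0]] cyclic_approximation.aut[OF T[of 0]]
      spectral_properties[OF S stage_facts(4)] spectral_properties[OF T stage_facts(5)] averages_diverge[OF S T] C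
    by blast
qed

end
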